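(* Let $\beta>1$. (i) For each $t\in\mathscr{B}_\beta$, $$\lim_{\varepsilon\searrow 0}\dim_H\big(\mathscr{E}_\beta\cap(t-\varepsilon,t+\varepsilon)\big)=\lim_{\varepsilon\searrow 0}\dim_H\big(\mathscr{E}_\beta\cap[t,t+\varepsilon)\big)=\dim_H K_\beta(t).$$ (ii) If $\alpha(\beta)$ is eventually periodic, then for each $t\in\mathscr{B}_\beta$ we also have $$\lim_{\varepsilon\searrow 0}\dim_H\big(\mathscr{B}_\beta\cap(t-\varepsilon,t+\varepsilon)\big)=\lim_{\varepsilon\searrow 0}\dim_H\big(\mathscr{B}_\beta\cap[t,t+\varepsilon)\big)=\dim_H K_\beta(t).$$
   Context: For $\beta>1$ let $T_\beta:[0,1)\to[0,1)$, $T_\beta(x)=\beta x \bmod 1$. For $t\ge 0$ let $K_\beta(t)=\{x\in[0,1): T_\beta^n(x)\ge t\ \text{for all } n\ge 0\}$. Define $$\mathscr{E}_\beta=\{t\in[0,1): K_\beta(t')\ne K_\beta(t)\ \text{for all } t'>t\},$$ $$\mathscr{B}_\beta=\{t\ge 0: \dim_H K_\beta(t')<\dim_H K_\beta(t)\ \text{for all } t'>t\}.$$ Let $A_\beta=\{0,1,\dots,\lceil\beta\rceil-1\}$. The quasi-greedy expansion $\alpha(\beta)$ of $1$ in base $\beta$ is the lexicographically largest sequence $(d_i)\in A_\beta^{\mathbb N}$ not ending in $0^\infty$ with $\sum_{i\ge1}d_i\beta^{-i}=1$. $\dim_H$ denotes Hausdorff dimension. *)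

theory Defs
  imports "HOL-Analysis.Analysis" "HOL-Library.Fun_Lexorder"
begin

section \<open>Hausdorff dimension\<close>

text \<open>
  The usual convention \<open>0\<^sup>0 = 1\<close> for nonempty sets is made explicit, since
  \<open>0 powr 0 = 0\<close> in HOL; the empty set contributes \<open>0\<close> for every \<open>s\<close>.
\<close>

definition diam_pow :: "real \<Rightarrow> 'a::metric_space set \<Rightarrow> ennreal" where
  "diam_pow s U =
     (if U = {} then 0 else if s = 0 then 1 else ennreal (diameter U powr s))"

text \<open>
  Boundedness is required because \<^const>\<open>diameter\<close> is unspecified on unbounded sets.
  Sequences of sets also cover the case of finite covers, as the sets may be empty.
\<close>

definition hausdorff_premeasure :: "real \<Rightarrow> real \<Rightarrow> 'a::metric_space set \<Rightarrow> ennreal" where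
  "hausdorff_premeasure s \<delta> A =
     Inf {(\<Sum>i. diam_pow s (U i)) | U :: nat \<Rightarrow> 'a set.
            A \<subseteq> (\<Union>i. U i) \<and> (\<forall>i. bounded (U i) \<and> diameter (U i) \<le> \<delta>)}"

definition hausdorff_measure :: "real \<Rightarrow> 'a::metric_space set \<Rightarrow> ennreal" where
  "hausdorff_measure s A = (SUP \<delta>\<in>{0<..}. hausdorff_premeasure s \<delta> A)"

text \<open>With this definition the empty set has dimension \<open>0\<close>.\<close>

definition hausdorff_dim :: "'a::metric_space set \<Rightarrow> ennreal" where
  "hausdorff_dim A = Inf {ennreal s | s. 0 \<le> s \<and> hausdorff_measure s A = 0}"

section \<open>The \<open>\<beta>\<close>-transformation and its survivor sets\<close>

definition beta_map :: "real \<Rightarrow> real \<Rightarrow> real" where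
  "beta_map \<beta> x = frac (\<beta> * x)"

definition survivor_set :: "real \<Rightarrow> real \<Rightarrow> real set" where
  "survivor_set \<beta> t = {x \<in> {0..<1}. \<forall>n. (beta_map \<beta> ^^ n) x \<ge> t}"

definition set_bifurcation :: "real \<Rightarrow> real set" where
  "set_bifurcation \<beta> =
     {t \<in> {0..<1}. \<forall>t'>t. survivor_set \<beta> t' \<noteq> survivor_set \<beta> t}"

definition dim_bifurcation :: "real \<Rightarrow> real set" where
  "dim_bifurcation \<beta> =
     {t. t \<ge> 0 \<and> (\<forall>t'>t. hausdorff_dim (survivor_set \<beta> t') < hausdorff_dim (survivor_set \<beta> t))}"

section \<open>The quasi-greedy expansion of \<open>1\<close>\<close>

text \<open>Sequences are indexed from \<open>0\<close>: \<open>d i\<close> is the digit usually written \<open>d\<^sub>i\<^sub>+\<^sub>1\<close>.\<close>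

definition infinite_expansion_of_one :: "real \<Rightarrow> (nat \<Rightarrow> nat) \<Rightarrow> bool" where
  "infinite_expansion_of_one \<beta> d \<longleftrightarrow>
     (\<forall>i. int (d i) \<in> {0..\<lceil>\<beta>\<rceil> - 1}) \<and>
     (\<forall>m. \<exists>i\<ge>m. d i \<noteq> 0) \<and>
     (\<lambda>i. real (d i) / \<beta> ^ (i + 1)) sums 1"

definition quasi_greedy :: "real \<Rightarrow> nat \<Rightarrow> nat" where
  "quasi_greedy \<beta> =
     (THE d. infinite_expansion_of_one \<beta> d \<and>
        (\<forall>e. infinite_expansion_of_one \<beta> e \<longrightarrow> e = d \<or> less_fun e d))"

definition eventually_periodic :: "(nat \<Rightarrow> 'a) \<Rightarrow> bool" where
  "eventually_periodic d \<longleftrightarrow> (\<exists>m. \<exists>p>0. \<forall>i\<ge>m. d (i + p) = d i)"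

end

theory Submission
  imports Defs
begin

text \<open>
  Reading expansions from left to right, the possible continuations of a word form an interval
  \<open>[a, b)\<close> (Hofbauer's tower). If a path stays outside a finite set of low states, then each end of
  its interval is reset at most once in a long time, so such paths have almost no entropy.
  Hence, with \<open>s = dim K(t)\<close>, some low state \<open>v\<close> has so many loops that their weights
  \<open>\<beta>\<^sup>-\<^sup>s\<^sup>n\<close> sum to infinity. Loops at \<open>v\<close> can be concatenated freely, and finitely many of them generate a
  self-similar set \<open>Z \<subseteq> K(r)\<close>, \<open>r > t\<close>, of dimension almost \<open>s\<close>.

  If \<open>t\<close> is a bifurcation point of the dimension, then the loops at \<open>v\<close> are not confined to \<open>K(t')\<close> for any
  \<open>t' > t\<close>, so some loop \<open>l\<close> comes arbitrarily close to \<open>t\<close>. The minimal orbit points of the points \<open>l z\<close>,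
  \<open>z \<in> Z\<close>, lie in the bifurcation set close to \<open>t\<close>, which gives the lower bound in (i). The upper bound is
  left continuity of the dimension.

  In (ii) the right ends \<open>b\<close> take finitely many values. Hence the states from which \<open>t\<close> can be approached
  at nearly full entropy are all connected with each other, unless \<open>t\<close> belongs to a countable set that
  can be avoided. If the dimension were constant on \<open>[x, x']\<close> for a minimal orbit point \<open>x\<close> as above, then
  the rich loops for the threshold \<open>x'\<close> could be combined with a loop for the threshold \<open>x\<close> that dips below
  \<open>x'\<close>; this would raise the dimension of \<open>K(x)\<close> above that of \<open>K(x')\<close>.
\<close>

section \<open>Hausdorff dimension\<close>

text \<open>A word of length n contracts by \<open>\<beta> ^ n\<close>, so its weight at exponent s
  is the s-th power of its diameter. Counts of admissible words are submultiplicative; therefore the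
  weights diverge at the critical exponent s = dim K(t) itself, and nothing is lost before Z is
  built. The states are in general infinite in number, so no transition matrix with a Perron
  eigenvalue is at hand; the finite set of low states takes its place. The gap r > t is essential:
  after the word l the orbit stays above r, hence above the dip inside l, so its minimum is taken at
  one of the finitely many suffixes of l. Thus Z is covered by finitely many similar copies of the
  set of minima. In (ii) the obstacle is that the threshold moves. Right ends do not depend on it,
  and left ends move by \<open>\<beta> ^ i * (x' - t)\<close>, so loops for x' can be compared with
  loops for t on finitely many states. At a preperiodic t a connecting path could return exactly to
  t, which would leave no room for a higher threshold.\<close>

lemma hausdorff_measure_eq_0_iff:
  "hausdorff_measure s A = 0 \<longleftrightarrow>
     (\<forall>\<delta>>0. \<forall>e>0. \<exists>U. A \<subseteq> (\<Union>i. U i) \<and> (\<forall>i. bounded (U i) \<and> diameter (U i) \<le> \<delta>) \<and>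
        (\<Sum>i::nat. diam_pow s (U i)) < ennreal e)"
proof -
  have *: "x = 0 \<longleftrightarrow> (\<forall>e>0. x < ennreal e)" for x :: ennreal
    by (cases x) (auto simp: ennreal_less_iff intro: gt_ex, metis less_irrefl order_le_less)
  have "hausdorff_measure s A = 0 \<longleftrightarrow> (\<forall>\<delta>>0. hausdorff_premeasure s \<delta> A = 0)"
    unfolding hausdorff_measure_def by (auto simp flip: bot_ennreal)
  also have "\<dots> \<longleftrightarrow> (\<forall>\<delta>>0. \<forall>e>0. hausdorff_premeasure s \<delta> A < ennreal e)"
    using * by auto
  also have "\<dots> \<longleftrightarrow> (\<forall>\<delta>>0. \<forall>e>0. \<exists>U. A \<subseteq> (\<Union>i. U i) \<and> (\<forall>i. bounded (U i) \<and> diameter (U i) \<le> \<delta>) \<and>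
        (\<Sum>i::nat. diam_pow s (U i)) < ennreal e)"
  proof -
    have "hausdorff_premeasure s \<delta> A < ennreal e \<longleftrightarrow>
        (\<exists>U. A \<subseteq> (\<Union>i. U i) \<and> (\<forall>i. bounded (U i) \<and> diameter (U i) \<le> \<delta>) \<and>
        (\<Sum>i::nat. diam_pow s (U i)) < ennreal e)" for \<delta> e
      unfolding hausdorff_premeasure_def Inf_less_iff by (rule iffI; elim bexE CollectE exE conjE; force)
    then show ?thesis by simp
  qed
  finally show ?thesis .
qed

lemma hausdorff_measure_0_coverE:
  assumes "hausdorff_measure s A = 0" "\<delta> > 0" "e > 0"
  obtains U :: "nat \<Rightarrow> 'a::metric_space set" where "A \<subseteq> (\<Union>i. U i)"
    "\<forall>i. bounded (U i) \<and> diameter (U i) \<le> \<delta>" "(\<Sum>i. diam_pow s (U i)) < ennreal e"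
proof -
  have "\<exists>U. A \<subseteq> (\<Union>i. U i) \<and> (\<forall>i. bounded (U i) \<and> diameter (U i) \<le> \<delta>) \<and>
        (\<Sum>i::nat. diam_pow s (U i)) < ennreal e"
    using iffD1[OF hausdorff_measure_eq_0_iff assms(1)] assms(2,3) by (elim allE impE) simp_all
  then show thesis using that by (elim exE conjE) simp
qed

lemma hausdorff_measure_0_subset:
  assumes "hausdorff_measure s B = 0" "A \<subseteq> B"
  shows "hausdorff_measure s A = 0"
  using assms unfolding hausdorff_measure_eq_0_iff by (meson order_trans)

lemma diam_pow_mono_exponent:
  assumes "0 \<le> s" "s \<le> s'" "bounded U" "diameter U \<le> 1"
  shows "diam_pow s' U \<le> diam_pow s U"
proof (cases "s = s' \<or> U = {} \<or> s' = 0")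
  case True
  with assms show ?thesis by (auto simp: diam_pow_def)
next
  case False
  then have "s' > 0" "s < s'" using assms by auto
  have d0: "0 \<le> diameter U" using assms diameter_ge_0 by blast
  have 1: "diameter U powr s' \<le> 1"
    using d0 assms \<open>s' > 0\<close> by (simp add: powr_le1)
  have 2: "diameter U powr s' \<le> diameter U powr s" if "s \<noteq> 0"
  proof (cases "diameter U = 0")
    case False
    then show ?thesis using d0 assms \<open>s < s'\<close> by (intro powr_mono') auto
  qed auto
  show ?thesis using 1 2 False d0 by (auto simp: diam_pow_def ennreal_leI ennreal_le_1)
qed

lemma hausdorff_measure_0_mono_exponent:
  assumes "hausdorff_measure s A = 0" "0 \<le> s" "s \<le> s'"
  shows "hausdorff_measure s' A = 0"
  unfolding hausdorff_measure_eq_0_iff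
proof (intro allI impI)
  fix \<delta> e :: real assume "\<delta> > 0" "e > 0"
  then obtain U where U: "A \<subseteq> (\<Union>i. U i)" "\<And>i. bounded (U i)" "\<And>i. diameter (U i) \<le> min \<delta> 1"
      "(\<Sum>i::nat. diam_pow s (U i)) < ennreal e"
    using assms(1) unfolding hausdorff_measure_eq_0_iff
    by (metis min_less_iff_conj zero_less_one)
  have "(\<Sum>i. diam_pow s' (U i)) \<le> (\<Sum>i. diam_pow s (U i))"
    using U assms by (intro suminf_le diam_pow_mono_exponent) auto
  with U show "\<exists>U. A \<subseteq> (\<Union>i. U i) \<and> (\<forall>i. bounded (U i) \<and> diameter (U i) \<le> \<delta>) \<and>
        (\<Sum>i::nat. diam_pow s' (U i)) < ennreal e"
    by (intro exI[of _ U]) auto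
qed

lemma hausdorff_dim_le:
  assumes "0 \<le> s" "hausdorff_measure s A = 0"
  shows "hausdorff_dim A \<le> ennreal s"
  unfolding hausdorff_dim_def using assms by (intro Inf_lower) auto

lemma hausdorff_measure_0_if_dim_less:
  assumes "hausdorff_dim A < ennreal s"
  shows "hausdorff_measure s A = 0"
proof -
  obtain s1 where s1: "0 \<le> s1" "hausdorff_measure s1 A = 0" "ennreal s1 < ennreal s"
    using assms unfolding hausdorff_dim_def Inf_less_iff by auto
  then have "s1 \<le> s" by (metis ennreal_less_iff less_imp_le)
  with s1 show ?thesis using hausdorff_measure_0_mono_exponent by blast
qed

lemma hausdorff_dim_ge:
  assumes "hausdorff_measure s A \<noteq> 0"
  shows "ennreal s \<le> hausdorff_dim A"
  using assms hausdorff_measure_0_if_dim_less not_le by blast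

lemma hausdorff_dim_mono:
  assumes "A \<subseteq> B"
  shows "hausdorff_dim A \<le> hausdorff_dim B"
  unfolding hausdorff_dim_def
  using hausdorff_measure_0_subset[OF _ assms] by (intro Inf_superset_mono) blast

lemma suminf_interleave_le:
  fixes f g :: "nat \<Rightarrow> ennreal"
  shows "(\<Sum>i. if even i then f (i div 2) else g (i div 2)) \<le> (\<Sum>i. f i) + (\<Sum>i. g i)"
proof -
  let ?h = "\<lambda>i. if even i then f (i div 2) else g (i div 2)"
  have eq: "sum ?h {..<2*N} = sum f {..<N} + sum g {..<N}" for N
    by (induction N) (auto simp: algebra_simps)
  have "sum ?h {..<N} \<le> (\<Sum>i. f i) + (\<Sum>i. g i)" for N
  proof -
    have "sum ?h {..<N} \<le> sum ?h {..<2*N}" by (intro sum_mono2) auto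
    also have "\<dots> \<le> (\<Sum>i. f i) + (\<Sum>i. g i)"
      unfolding eq by (intro add_mono sum_le_suminf) auto
    finally show ?thesis .
  qed
  then show ?thesis by (intro suminf_le_const) auto
qed

lemma hausdorff_measure_0_Un:
  assumes "hausdorff_measure s A = 0" "hausdorff_measure s B = 0"
  shows "hausdorff_measure s (A \<union> B) = 0"
  unfolding hausdorff_measure_eq_0_iff
proof (intro allI impI)
  fix \<delta> e :: real assume "\<delta> > 0" "e > 0"
  then have "e/2 > 0" by simp
  obtain U where U: "A \<subseteq> (\<Union>i. U i)" "\<And>i. bounded (U i)" "\<And>i. diameter (U i) \<le> \<delta>"
      "(\<Sum>i::nat. diam_pow s (U i)) < ennreal (e/2)"
    using assms(1) \<open>\<delta> > 0\<close> \<open>e/2 > 0\<close> unfolding hausdorff_measure_eq_0_iff by metis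
  obtain V where V: "B \<subseteq> (\<Union>i. V i)" "\<And>i. bounded (V i)" "\<And>i. diameter (V i) \<le> \<delta>"
      "(\<Sum>i::nat. diam_pow s (V i)) < ennreal (e/2)"
    using assms(2) \<open>\<delta> > 0\<close> \<open>e/2 > 0\<close> unfolding hausdorff_measure_eq_0_iff by metis
  define W where "W i = (if even i then U (i div 2) else V (i div 2))" for i :: nat
  have "A \<union> B \<subseteq> (\<Union>i. W i)"
  proof -
    have "U i \<subseteq> W (2*i)" "V i \<subseteq> W (2*i+1)" for i by (auto simp: W_def)
    then have "(\<Union>i. U i) \<subseteq> (\<Union>i. W i)" "(\<Union>i. V i) \<subseteq> (\<Union>i. W i)"
      by (meson UN_least UN_upper UNIV_I order_trans)+
    then show ?thesis using U(1) V(1) by (meson Un_least order_trans)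
  qed
  moreover have "bounded (W i) \<and> diameter (W i) \<le> \<delta>" for i
    using U V by (auto simp: W_def)
  moreover have "(\<Sum>i. diam_pow s (W i)) < ennreal e"
  proof -
    have "(\<Sum>i. diam_pow s (W i)) =
        (\<Sum>i. if even i then diam_pow s (U (i div 2)) else diam_pow s (V (i div 2)))"
      by (intro suminf_cong) (auto simp: W_def)
    also have "\<dots> \<le> (\<Sum>i. diam_pow s (U i)) + (\<Sum>i. diam_pow s (V i))"
      by (rule suminf_interleave_le)
    also have "\<dots> < ennreal (e/2) + ennreal (e/2)"
      using U(4) V(4) by (intro add_strict_mono) auto
    also have "\<dots> = ennreal e" using \<open>e > 0\<close> by (simp flip: ennreal_plus)
    finally show ?thesis .
  qed
  ultimately show "\<exists>U. A \<union> B \<subseteq> (\<Union>i. U i) \<and> (\<forall>i. bounded (U i) \<and> diameter (U i) \<le> \<delta>) \<and>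
        (\<Sum>i::nat. diam_pow s (U i)) < ennreal e"
    by blast
qed

lemma hausdorff_measure_0_finite_cover:
  assumes "finite \<U>" "A \<subseteq> \<Union>\<U>"
    and "\<And>U. U \<in> \<U> \<Longrightarrow> bounded U \<and> diameter U \<le> \<delta>" "\<delta> \<ge> 0" "s > 0"
  shows "\<exists>U. A \<subseteq> (\<Union>i. U i) \<and> (\<forall>i. bounded (U i) \<and> diameter (U i) \<le> \<delta>) \<and>
        (\<Sum>i::nat. diam_pow s (U i)) \<le> ennreal (real (card \<U>) * \<delta> powr s)"
proof -
  obtain h where h: "\<U> = h ` {..<card \<U>}" "inj_on h {..<card \<U>}"
    using assms(1) by (metis finite_imp_nat_seg_image_inj_on card_image card_lessThan lessThan_def)
  \<comment> \<open>The empty sets used as padding have \<open>diam_pow\<close> equal to 0.\<close>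
  define U where "U i = (if i < card \<U> then h i else {})" for i
  have mem: "h i \<in> \<U>" if "i < card \<U>" for i using h that by auto
  have "A \<subseteq> (\<Union>i. U i)"
  proof
    fix x assume "x \<in> A"
    then obtain i where "i < card \<U>" "x \<in> h i" using assms(2) h(1)
      by (metis (no_types, lifting) UnionE imageE lessThan_iff subsetD)
    then show "x \<in> (\<Union>i. U i)" by (intro UN_I[of i]) (auto simp: U_def)
  qed
  moreover have "bounded (U i) \<and> diameter (U i) \<le> \<delta>" for i
    using assms mem by (auto simp: U_def)
  moreover have "(\<Sum>i. diam_pow s (U i)) \<le> ennreal (real (card \<U>) * \<delta> powr s)"
  proof -
    have le: "diam_pow s (U i) \<le> ennreal (\<delta> powr s)" if "i < card \<U>" for i
      using assms mem[OF that] that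
      by (auto simp: diam_pow_def U_def intro!: ennreal_leI powr_mono2 diameter_ge_0)
    have "(\<Sum>i. diam_pow s (U i)) = (\<Sum>i<card \<U>. diam_pow s (U i))"
      by (intro suminf_finite) (auto simp: U_def diam_pow_def)
    also have "\<dots> \<le> (\<Sum>i<card \<U>. ennreal (\<delta> powr s))"
      using le by (intro sum_mono) auto
    also have "\<dots> = ennreal (real (card \<U>) * \<delta> powr s)"
      by (subst ennreal_mult) (auto simp: ennreal_of_nat_eq_real_of_nat)
    finally show ?thesis .
  qed
  ultimately show ?thesis by blast
qed

lemma hausdorff_dim_lipschitz_image:
  assumes lip: "\<And>x y. x \<in> A \<Longrightarrow> y \<in> A \<Longrightarrow> dist (h x) (h y) \<le> C * dist x y" and "C > 0"
  shows "hausdorff_dim (h ` A) \<le> hausdorff_dim A"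
proof -
  have "hausdorff_measure s (h ` A) = 0" if null: "hausdorff_measure s A = 0" "s \<ge> 0" for s
    unfolding hausdorff_measure_eq_0_iff
  proof (intro allI impI)
    fix \<delta> e :: real assume "\<delta> > 0" "e > 0"
    define e' where "e' = e / C powr s"
    have e': "e' > 0" using \<open>e > 0\<close> \<open>C > 0\<close> by (simp add: e'_def)
    have "\<delta> / C > 0" using \<open>\<delta> > 0\<close> \<open>C > 0\<close> by simp
    from hausdorff_measure_0_coverE[OF null(1) this e'] obtain U where
      U': "A \<subseteq> (\<Union>i. U i)" "\<forall>i. bounded (U i) \<and> diameter (U i) \<le> \<delta> / C"
        "(\<Sum>i::nat. diam_pow s (U i)) < ennreal e'" .
    have U: "A \<subseteq> (\<Union>i. U i)" "\<And>i. bounded (U i)" "\<And>i. diameter (U i) \<le> \<delta> / C"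
      "(\<Sum>i::nat. diam_pow s (U i)) < ennreal e'"
      using U' by simp_all
    \<comment> \<open>The Lipschitz bound is known on A only, so the cover is first cut down to
      A.\<close>
    define V where "V i = h ` (U i \<inter> A)" for i
    have dV: "dist x y \<le> C * diameter (U i)" if xy: "x \<in> V i" "y \<in> V i" for x y i
    proof -
      obtain x' y' where *: "x = h x'" "y = h y'" "x' \<in> U i" "y' \<in> U i" "x' \<in> A" "y' \<in> A"
        using xy by (auto simp: V_def)
      have "dist x y \<le> C * dist x' y'" using lip * by auto
      also have "\<dots> \<le> C * diameter (U i)"
        using diameter_bounded_bound[OF U(2)] * \<open>C > 0\<close> by auto
      finally show ?thesis .
    qed
    have bV: "bounded (V i)" for i
    proof (cases "V i = {}")
      case False
      then obtain x where "x \<in> V i" by auto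
      with dV show ?thesis unfolding bounded_def by metis
    qed auto
    have diV: "diameter (V i) \<le> C * diameter (U i)" for i
    proof (cases "V i = {}")
      case True
      then show ?thesis using \<open>C > 0\<close> diameter_ge_0[OF U(2)] by simp
    next
      case False
      then show ?thesis unfolding diameter_def[of "V i"] using dV by (auto intro!: cSUP_least)
    qed
    have "h ` A \<subseteq> (\<Union>i. V i)" using U(1) unfolding V_def by blast
    moreover have "diameter (V i) \<le> \<delta>" for i
    proof -
      have "C * diameter (U i) \<le> \<delta>" using U(3)[of i] \<open>C > 0\<close> by (simp add: field_simps)
      then show ?thesis using diV[of i] by linarith
    qed
    moreover have "(\<Sum>i. diam_pow s (V i)) < ennreal e"
    proof -
      have "diam_pow s (V i) \<le> ennreal (C powr s) * diam_pow s (U i)" for i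
      proof (cases "V i = {} \<or> s = 0")
        case True
        then show ?thesis using \<open>C > 0\<close> by (auto simp: diam_pow_def V_def)
      next
        case False
        have "diameter (V i) powr s \<le> (C * diameter (U i)) powr s"
          using diV bV diameter_ge_0 that(2) by (intro powr_mono2) auto
        also have "\<dots> = C powr s * diameter (U i) powr s"
          using \<open>C > 0\<close> diameter_ge_0[OF U(2)] by (simp add: powr_mult)
        finally have "ennreal (diameter (V i) powr s) \<le> ennreal (C powr s) * ennreal (diameter (U i) powr s)"
          by (subst ennreal_mult[symmetric]) (auto intro: ennreal_leI)
        moreover have "U i \<noteq> {}" using False by (auto simp: V_def)
        ultimately show ?thesis using False by (simp add: diam_pow_def)
      qed
      then have "(\<Sum>i. diam_pow s (V i)) \<le> (\<Sum>i. ennreal (C powr s) * diam_pow s (U i))"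
        by (intro suminf_le) auto
      also have "\<dots> = ennreal (C powr s) * (\<Sum>i. diam_pow s (U i))" by simp
      also have "\<dots> < ennreal (C powr s) * ennreal e'"
        using U(4) \<open>C > 0\<close> by (intro ennreal_mult_strict_left_mono) auto
      also have "\<dots> = ennreal e" using \<open>C > 0\<close> e' by (simp add: e'_def flip: ennreal_mult)
      finally show ?thesis .
    qed
    ultimately show "\<exists>U. h ` A \<subseteq> (\<Union>i. U i) \<and> (\<forall>i. bounded (U i) \<and> diameter (U i) \<le> \<delta>) \<and>
        (\<Sum>i::nat. diam_pow s (U i)) < ennreal e"
      using bV by blast
  qed
  then show ?thesis unfolding hausdorff_dim_def by (intro Inf_superset_mono) blast
qed

lemma hausdorff_dim_Un_le:
  assumes "hausdorff_dim A \<le> c" "hausdorff_dim B \<le> c"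
  shows "hausdorff_dim (A \<union> B) \<le> c"
proof (rule ccontr)
  assume "\<not> ?thesis"
  then have "c < hausdorff_dim (A \<union> B)" by simp
  then obtain s where s: "c < ennreal s" "ennreal s < hausdorff_dim (A \<union> B)" "s \<ge> 0"
  proof -
    obtain r where r: "c < r" "r < hausdorff_dim (A \<union> B)"
      using \<open>c < hausdorff_dim (A \<union> B)\<close> dense by blast
    then have "r < top" by (simp add: order_less_le_trans)
    with r show thesis by (cases r) (auto intro: that)
  qed
  have "hausdorff_measure s A = 0" "hausdorff_measure s B = 0"
    using assms s by (auto intro!: hausdorff_measure_0_if_dim_less)
  then have "hausdorff_dim (A \<union> B) \<le> ennreal s"
    using hausdorff_measure_0_Un s hausdorff_dim_le by blast
  with s show False by simp
qed

lemma hausdorff_dim_empty [simp]: "hausdorff_dim {} = 0"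
proof -
  have "hausdorff_measure 0 ({} :: 'a set) = 0"
    unfolding hausdorff_measure_eq_0_iff
    by (intro allI impI exI[of _ "\<lambda>_. {}"]) (auto simp: diam_pow_def)
  then have "hausdorff_dim ({} :: 'a set) \<le> ennreal 0" by (intro hausdorff_dim_le) auto
  then show ?thesis by simp
qed

lemma hausdorff_dim_UN_le:
  assumes "finite I" "\<And>i. i \<in> I \<Longrightarrow> hausdorff_dim (A i) \<le> c"
  shows "hausdorff_dim (\<Union>i\<in>I. A i) \<le> c"
  using assms by (induction I rule: finite_induct) (auto intro: hausdorff_dim_Un_le)

text \<open>The mass distribution principle, with Lebesgue measure pulled back along \<open>\<phi>\<close>.\<close>

lemma hausdorff_dim_ge_hoelder:
  fixes \<phi> :: "'a::metric_space \<Rightarrow> real"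
  assumes onto: "{0..<1} \<subseteq> \<phi> ` A"
    and hoelder: "\<And>x y. x \<in> A \<Longrightarrow> y \<in> A \<Longrightarrow> \<bar>\<phi> x - \<phi> y\<bar> \<le> C * dist x y powr s"
    and "s > 0" "C > 0"
  shows "ennreal s \<le> hausdorff_dim A"
proof (rule hausdorff_dim_ge)
  show "hausdorff_measure s A \<noteq> 0"
  proof
    assume "hausdorff_measure s A = 0"
    moreover have "1 / (2 * C) > 0" using \<open>C > 0\<close> by simp
    ultimately obtain U where U: "A \<subseteq> (\<Union>i. U i)" "\<And>i. bounded (U i)"
      "(\<Sum>i::nat. diam_pow s (U i)) < ennreal (1 / (2 * C))"
      unfolding hausdorff_measure_eq_0_iff using zero_less_one by metis
    \<comment> \<open>Balls replace the images of the cover, which need not be measurable.\<close>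
    define J where "J i = (if U i \<inter> A = {} then {} else
        cball (\<phi> (SOME x. x \<in> U i \<inter> A)) (C * diameter (U i) powr s))" for i
    have sub: "\<phi> ` (U i \<inter> A) \<subseteq> J i" for i
    proof
      fix y assume "y \<in> \<phi> ` (U i \<inter> A)"
      then obtain x where x: "x \<in> U i \<inter> A" "y = \<phi> x" by auto
      define x0 where "x0 = (SOME x. x \<in> U i \<inter> A)"
      have x0: "x0 \<in> U i \<inter> A" unfolding x0_def using x by (intro someI)
      have "\<bar>\<phi> x0 - \<phi> x\<bar> \<le> C * dist x0 x powr s" using hoelder x x0 by auto
      also have "\<dots> \<le> C * diameter (U i) powr s"
        using diameter_bounded_bound[OF U(2)] x x0 \<open>C > 0\<close> \<open>s > 0\<close>
        by (intro mult_left_mono powr_mono2) auto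
      finally show "y \<in> J i" using x x0
        by (auto simp: J_def x0_def dist_real_def)
    qed
    have "{0..<1} \<subseteq> (\<Union>i. J i)"
    proof
      fix y :: real assume "y \<in> {0..<1}"
      then obtain x where x: "x \<in> A" "y = \<phi> x" using onto by auto
      then obtain i where "x \<in> U i" using U(1) by auto
      then show "y \<in> (\<Union>i. J i)" using x sub[of i] by auto
    qed
    then have "emeasure lborel {0..<1::real} \<le> emeasure lborel (\<Union>i. J i)"
      by (intro emeasure_mono) (auto simp: J_def)
    also have "\<dots> \<le> (\<Sum>i. emeasure lborel (J i))"
      by (intro emeasure_subadditive_countably) (auto simp: J_def)
    also have "\<dots> \<le> (\<Sum>i. ennreal (2 * C) * diam_pow s (U i))"
    proof (intro suminf_le)
      fix i
      have "emeasure lborel (cball c r) = ennreal (2 * r)" if "r \<ge> 0" for c r :: real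
        using that by (simp add: cball_eq_atLeastAtMost)
      then show "emeasure lborel (J i) \<le> ennreal (2 * C) * diam_pow s (U i)"
        using \<open>C > 0\<close> \<open>s > 0\<close> by (auto simp: J_def diam_pow_def simp flip: ennreal_mult mult.assoc)
    qed auto
    also have "\<dots> = ennreal (2 * C) * (\<Sum>i. diam_pow s (U i))" by simp
    also have "\<dots> < ennreal (2 * C) * ennreal (1 / (2 * C))"
      using U(3) \<open>C > 0\<close> by (intro ennreal_mult_strict_left_mono) auto
    also have "\<dots> = 1" using \<open>C > 0\<close> by (simp flip: ennreal_mult)
    finally show False by simp
  qed
qed

section \<open>Weights of sets of words\<close>

definition weight :: "real \<Rightarrow> 'a list set \<Rightarrow> real" where
  "weight z X = (\<Sum>w\<in>X. z ^ length w)"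

text \<open>Boundedness over finite subsets, because \<open>weight\<close> of an infinite set is 0
  by the convention for \<open>sum\<close>.\<close>

definition summable_weight :: "real \<Rightarrow> 'a list set \<Rightarrow> bool" where
  "summable_weight z X \<longleftrightarrow> (\<exists>C. \<forall>F. finite F \<longrightarrow> F \<subseteq> X \<longrightarrow> weight z F \<le> C)"

lemma weight_nonneg: "z \<ge> 0 \<Longrightarrow> weight z X \<ge> 0"
  by (simp add: weight_def sum_nonneg)

lemma weight_mono:
  assumes "finite Y" "X \<subseteq> Y" "z \<ge> 0"
  shows "weight z X \<le> weight z Y"
  unfolding weight_def using assms by (intro sum_mono2) auto

lemma summable_weight_subset:
  "summable_weight z Y \<Longrightarrow> X \<subseteq> Y \<Longrightarrow> summable_weight z X"
  unfolding summable_weight_def by (meson order_trans)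

lemma summable_weight_finite:
  assumes "finite X" "z \<ge> 0"
  shows "summable_weight z X"
  unfolding summable_weight_def using weight_mono[OF assms(1)] assms by blast

lemma weight_Un_le:
  assumes "finite X" "finite Y" "z \<ge> 0"
  shows "weight z (X \<union> Y) \<le> weight z X + weight z Y"
  using assms weight_nonneg[of z "X \<inter> Y"]
  by (simp add: weight_def sum_Un)

lemma summable_weight_Un:
  assumes "summable_weight z X" "summable_weight z Y" "z \<ge> 0"
  shows "summable_weight z (X \<union> Y)"
proof -
  obtain C D where CD: "\<And>F. finite F \<Longrightarrow> F \<subseteq> X \<Longrightarrow> weight z F \<le> C"
    "\<And>F. finite F \<Longrightarrow> F \<subseteq> Y \<Longrightarrow> weight z F \<le> D"
    using assms unfolding summable_weight_def by blast
  have "weight z F \<le> C + D" if "finite F" "F \<subseteq> X \<union> Y" for F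
  proof -
    have "F = (F \<inter> X) \<union> (F \<inter> Y)" using that by auto
    then have "weight z F \<le> weight z (F \<inter> X) + weight z (F \<inter> Y)"
      using weight_Un_le[of "F \<inter> X" "F \<inter> Y" z] that assms(3) by simp
    also have "\<dots> \<le> C + D" using CD that by (intro add_mono) auto
    finally show ?thesis .
  qed
  then show ?thesis unfolding summable_weight_def by blast
qed

lemma summable_weight_UN:
  assumes "finite I" "\<And>i. i \<in> I \<Longrightarrow> summable_weight z (X i)" "z \<ge> 0"
  shows "summable_weight z (\<Union>i\<in>I. X i)"
  using assms(1,2)
proof (induction I rule: finite_induct)
  case empty
  then show ?case using summable_weight_finite[of "{}" z] assms(3) by simp
next
  case (insert i I)
  then show ?case using summable_weight_Un[OF _ _ assms(3), of "X i" "\<Union>(X ` I)"] by auto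
qed

definition lconc :: "'a list set \<Rightarrow> 'a list set \<Rightarrow> 'a list set" where
  "lconc X Y = {u @ v | u v. u \<in> X \<and> v \<in> Y}"

lemma lconcI: "u \<in> X \<Longrightarrow> v \<in> Y \<Longrightarrow> u @ v \<in> lconc X Y"
  by (auto simp: lconc_def)

text \<open>Factorisations need not be unique: choosing one for each word embeds a finite part of
  the product into a finite rectangle, and the weight is multiplicative on rectangles.\<close>

lemma summable_weight_lconc:
  assumes "summable_weight z X" "summable_weight z Y" "z \<ge> 0"
  shows "summable_weight z (lconc X Y)"
proof -
  obtain C D where CD: "\<And>F. finite F \<Longrightarrow> F \<subseteq> X \<Longrightarrow> weight z F \<le> C"
    "\<And>F. finite F \<Longrightarrow> F \<subseteq> Y \<Longrightarrow> weight z F \<le> D"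
    using assms unfolding summable_weight_def by blast
  have C0: "0 \<le> C" using CD(1)[of "{}"] by (simp add: weight_def)
  have "weight z F \<le> C * D" if F: "finite F" "F \<subseteq> lconc X Y" for F
  proof -
    have "\<exists>p. w = fst p @ snd p \<and> fst p \<in> X \<and> snd p \<in> Y" if "w \<in> F" for w
    proof -
      have "w \<in> lconc X Y" using F that by blast
      then obtain u v where "w = u @ v" "u \<in> X" "v \<in> Y" by (auto simp: lconc_def)
      then show ?thesis by (intro exI[of _ "(u, v)"]) simp
    qed
    then obtain h where h: "\<And>w. w \<in> F \<Longrightarrow> w = fst (h w) @ snd (h w) \<and> fst (h w) \<in> X \<and> snd (h w) \<in> Y"
      by metis
    define A B where "A = (fst \<circ> h) ` F" and "B = (snd \<circ> h) ` F"
    have fin: "finite A" "finite B" "A \<subseteq> X" "B \<subseteq> Y" using F(1) h by (auto simp: A_def B_def)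
    have "F \<subseteq> (\<lambda>(u, v). u @ v) ` (A \<times> B)"
    proof
      fix w assume w: "w \<in> F"
      then show "w \<in> (\<lambda>(u, v). u @ v) ` (A \<times> B)"
        using h[OF w] by (intro image_eqI[of _ _ "h w"]) (auto simp: A_def B_def mem_Times_iff split: prod.splits)
    qed
    then have "weight z F \<le> weight z ((\<lambda>(u, v). u @ v) ` (A \<times> B))"
      using fin assms(3) by (intro weight_mono) auto
    also have "\<dots> \<le> (\<Sum>p\<in>A \<times> B. z ^ length ((\<lambda>(u, v). u @ v) p))"
      unfolding weight_def using fin assms(3) sum_image_le[of "A \<times> B" "\<lambda>w. z ^ length w" "\<lambda>(u, v). u @ v"]
      by auto
    also have "\<dots> = weight z A * weight z B"
      unfolding weight_def sum_product sum.cartesian_product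
      by (intro sum.cong) (auto simp: power_add)
    also have "\<dots> \<le> C * D" using CD fin C0 weight_nonneg[OF assms(3)] by (intro mult_mono) auto
    finally show ?thesis .
  qed
  then show ?thesis unfolding summable_weight_def by blast
qed

lemma large_finite_weight:
  assumes "\<not> summable_weight z X"
  obtains F where "finite F" "F \<subseteq> X" "weight z F > C"
  using assms unfolding summable_weight_def by (meson not_le)

text \<open>Used contrapositively: divergence at z forces more than \<open>r ^ n\<close> words of
  length n for arbitrarily large n, whenever \<open>r * z < 1\<close>.\<close>

lemma summable_weight_growth:
  fixes X :: "'a list set"
  assumes fin: "\<And>n. finite {w \<in> X. length w = n}"
    and le: "\<And>n. n \<ge> n0 \<Longrightarrow> real (card {w \<in> X. length w = n}) \<le> r ^ n"
    and "0 \<le> r" "0 \<le> z" "r * z < 1"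
  shows "summable_weight z X"
proof -
  define c where "c n = (if n < n0 then real (card {w \<in> X. length w = n}) * z ^ n else (r * z) ^ n)" for n
  have "summable c"
  proof (rule summable_comparison_test_ev)
    show "summable (\<lambda>n. (r * z) ^ n)" using assms by (intro summable_geometric) auto
    show "\<forall>\<^sub>F n in sequentially. norm (c n) \<le> (r * z) ^ n"
      using eventually_ge_at_top[of n0] by eventually_elim (use assms in \<open>auto simp: c_def\<close>)
  qed
  have c0: "c n \<ge> 0" for n using assms by (auto simp: c_def)
  have "weight z F \<le> suminf c" if F: "finite F" "F \<subseteq> X" for F
  proof -
    obtain N where N: "\<And>w. w \<in> F \<Longrightarrow> length w < N"
      using F(1) finite_nat_set_iff_bounded[of "length ` F"] by auto
    have "weight z F = (\<Sum>n<N. \<Sum>w\<in>{w \<in> F. length w = n}. z ^ length w)"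
      unfolding weight_def using F N by (intro sum.group[symmetric]) auto
    also have "\<dots> \<le> (\<Sum>n<N. c n)"
    proof (intro sum_mono)
      fix n
      have "(\<Sum>w\<in>{w \<in> F. length w = n}. z ^ length w) = real (card {w \<in> F. length w = n}) * z ^ n"
        by simp
      also have "\<dots> \<le> real (card {w \<in> X. length w = n}) * z ^ n"
        using F fin assms by (intro mult_right_mono of_nat_mono card_mono) auto
      also have "\<dots> \<le> c n"
        using le[of n] assms by (auto simp: c_def power_mult_distrib intro!: mult_right_mono)
      finally show "(\<Sum>w\<in>{w \<in> F. length w = n}. z ^ length w) \<le> c n" .
    qed
    also have "\<dots> \<le> suminf c" using \<open>summable c\<close> c0 by (intro sum_le_suminf) auto
    finally show ?thesis .
  qed
  then show ?thesis unfolding summable_weight_def by blast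
qed

text \<open>Prefix codes have the unique factorisation property, so the weight of the
  \<open>k\<close>-fold products is the \<open>k\<close>-th power of the weight.\<close>

lemma not_summable_weight_prefix_code:
  assumes R: "finite R" "weight z R \<ge> 2" "z \<ge> 0"
    and pf: "\<And>u v w. u \<in> R \<Longrightarrow> v \<in> R \<Longrightarrow> u @ w = v \<Longrightarrow> u = v"
    and M: "[] \<in> M" "\<And>u v. u \<in> R \<Longrightarrow> v \<in> M \<Longrightarrow> u @ v \<in> M"
  shows "\<not> summable_weight z M"
proof
  assume "summable_weight z M"
  then obtain C where C: "\<And>F. finite F \<Longrightarrow> F \<subseteq> M \<Longrightarrow> weight z F \<le> C"
    unfolding summable_weight_def by blast
  have *: "\<exists>F. finite F \<and> F \<subseteq> M \<and> weight z F \<ge> 2 ^ k" for k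
  proof (induction k)
    case 0
    then show ?case using M by (intro exI[of _ "{[]}"]) (auto simp: weight_def)
  next
    case (Suc k)
    then obtain F where F: "finite F" "F \<subseteq> M" "weight z F \<ge> 2 ^ k" by blast
    let ?h = "\<lambda>(u, v). u @ v"
    have inj: "inj_on ?h (R \<times> F)"
    proof (rule inj_onI)
      fix p q assume pq: "p \<in> R \<times> F" "q \<in> R \<times> F" "?h p = ?h q"
      obtain u v u' v' where [simp]: "p = (u, v)" "q = (u', v')" by (cases p, cases q)
      have "u @ v = u' @ v'" using pq by simp
      then obtain us where "u = u' @ us \<and> us @ v = v' \<or> u @ us = u' \<and> v = us @ v'"
        unfolding append_eq_append_conv2 by auto
      then have "u = u'" using pf[of u u'] pf[of u' u] pq by auto
      then show "p = q" using \<open>u @ v = u' @ v'\<close> by simp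
    qed
    have "2 ^ Suc k \<le> weight z R * weight z F"
      using mult_mono[OF R(2) F(3)] weight_nonneg[OF R(3), of R] by simp
    also have "\<dots> = (\<Sum>p\<in>R \<times> F. z ^ length (?h p))"
      unfolding weight_def sum_product sum.cartesian_product
      by (intro sum.cong) (auto simp: power_add)
    also have "\<dots> = weight z (?h ` (R \<times> F))"
      unfolding weight_def using inj by (simp add: sum.reindex)
    finally show ?case using F R M by (intro exI[of _ "?h ` (R \<times> F)"]) auto
  qed
  obtain k where "C < 2 ^ k" using real_arch_pow[of 2 C] by auto
  moreover obtain F where "finite F" "F \<subseteq> M" "weight z F \<ge> 2 ^ k" using * by blast
  ultimately show False using C[of F] by auto
qed

section \<open>Words and admissible points\<close>

locale beta_base =
  fixes \<beta> :: real
  assumes beta_gt_1: "\<beta> > 1"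
begin

lemma beta_pos: "\<beta> > 0" using beta_gt_1 by simp

lemma beta_power_pos [simp]: "\<beta> ^ n > 0" using beta_pos by simp

lemma beta_power_nonneg [simp]: "\<beta> ^ n \<ge> 0"
  using beta_power_pos[of n] by (rule less_imp_le)

lemma beta_power_ge_1: "\<beta> ^ n \<ge> 1" using beta_gt_1 by simp

text \<open>\<open>val w y\<close> is the point whose expansion consists of the digits \<open>w\<close> followed by that of \<open>y\<close>,
  so \<open>T\<^sup>k\<close> maps it to \<open>val (drop k w) y\<close>; \<open>adm t w y\<close> says that these points lie in \<open>[t, 1)\<close>.\<close>

primrec val :: "nat list \<Rightarrow> real \<Rightarrow> real" where
  "val [] y = y"
| "val (d # w) y = (real d + val w y) / \<beta>"

primrec adm :: "real \<Rightarrow> nat list \<Rightarrow> real \<Rightarrow> bool" where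
  "adm t [] y \<longleftrightarrow> t \<le> y \<and> y < 1"
| "adm t (d # w) y \<longleftrightarrow> t \<le> val (d # w) y \<and> val (d # w) y < 1 \<and> adm t w y"

text \<open>A path from I to J labelled w: it can be continued by every point of J and then starts
  in I. Arbitrary sets are allowed as ends, so that paths through subintervals compose as
  well.\<close>

definition arr :: "real \<Rightarrow> real set \<Rightarrow> nat list \<Rightarrow> real set \<Rightarrow> bool" where
  "arr t I w J \<longleftrightarrow> (\<forall>y\<in>J. adm t w y \<and> val w y \<in> I)"

lemma val_append [simp]: "val (u @ w) y = val u (val w y)"
  by (induction u) auto

lemma val_diff: "val w y - val w x = (y - x) / \<beta> ^ length w"
proof (induction w)
  case (Cons d w)
  have "val (d # w) y - val (d # w) x = (val w y - val w x) / \<beta>"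
    by (simp add: diff_divide_distrib add_divide_distrib)
  then show ?case by (simp add: Cons)
qed simp

lemma val_shift: "val w y = val w x + (y - x) / \<beta> ^ length w"
  using val_diff[of w y x] by simp

lemma val_less_iff [simp]: "val w x < val w y \<longleftrightarrow> x < y"
proof -
  have "0 < val w y - val w x \<longleftrightarrow> 0 < y - x"
    unfolding val_diff pos_less_divide_eq[OF beta_power_pos] by simp
  then show ?thesis by simp
qed

lemma val_le_iff [simp]: "val w x \<le> val w y \<longleftrightarrow> x \<le> y"
  by (meson not_le val_less_iff)

lemma adm_append: "adm t (u @ w) y \<longleftrightarrow> adm t u (val w y) \<and> adm t w y"
proof (induction u)
  case Nil
  have "adm t w y \<Longrightarrow> t \<le> val w y \<and> val w y < 1" by (cases w) auto
  then show ?case by auto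
qed auto

lemma adm_bounds: "adm t w y \<Longrightarrow> t \<le> val w y \<and> val w y < 1"
  by (cases w) auto

lemma adm_end: "adm t w y \<Longrightarrow> t \<le> y \<and> y < 1"
  by (induction w) auto

lemma adm_drop: "adm t w y \<Longrightarrow> adm t (drop k w) y"
  using adm_append[of t "take k w" "drop k w" y] by simp

lemma adm_iff_drop: "adm t w y \<longleftrightarrow> (\<forall>k\<le>length w. t \<le> val (drop k w) y \<and> val (drop k w) y < 1)"
proof
  assume "adm t w y"
  then show "\<forall>k\<le>length w. t \<le> val (drop k w) y \<and> val (drop k w) y < 1"
    using adm_drop adm_bounds by blast
next
  assume "\<forall>k\<le>length w. t \<le> val (drop k w) y \<and> val (drop k w) y < 1"
  then show "adm t w y"
  proof (induction w)
    case (Cons d w)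
    have "\<forall>k\<le>length w. t \<le> val (drop k w) y \<and> val (drop k w) y < 1"
      using Cons.prems by (metis Suc_le_mono drop_Suc_Cons length_Cons)
    with Cons.IH have "adm t w y" by blast
    with Cons.prems[rule_format, of 0] show ?case by simp
  qed auto
qed

lemma adm_antimono: "adm t w y \<Longrightarrow> t' \<le> t \<Longrightarrow> adm t' w y"
  by (induction w) auto

lemma beta_map_shift: "0 \<le> y \<Longrightarrow> y < 1 \<Longrightarrow> beta_map \<beta> ((real d + y) / \<beta>) = y"
  using beta_pos by (simp add: beta_map_def frac_unique_iff)

lemma beta_map_funpow_val:
  assumes "adm t w y" "0 \<le> t" "k \<le> length w"
  shows "(beta_map \<beta> ^^ k) (val w y) = val (drop k w) y"
  using assms
proof (induction k arbitrary: w)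
  case (Suc k)
  then obtain d w' where w: "w = d # w'" by (cases w) auto
  have "0 \<le> val w' y" "val w' y < 1" using Suc.prems w adm_bounds[of t w' y] by auto
  then have "beta_map \<beta> (val w y) = val w' y" unfolding w by (simp add: beta_map_shift)
  then show ?case using Suc w by (simp add: funpow_swap1 flip: funpow.simps(2)) (simp add: funpow_swap1)
qed auto

lemma arr_append:
  "arr t I u J \<Longrightarrow> arr t J w K \<Longrightarrow> arr t I (u @ w) K"
  by (auto simp: arr_def adm_append)

lemma adm_digits:
  assumes "adm t w y" "0 \<le> t"
  shows "set w \<subseteq> {..<nat \<lceil>\<beta>\<rceil>}"
  using assms
proof (induction w)
  case (Cons d w)
  have "0 \<le> val w y" using Cons.prems adm_bounds[of t w y] by auto
  moreover have "(real d + val w y) / \<beta> < 1" using Cons.prems by simp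
  ultimately have "real d < \<beta>" using beta_pos by (simp add: field_simps)
  then have "d < nat \<lceil>\<beta>\<rceil>" by linarith
  then show ?case using Cons by auto
qed auto

section \<open>Follower intervals\<close>

text \<open>A state \<open>(a, b)\<close> stands for the interval \<open>[a, b)\<close>. Reading the digit \<open>d\<close> turns it into its
  image under \<open>x \<mapsto> \<beta>x - d\<close>, cut off to \<open>[t, 1)\<close>; the interval is empty if the state is not \<open>alive\<close>.\<close>

definition nxt :: "real \<Rightarrow> real \<times> real \<Rightarrow> nat \<Rightarrow> real \<times> real" where
  "nxt t s d = (max (\<beta> * fst s - real d) t, min (\<beta> * snd s - real d) 1)"

definition run :: "real \<Rightarrow> real \<times> real \<Rightarrow> nat list \<Rightarrow> real \<times> real" where
  "run t s w = foldl (nxt t) s w"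

definition itv :: "real \<times> real \<Rightarrow> real set" where
  "itv s = {fst s..<snd s}"

definition alive :: "real \<times> real \<Rightarrow> bool" where
  "alive s \<longleftrightarrow> fst s < snd s"

definition inside :: "real \<Rightarrow> real \<times> real \<Rightarrow> bool" where
  "inside t s \<longleftrightarrow> t \<le> fst s \<and> snd s \<le> 1"

lemma run_simps [simp]:
  "run t s [] = s" "run t s (d # w) = run t (nxt t s d) w" "run t s (u @ w) = run t (run t s u) w"
  by (auto simp: run_def)

lemma inside_nxt [simp]: "inside t (nxt t s d)"
  by (auto simp: inside_def nxt_def)

lemma inside_run: "inside t s \<Longrightarrow> inside t (run t s w)"
  by (induction w arbitrary: s) auto

lemma alive_iff: "alive s \<longleftrightarrow> itv s \<noteq> {}"
  by (auto simp: alive_def itv_def)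

lemma itv_nxt: "y \<in> itv (nxt t s d) \<longleftrightarrow> (real d + y) / \<beta> \<in> itv s \<and> t \<le> y \<and> y < 1"
  using beta_pos by (auto simp: itv_def nxt_def field_simps)

lemma itv_run:
  assumes "inside t s"
  shows "y \<in> itv (run t s w) \<longleftrightarrow> adm t w y \<and> val w y \<in> itv s"
  using assms
proof (induction w arbitrary: s)
  case Nil
  then show ?case by (auto simp: inside_def itv_def)
next
  case (Cons d w)
  have "y \<in> itv (run t s (d # w)) \<longleftrightarrow> adm t w y \<and> val w y \<in> itv (nxt t s d)"
    using Cons.IH[of "nxt t s d"] by simp
  also have "\<dots> \<longleftrightarrow> adm t (d # w) y \<and> val (d # w) y \<in> itv s"
    using Cons.prems adm_bounds[of t w y] by (auto simp: itv_nxt) (auto simp: inside_def itv_def)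
  finally show ?case .
qed

lemma arr_run: "inside t s \<Longrightarrow> arr t (itv s) w (itv (run t s w))"
  by (auto simp: arr_def itv_run)

lemma alive_run_append:
  assumes "inside t s" "alive (run t s (u @ w))"
  shows "alive (run t s u)"
proof -
  obtain y where "y \<in> itv (run t (run t s u) w)" using assms by (auto simp: alive_iff)
  then have "val w y \<in> itv (run t s u)" using itv_run inside_run assms by blast
  then show ?thesis by (auto simp: alive_iff)
qed

lemma alive_run_digits:
  assumes "inside t s" "alive (run t s w)" "0 \<le> t"
  shows "set w \<subseteq> {..<nat \<lceil>\<beta>\<rceil>}"
proof -
  obtain y where "y \<in> itv (run t s w)" using assms by (auto simp: alive_iff)
  then show ?thesis using itv_run[OF assms(1)] adm_digits assms(3) by blast
qed

text \<open>The starting state is not tested, only the states entered later; a path from v may thus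
  avoid v.\<close>

primrec avoids :: "real \<Rightarrow> (real \<times> real) set \<Rightarrow> real \<times> real \<Rightarrow> nat list \<Rightarrow> bool" where
  "avoids t V s [] \<longleftrightarrow> True"
| "avoids t V s (d # w) \<longleftrightarrow> nxt t s d \<notin> V \<and> avoids t V (nxt t s d) w"

definition paths :: "real \<Rightarrow> (real \<times> real) set \<Rightarrow> real \<times> real \<Rightarrow> nat list set" where
  "paths t V s = {w. alive (run t s w) \<and> avoids t V s w}"

definition loops :: "real \<Rightarrow> real \<times> real \<Rightarrow> nat list set" where
  "loops t v = {w. alive v \<and> run t v w = v}"

lemma avoids_append: "avoids t V s (u @ w) \<longleftrightarrow> avoids t V s u \<and> avoids t V (run t s u) w"
  by (induction u arbitrary: s) auto

lemma avoids_empty [simp]: "avoids t {} s w"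
  by (induction w arbitrary: s) auto

lemma paths_appendD:
  assumes "u @ w \<in> paths t V s" "inside t s"
  shows "u \<in> paths t V s" "w \<in> paths t V (run t s u)"
  using assms alive_run_append[OF assms(2), of u w] by (auto simp: paths_def avoids_append)

lemma paths_first_visit:
  assumes "w \<in> paths t V s" "w \<notin> paths t (insert v V) s" "inside t s"
  shows "\<exists>w1 d w2. w = w1 @ d # w2 \<and> w1 \<in> paths t (insert v V) s \<and> run t s (w1 @ [d]) = v
    \<and> w2 \<in> paths t V v"
  using assms
proof (induction w arbitrary: s)
  case Nil
  then show ?case by (auto simp: paths_def)
next
  case (Cons d w)
  have al: "alive s" using Cons.prems alive_run_append[of t s "[]" "d # w"] by (auto simp: paths_def)
  show ?case
  proof (cases "nxt t s d = v")
    case True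
    with Cons.prems al show ?thesis
      by (intro exI[of _ "[]"] exI[of _ d] exI[of _ w]) (auto simp: paths_def)
  next
    case False
    have "w \<in> paths t V (nxt t s d)" "w \<notin> paths t (insert v V) (nxt t s d)"
      using Cons.prems False by (auto simp: paths_def)
    from Cons.IH[OF this] obtain w1 d' w2 where
      *: "w = w1 @ d' # w2" "w1 \<in> paths t (insert v V) (nxt t s d)"
      "run t (nxt t s d) (w1 @ [d']) = v" "w2 \<in> paths t V v"
      by auto
    then show ?thesis using False Cons.prems
      by (intro exI[of _ "d # w1"] exI[of _ d'] exI[of _ w2]) (auto simp: paths_def)
  qed
qed

text \<open>Cut at the last return to v.\<close>

lemma paths_last_visit:
  assumes "w \<in> paths t V v" "inside t v"
  shows "\<exists>l w'. w = l @ w' \<and> l \<in> loops t v \<and> w' \<in> paths t (insert v V) v"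
  using assms
proof (induction "length w" arbitrary: w rule: less_induct)
  case less
  have al: "alive v" using less.prems alive_run_append[of t v "[]" w] by (auto simp: paths_def)
  show ?case
  proof (cases "w \<in> paths t (insert v V) v")
    case True
    then show ?thesis using al by (intro exI[of _ "[]"] exI[of _ w]) (auto simp: loops_def)
  next
    case False
    from paths_first_visit[OF less.prems(1) False less.prems(2)] obtain w1 d w2
      where *: "w = w1 @ d # w2" "run t v (w1 @ [d]) = v" "w2 \<in> paths t V v" by blast
    then obtain l w' where "w2 = l @ w'" "l \<in> loops t v" "w' \<in> paths t (insert v V) v"
      using less.hyps[of w2] less.prems by auto
    with * al show ?thesis
      by (intro exI[of _ "w1 @ d # l"] exI[of _ w']) (auto simp: loops_def)
  qed
qed

text \<open>States are eliminated one at a time, as in Kleene's construction: a path that meets v is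
  a path up to the first visit, one digit into v, a loop at v, and a path that never
  returns.\<close>

lemma summable_weight_paths:
  assumes "finite V" "0 \<le> t" "0 \<le> z"
    and "\<And>s. inside t s \<Longrightarrow> summable_weight z (paths t V s)"
    and "\<And>v. v \<in> V \<Longrightarrow> inside t v \<Longrightarrow> summable_weight z (loops t v)"
    and "inside t s"
  shows "summable_weight z (paths t {} s)"
  using assms(1,4-6)
proof (induction V arbitrary: s rule: finite_induct)
  case (insert v V)
  have "summable_weight z (paths t V s)" if "inside t s" for s
  proof (cases "inside t v")
    case False
    have "paths t V s \<subseteq> paths t (insert v V) s"
    proof (rule ccontr)
      assume "\<not> ?thesis"
      then obtain w where w: "w \<in> paths t V s" "w \<notin> paths t (insert v V) s" by blast
      from paths_first_visit[OF this that] inside_run[OF that] False show False by metis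
    qed
    then show ?thesis using insert.prems that summable_weight_subset by blast
  next
    case True
    define D where "D = (\<lambda>d. [d]) ` {..<nat \<lceil>\<beta>\<rceil>}"
    let ?P = "paths t (insert v V)"
    have "paths t V s \<subseteq> ?P s \<union> lconc (?P s) (lconc D (lconc (loops t v) (?P v)))"
    proof
      fix w assume w: "w \<in> paths t V s"
      show "w \<in> ?P s \<union> lconc (?P s) (lconc D (lconc (loops t v) (?P v)))"
      proof (cases "w \<in> ?P s")
        case False
        from paths_first_visit[OF w False that] obtain w1 d w2 where
          *: "w = w1 @ d # w2" "w1 \<in> ?P s" "w2 \<in> paths t V v" by blast
        from paths_last_visit[OF *(3) True] obtain l w' where
          **: "w2 = l @ w'" "l \<in> loops t v" "w' \<in> ?P v" by blast
        have "d < nat \<lceil>\<beta>\<rceil>" using alive_run_digits[of t s w] w that * assms(2) by (auto simp: paths_def)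
        then have "[d] \<in> D" by (auto simp: D_def)
        then have "w1 @ [d] @ l @ w' \<in> lconc (?P s) (lconc D (lconc (loops t v) (?P v)))"
          using * ** by (intro lconcI)
        then show ?thesis using * ** by simp
      qed auto
    qed
    moreover have "summable_weight z (?P s)" "summable_weight z (?P v)" "summable_weight z (loops t v)"
      using insert.prems True that by blast+
    moreover have "summable_weight z D" using assms(3) by (intro summable_weight_finite) (auto simp: D_def)
    ultimately have "paths t V s \<subseteq> ?P s \<union> lconc (?P s) (lconc D (lconc (loops t v) (?P v)))"
      "summable_weight z (?P s \<union> lconc (?P s) (lconc D (lconc (loops t v) (?P v))))"
      using assms(3) by (blast intro: summable_weight_Un summable_weight_lconc)+
    then show ?thesis using summable_weight_subset by blast
  qed
  then show ?case using insert.IH insert.prems by blast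
qed auto

section \<open>Sparsity of the paths that avoid the low states\<close>

text \<open>Motion of the left end while the lowest possible digit is read.\<close>

definition stepA :: "real \<Rightarrow> real \<Rightarrow> real" where
  "stepA t a = max (\<beta> * a - real (nat \<lfloor>\<beta> * a\<rfloor>)) t"

text \<open>Motion of the right end while the highest possible digit is read. The form
  \<open>\<lceil>\<beta> * b\<rceil> - 1\<close> gives remainder 1, not 0, when
  \<open>\<beta> * b\<close> is an integer, as the intervals are open on the right; on the orbit of
  1 it is the quasi-greedy map.\<close>

definition stepB :: "real \<Rightarrow> real" where
  "stepB b = \<beta> * b - real (nat (\<lceil>\<beta> * b\<rceil> - 1))"

text \<open>Both ends are at most L steps away from their reset values t and 1.\<close>

definition low_states :: "real \<Rightarrow> nat \<Rightarrow> (real \<times> real) set" where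
  "low_states t L = (\<lambda>(i, j). ((stepA t ^^ i) t, (stepB ^^ j) 1)) ` ({..L} \<times> {..L})"

definition lo :: "real \<times> real \<Rightarrow> nat" where "lo s = nat \<lfloor>\<beta> * fst s\<rfloor>"

definition hi :: "real \<times> real \<Rightarrow> nat" where "hi s = nat (\<lceil>\<beta> * snd s\<rceil> - 1)"

lemma finite_low_states [simp]: "finite (low_states t L)"
  by (simp add: low_states_def)

lemma low_statesI:
  "fst s = (stepA t ^^ i) t \<Longrightarrow> snd s = (stepB ^^ j) 1 \<Longrightarrow> i \<le> L \<Longrightarrow> j \<le> L \<Longrightarrow> s \<in> low_states t L"
  unfolding low_states_def by (intro image_eqI[of _ _ "(i, j)"]) (auto simp: prod_eq_iff)

text \<open>Only the extreme digits have memory: any digit above the lowest resets the left end to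
  t, any digit below the highest resets the right end to 1.\<close>

lemma nxt_cases:
  assumes "inside t s" "0 \<le> t" "alive (nxt t s d)"
  shows "lo s \<le> d" "d \<le> hi s"
    "fst (nxt t s d) = (if d = lo s then stepA t (fst s) else t)"
    "snd (nxt t s d) = (if d = hi s then stepB (snd s) else 1)"
proof -
  have a: "0 \<le> \<beta> * fst s" using assms beta_pos by (auto simp: inside_def)
  have al: "max (\<beta> * fst s - real d) t < min (\<beta> * snd s - real d) 1"
    using assms(3) by (simp add: alive_def nxt_def)
  show 1: "lo s \<le> d" using al a unfolding lo_def by linarith
  have b: "0 < \<beta> * snd s - real d" using al assms(2) by linarith
  show 2: "d \<le> hi s" using b unfolding hi_def by linarith
  show "fst (nxt t s d) = (if d = lo s then stepA t (fst s) else t)"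
    using 1 a assms(2) by (auto simp: nxt_def lo_def stepA_def) linarith
  have "\<beta> * snd s - real (hi s) \<le> 1" using b unfolding hi_def by linarith
  moreover have "\<beta> * snd s - real d \<ge> 1" if "d < hi s" using that b unfolding hi_def by linarith
  ultimately show "snd (nxt t s d) = (if d = hi s then stepB (snd s) else 1)"
    using 2 by (auto simp: nxt_def hi_def stepB_def)
qed

primrec loword :: "real \<Rightarrow> nat \<Rightarrow> real \<times> real \<Rightarrow> nat list" where
  "loword t 0 s = []"
| "loword t (Suc k) s = lo s # loword t k (nxt t s (lo s))"

primrec hiword :: "real \<Rightarrow> nat \<Rightarrow> real \<times> real \<Rightarrow> nat list" where
  "hiword t 0 s = []"
| "hiword t (Suc k) s = hi s # hiword t k (nxt t s (hi s))"

lemma paths_ConsD: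
  assumes "d # w \<in> paths t V s" "inside t s"
  shows "alive (nxt t s d)" "w \<in> paths t V (nxt t s d)" "nxt t s d \<notin> V"
  using assms alive_run_append[of t s "[d]" w] by (auto simp: paths_def)

text \<open>The right end was reset recently. A digit above the lowest would reset the left end too
  and so enter a low state; hence every digit is forced.\<close>

lemma paths_loword:
  assumes "w \<in> paths t (low_states t L) s" "inside t s" "0 \<le> t"
    and "snd s = (stepB ^^ m) 1" "m + length w \<le> L"
  shows "w = loword t (length w) s"
  using assms
proof (induction w arbitrary: s m)
  case (Cons d w)
  note D = paths_ConsD[OF Cons.prems(1,2)]
  note N = nxt_cases[OF Cons.prems(2,3) D(1)]
  have snd: "\<exists>m'\<le>Suc m. snd (nxt t s d) = (stepB ^^ m') 1"
  proof (cases "d = hi s")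
    case True
    then show ?thesis using N(4) Cons.prems(4) by (intro exI[of _ "Suc m"]) auto
  next
    case False
    then show ?thesis using N(4) by (intro exI[of _ 0]) auto
  qed
  then obtain m' where m': "m' \<le> Suc m" "snd (nxt t s d) = (stepB ^^ m') 1" by blast
  have "d = lo s"
  proof (rule ccontr)
    assume "d \<noteq> lo s"
    then have "fst (nxt t s d) = (stepA t ^^ 0) t" using N(3) by simp
    then have "nxt t s d \<in> low_states t L"
      using m' Cons.prems(5) by (intro low_statesI[where i = 0 and j = m']) auto
    with D(3) show False by blast
  qed
  moreover have "w = loword t (length w) (nxt t s d)"
    using Cons.prems(3,5) m' by (intro Cons.IH[of _ m'] D(2)) auto
  ultimately show ?case by simp
qed auto

lemma paths_hiword:
  assumes "w \<in> paths t (low_states t L) s" "inside t s" "0 \<le> t"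
    and "fst s = (stepA t ^^ m) t" "m + length w \<le> L"
  shows "w = hiword t (length w) s"
  using assms
proof (induction w arbitrary: s m)
  case (Cons d w)
  note D = paths_ConsD[OF Cons.prems(1,2)]
  note N = nxt_cases[OF Cons.prems(2,3) D(1)]
  have "\<exists>m'\<le>Suc m. fst (nxt t s d) = (stepA t ^^ m') t"
  proof (cases "d = lo s")
    case True
    then show ?thesis using N(3) Cons.prems(4) by (intro exI[of _ "Suc m"]) auto
  next
    case False
    then show ?thesis using N(3) by (intro exI[of _ 0]) auto
  qed
  then obtain m' where m': "m' \<le> Suc m" "fst (nxt t s d) = (stepA t ^^ m') t" by blast
  have "d = hi s"
  proof (rule ccontr)
    assume "d \<noteq> hi s"
    then have "snd (nxt t s d) = (stepB ^^ 0) 1" using N(4) by simp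
    then have "nxt t s d \<in> low_states t L"
      using m' Cons.prems(5) by (intro low_statesI[where i = m' and j = 0]) auto
    with D(3) show False by blast
  qed
  moreover have "w = hiword t (length w) (nxt t s d)"
    using Cons.prems(3,5) m' by (intro Cons.IH[of _ m'] D(2)) auto
  ultimately show ?case by simp
qed auto

text \<open>After a branching, one end of the follower interval is reset. A second reset of the
  other end within \<open>L\<close> steps would lead to a low state, so all turns go to the same side.\<close>

lemma paths_avoiding_low_states:
  assumes "w \<in> paths t (low_states t L) s" "inside t s" "0 \<le> t" "length w \<le> L"
  shows "w = loword t (length w) s \<or> w = hiword t (length w) s"
  using assms
proof (induction w arbitrary: s)
  case (Cons d w)
  note D = paths_ConsD[OF Cons.prems(1,2)]
  note N = nxt_cases[OF Cons.prems(2,3) D(1)]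
  consider "d = lo s" "d = hi s" | "d = lo s" "d \<noteq> hi s" | "d \<noteq> lo s" "d = hi s" | "d \<noteq> lo s" "d \<noteq> hi s"
    by blast
  then show ?case
  proof cases
    case 1
    then show ?thesis using Cons.IH[OF D(2)] Cons.prems by auto
  next
    case 2
    then have "w = loword t (length w) (nxt t s d)"
      using N Cons.prems by (intro paths_loword[where m = 0 and L = L] D(2)) auto
    then show ?thesis using 2 by simp
  next
    case 3
    then have "w = hiword t (length w) (nxt t s d)"
      using N Cons.prems by (intro paths_hiword[where m = 0 and L = L] D(2)) auto
    then show ?thesis using 3 by simp
  next
    case 4
    then have "nxt t s d \<in> low_states t L"
      using N by (intro low_statesI[where i = 0 and j = 0]) auto
    then show ?thesis using D(3) by blast
  qed
qed auto

lemma length_loword [simp]: "length (loword t k s) = k"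
  by (induction k arbitrary: s) auto

lemma length_hiword [simp]: "length (hiword t k s) = k"
  by (induction k arbitrary: s) auto

text \<open>In each block of L digits at most two words are possible, so the growth rate is at most
  the L-th root of 2.\<close>

lemma summable_weight_paths_low:
  assumes "0 \<le> t" "0 \<le> z" "z \<le> 1" "2 * z ^ L < 1" "inside t s"
  shows "summable_weight z (paths t (low_states t L) s)"
proof -
  \<comment> \<open>Solution of \<open>C = 2 * L + 2 * z ^ L * C\<close>: at most 2L words shorter
    than L, and two possible prefixes of length L for the others.\<close>
  define C where "C = 2 * real L / (1 - 2 * z ^ L)"
  have C: "C \<ge> 0" "2 * real L + 2 * z ^ L * C = C" using assms by (auto simp: C_def field_simps)
  have bound: "weight z F \<le> C" if "inside t s" "finite F" "F \<subseteq> paths t (low_states t L) s"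
      "\<And>w. w \<in> F \<Longrightarrow> length w < m * L" for m s F
    using that
  proof (induction m arbitrary: s F)
    case 0
    then have "F = {}" by auto
    then show ?case using C by (simp add: weight_def)
  next
    case (Suc m)
    let ?P = "paths t (low_states t L)"
    define F1 F2 where "F1 = {w \<in> F. length w < L}" and "F2 = {w \<in> F. length w \<ge> L}"
    have "weight z F \<le> weight z F1 + weight z F2"
      using weight_Un_le[of F1 F2 z] Suc.prems assms by (simp add: F1_def F2_def Collect_disj_eq[symmetric])
        (smt (verit, ccfv_SIG) Collect_cong Collect_mem_eq not_le)
    moreover have "weight z F1 \<le> 2 * real L"
    proof -
      have "F1 \<subseteq> (\<lambda>k. loword t k s) ` {..<L} \<union> (\<lambda>k. hiword t k s) ` {..<L}"
      proof
        fix w assume w: "w \<in> F1"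
        then have "w = loword t (length w) s \<or> w = hiword t (length w) s"
          using Suc.prems assms(1) by (intro paths_avoiding_low_states[where L = L]) (auto simp: F1_def)
        then show "w \<in> (\<lambda>k. loword t k s) ` {..<L} \<union> (\<lambda>k. hiword t k s) ` {..<L}"
          using w by (auto simp: F1_def)
      qed
      then have "card F1 \<le> card ((\<lambda>k. loword t k s) ` {..<L} \<union> (\<lambda>k. hiword t k s) ` {..<L})"
        by (intro card_mono) auto
      also have "\<dots> \<le> card ((\<lambda>k. loword t k s) ` {..<L}) + card ((\<lambda>k. hiword t k s) ` {..<L})"
        by (rule card_Un_le)
      also have "\<dots> \<le> L + L" by (intro add_mono card_image_le[THEN order_trans]) auto
      finally have "real (card F1) \<le> 2 * real L" by simp
      moreover have "weight z F1 \<le> (\<Sum>w\<in>F1. 1)"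
        unfolding weight_def using assms by (intro sum_mono power_le_one) auto
      ultimately show ?thesis by simp
    qed
    moreover have "weight z F2 \<le> 2 * z ^ L * C"
    proof -
      define G where "G p = (\<lambda>u. p @ u) -` F" for p
      have wG: "weight z ((\<lambda>u. p @ u) ` G p) \<le> z ^ L * C" if "length p = L" "inside t s" for p
      proof -
        have inj: "inj_on (\<lambda>u. p @ u) (G p)" by (auto intro: inj_onI)
        have "finite (G p)" unfolding G_def using Suc.prems by (intro finite_vimageI) (auto intro: injI)
        have "weight z ((\<lambda>u. p @ u) ` G p) = z ^ L * weight z (G p)"
          unfolding weight_def sum.reindex[OF inj] using that
          by (simp add: power_add sum_distrib_left)
        moreover have "weight z (G p) \<le> C"
        proof (rule Suc.IH[of "run t s p"])
          show "inside t (run t s p)" using that inside_run by blast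
          show "finite (G p)" by fact
          show "G p \<subseteq> ?P (run t s p)" 
          proof
            fix u assume "u \<in> G p"
            then have "p @ u \<in> ?P s" using Suc.prems(3) by (auto simp: G_def)
            then show "u \<in> ?P (run t s p)" using paths_appendD(2) that(2) by blast
          qed
          show "length w < m * L" if "w \<in> G p" for w
            using Suc.prems(4)[of "p @ w"] that \<open>length p = L\<close> by (auto simp: G_def)
        qed
        ultimately show ?thesis using assms by (simp add: mult_left_mono)
      qed
      have "F2 \<subseteq> (\<lambda>u. loword t L s @ u) ` G (loword t L s) \<union> (\<lambda>u. hiword t L s @ u) ` G (hiword t L s)"
      proof
        fix w assume w: "w \<in> F2"
        then have "take L w @ drop L w \<in> ?P s" "length (take L w) = L"
          using Suc.prems by (auto simp: F2_def)
        then have "take L w = loword t L s \<or> take L w = hiword t L s"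
          using paths_avoiding_low_states[OF paths_appendD(1)[OF _ Suc.prems(1)] Suc.prems(1) assms(1)]
          by (metis order_refl)
        moreover have "w = take L w @ drop L w" "w \<in> F" using w by (auto simp: F2_def)
        ultimately show "w \<in> (\<lambda>u. loword t L s @ u) ` G (loword t L s) \<union> (\<lambda>u. hiword t L s @ u) ` G (hiword t L s)"
          unfolding G_def by (metis UnI1 UnI2 image_eqI vimageI)
      qed
      moreover have fin: "finite ((\<lambda>u. p @ u) ` G p)" for p
        unfolding G_def using Suc.prems(2) by (metis finite_Int finite_subset image_vimage_subset le_infE inf_le1)
      ultimately have "weight z F2 \<le> weight z ((\<lambda>u. loword t L s @ u) ` G (loword t L s)
            \<union> (\<lambda>u. hiword t L s @ u) ` G (hiword t L s))"
        using assms(2) by (intro weight_mono) auto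
      also have "\<dots> \<le> weight z ((\<lambda>u. loword t L s @ u) ` G (loword t L s))
            + weight z ((\<lambda>u. hiword t L s @ u) ` G (hiword t L s))"
        using assms(2) fin by (intro weight_Un_le) auto
      also have "\<dots> \<le> z ^ L * C + z ^ L * C" using wG Suc.prems by (intro add_mono) auto
      finally show ?thesis by (simp add: ac_simps)
    qed
    ultimately show ?case using C by linarith
  qed
  have "weight z F \<le> C" if F: "finite F" "F \<subseteq> paths t (low_states t L) s" for F
  proof -
    obtain N where N: "\<And>w. w \<in> F \<Longrightarrow> length w < N"
      using F(1) finite_nat_set_iff_bounded[of "length ` F"] by auto
    have "L > 0" using assms by (cases L) auto
    then have "N \<le> N * L" by simp
    then have "length w < N * L" if "w \<in> F" for w using N[OF that] by linarith
    then show ?thesis using bound[OF assms(5) F] by blast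
  qed
  then show ?thesis unfolding summable_weight_def by blast
qed

lemma recurrent_state:
  assumes "0 \<le> t" "0 \<le> z" "z \<le> 1" "2 * z ^ L < 1" "inside t s"
    and "\<not> summable_weight z (paths t {} s)"
  obtains v where "v \<in> low_states t L" "inside t v" "alive v" "\<not> summable_weight z (loops t v)"
proof -
  obtain v where v: "v \<in> low_states t L" "inside t v" "\<not> summable_weight z (loops t v)"
    using summable_weight_paths[of "low_states t L" t z s] summable_weight_paths_low assms
    by auto
  then have "loops t v \<noteq> {}" using summable_weight_finite[of "{}" z] assms by auto
  then show thesis using that v by (auto simp: loops_def)
qed

end

section \<open>Self-similar subsets of the survivor set\<close>

definition ser :: "real \<Rightarrow> (nat \<Rightarrow> real) \<Rightarrow> real" where
  "ser r f = (\<Sum>k. f k / r ^ k)"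

lemma ser_summable:
  fixes r B :: real
  assumes "r > 1" "\<And>k. \<bar>f k\<bar> \<le> B"
  shows "summable (\<lambda>k. f k / r ^ k)"
proof (rule summable_comparison_test')
  show "summable (\<lambda>k. B * (1 / r) ^ k)" using assms by (intro summable_mult summable_geometric) auto
  show "norm (f k / r ^ k) \<le> B * (1 / r) ^ k" if "k \<ge> 0" for k
    using assms(1) divide_right_mono[OF assms(2)[of k], of "r ^ k"] by (simp add: power_one_over)
qed

lemma ser_rec:
  assumes "r > 1" "\<And>k. \<bar>f k\<bar> \<le> B"
  shows "ser r f = f 0 + ser r (\<lambda>k. f (Suc k)) / r"
proof -
  have "ser r f = f 0 + (\<Sum>k. f (Suc k) / r ^ Suc k)"
    unfolding ser_def using suminf_split_head[OF ser_summable[of r f B]] assms by simp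
  also have "(\<Sum>k. f (Suc k) / r ^ Suc k) = (\<Sum>k. f (Suc k) / r ^ k / r)"
    by (intro suminf_cong) (simp add: mult.commute)
  also have "\<dots> = ser r (\<lambda>k. f (Suc k)) / r"
    unfolding ser_def using assms by (intro suminf_divide ser_summable[of r _ B]) auto
  finally show ?thesis .
qed

lemma ser_bounds:
  assumes "r > 1" "\<And>k. 0 \<le> f k" "\<And>k. f k \<le> B"
  shows "0 \<le> ser r f" "ser r f \<le> B * r / (r - 1)"
proof -
  have s: "summable (\<lambda>k. f k / r ^ k)" using assms by (intro ser_summable[where B = B]) auto
  show "0 \<le> ser r f" unfolding ser_def using assms by (intro suminf_nonneg s) auto
  have g: "summable (\<lambda>k. (1 / r) ^ k)" using assms by (intro summable_geometric) auto
  have "ser r f \<le> (\<Sum>k. B * (1 / r) ^ k)" unfolding ser_def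
  proof (intro suminf_le s summable_mult g)
    show "f k / r ^ k \<le> B * (1 / r) ^ k" for k
      using assms(1) divide_right_mono[OF assms(3)[of k], of "r ^ k"] by (simp add: power_one_over)
  qed
  also have "\<dots> = B * (\<Sum>k. (1 / r) ^ k)" by (intro suminf_mult g)
  also have "\<dots> = B * r / (r - 1)" using assms by (subst suminf_geometric) (auto simp: field_simps)
  finally show "ser r f \<le> B * r / (r - 1)" .
qed

lemma first_difference:
  fixes f g :: "nat \<Rightarrow> 'a"
  assumes "f \<noteq> g"
  obtains k where "f k \<noteq> g k" "\<And>i. i < k \<Longrightarrow> f i = g i"
proof -
  obtain k where "f k \<noteq> g k" using assms by auto
  then show thesis using LeastI[of "\<lambda>k. f k \<noteq> g k" k] not_less_Least[of _ "\<lambda>k. f k \<noteq> g k"] that by blast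
qed

text \<open>Base c expansion. It maps the symbolic coding of the self-similar set onto
  \<open>{0..<1}\<close> and supplies the function for the mass distribution principle.\<close>

definition base_val :: "nat \<Rightarrow> (nat \<Rightarrow> nat) \<Rightarrow> real" where
  "base_val c \<omega> = ser (real c) (\<lambda>k. real (\<omega> k) / real c)"

lemma base_val_rec:
  assumes "c \<ge> 2" "\<And>k. \<omega> k < c"
  shows "base_val c \<omega> = (real (\<omega> 0) + base_val c (\<lambda>k. \<omega> (Suc k))) / real c"
  unfolding base_val_def using assms less_imp_le[OF assms(2)]
  by (subst ser_rec[where B = 1]) (auto simp: add_divide_distrib divide_le_eq)

lemma base_val_bounds:
  assumes "c \<ge> 2" "\<And>k. \<omega> k < c"
  shows "0 \<le> base_val c \<omega>" "base_val c \<omega> \<le> 1"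
proof -
  have "real (\<omega> k) / real c \<le> (real c - 1) / real c" for k
    using assms(2)[of k] assms(1) by (intro divide_right_mono) auto
  then have "0 \<le> base_val c \<omega>" "base_val c \<omega> \<le> (real c - 1) / real c * real c / (real c - 1)"
    unfolding base_val_def
    using ser_bounds[of "real c" "\<lambda>k. real (\<omega> k) / real c" "(real c - 1) / real c"] assms(1) by auto
  then show "0 \<le> base_val c \<omega>" "base_val c \<omega> \<le> 1" using assms(1) by auto
qed

lemma base_val_close:
  assumes "c \<ge> 2" "\<And>k. \<omega> k < c" "\<And>k. \<omega>' k < c" "\<And>i. i < k \<Longrightarrow> \<omega> i = \<omega>' i"
  shows "\<bar>base_val c \<omega> - base_val c \<omega>'\<bar> \<le> 1 / real c ^ k"
  using assms(2-4)
proof (induction k arbitrary: \<omega> \<omega>')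
  case 0
  then show ?case using base_val_bounds[OF assms(1), of \<omega>] base_val_bounds[OF assms(1), of \<omega>'] by auto
next
  case (Suc k)
  let ?s = "\<lambda>\<omega> :: nat \<Rightarrow> nat. \<lambda>k. \<omega> (Suc k)"
  have IH: "\<bar>base_val c (?s \<omega>) - base_val c (?s \<omega>')\<bar> \<le> 1 / real c ^ k"
    using Suc.prems by (intro Suc.IH) auto
  have "base_val c \<omega> - base_val c \<omega>' = (base_val c (?s \<omega>) - base_val c (?s \<omega>')) / real c"
  proof -
    have eq: "\<omega> 0 = \<omega>' 0" using Suc.prems(3)[of 0] by simp
    show ?thesis
      by (subst base_val_rec[OF assms(1) Suc.prems(1)], subst base_val_rec[OF assms(1) Suc.prems(2)])
        (simp add: eq flip: diff_divide_distrib)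
  qed
  then have "\<bar>base_val c \<omega> - base_val c \<omega>'\<bar> = \<bar>base_val c (?s \<omega>) - base_val c (?s \<omega>')\<bar> / real c"
    by simp
  also have "\<dots> \<le> 1 / real c ^ k / real c" using IH by (intro divide_right_mono) auto
  finally show ?case by (simp add: mult.commute)
qed

lemma base_val_onto:
  assumes c: "c \<ge> 2" and x: "0 \<le> x" "x < 1"
  obtains \<omega> where "\<And>k. \<omega> k < c" "base_val c \<omega> = x"
proof -
  define xs where "xs k = ((\<lambda>y. frac (real c * y)) ^^ k) x" for k
  define \<omega> where "\<omega> k = nat \<lfloor>real c * xs k\<rfloor>" for k
  have xs: "0 \<le> xs k \<and> xs k < 1" for k
    using x frac_lt_1 by (cases k) (auto simp: xs_def)
  have om: "\<omega> k < c" for k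
  proof -
    have "real c * xs k < real c" using xs[of k] c by simp
    then show ?thesis unfolding \<omega>_def using c by linarith
  qed
  have step: "xs k = (real (\<omega> k) + xs (Suc k)) / real c" for k
  proof -
    have "0 \<le> real c * xs k" using xs[of k] by simp
    then have "real (\<omega> k) + xs (Suc k) = real c * xs k"
      by (simp add: \<omega>_def xs_def frac_def)
    then show ?thesis using c by simp
  qed
  have close: "\<bar>base_val c (\<lambda>k. \<omega> (j + k)) - xs j\<bar> \<le> 1 / real c ^ m" for m j
  proof (induction m arbitrary: j)
    case 0
    then show ?case using base_val_bounds[OF c, of "\<lambda>k. \<omega> (j + k)"] om xs[of j] by auto
  next
    case (Suc m)
    have "base_val c (\<lambda>k. \<omega> (j + k)) - xs j = (base_val c (\<lambda>k. \<omega> (Suc j + k)) - xs (Suc j)) / real c"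
      by (subst base_val_rec[OF c], use om in blast, subst step[of j]) (simp flip: diff_divide_distrib)
    then have "\<bar>base_val c (\<lambda>k. \<omega> (j + k)) - xs j\<bar> = \<bar>base_val c (\<lambda>k. \<omega> (Suc j + k)) - xs (Suc j)\<bar> / real c"
      by simp
    also have "\<dots> \<le> 1 / real c ^ m / real c" using Suc[of "Suc j"] by (intro divide_right_mono) auto
    finally show ?case by (simp add: mult.commute)
  qed
  have "base_val c \<omega> = x"
  proof (rule ccontr)
    assume "base_val c \<omega> \<noteq> x"
    then have pos: "\<bar>base_val c \<omega> - x\<bar> > 0" by simp
    obtain m where "(1 / real c) ^ m < \<bar>base_val c \<omega> - x\<bar>"
      using real_arch_pow_inv[OF pos, of "1 / real c"] c by auto
    with close[of 0 m] show False by (simp add: xs_def power_one_over)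
  qed
  with om show thesis by (rule that)
qed

context beta_base
begin

text \<open>The remainders lie in \<open>{0..<1}\<close>, so each digit is an integer part and can
  be read off from the value.\<close>

lemma val_inj:
  assumes "adm 0 w y" "adm 0 w' y'" "length w = length w'" "val w y = val w' y'"
  shows "w = w'"
  using assms
proof (induction w arbitrary: w')
  case (Cons d w)
  then obtain d' v where w': "w' = d' # v" by (cases w') auto
  have b: "0 \<le> val w y" "val w y < 1" "0 \<le> val v y'" "val v y' < 1"
    using Cons.prems adm_bounds[of 0 w y] adm_bounds[of 0 v y'] w' by auto
  have eq: "real d + val w y = real d' + val v y'" using Cons.prems(4) beta_pos by (simp add: w')
  with b have "d = d'" by linarith
  with eq have "val w y = val v y'" by simp
  with Cons w' \<open>d = d'\<close> show ?case by auto
qed auto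

text \<open>\<open>Z\<close> is the attractor of the contractions \<open>val w\<close>, \<open>w \<in> W\<close>. The words of \<open>W\<close> keep away from both
  ends of \<open>[a, b)\<close>, which keeps the orbits of \<open>Z\<close> away from \<open>t\<close>, and \<open>wtop\<close> is a spare word whose
  image lies to the right of all images of \<open>W\<close>.\<close>

definition scheme :: "real \<Rightarrow> real \<Rightarrow> real \<Rightarrow> nat \<Rightarrow> nat list set \<Rightarrow> nat list \<Rightarrow> real set \<Rightarrow> bool" where
  "scheme t a b n W wtop Z \<longleftrightarrow> n \<ge> 1 \<and> W \<noteq> {} \<and> finite W
    \<and> (\<forall>w\<in>insert wtop W. length w = n \<and> arr t {a..<b} w {a..<b})
    \<and> (\<forall>w\<in>W. \<forall>y\<in>{a..b}. a + (b - a) / \<beta> ^ n \<le> val w y \<and> val w y \<le> val wtop a)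
    \<and> val wtop a \<le> b - (b - a) / \<beta> ^ n
    \<and> Z \<noteq> {} \<and> Z \<subseteq> {a + (b - a) / \<beta> ^ n..b - (b - a) / \<beta> ^ n}
    \<and> (\<forall>z\<in>Z. \<exists>w\<in>W. \<exists>z'\<in>Z. z = val w z')"

text \<open>The images of \<open>{a..<b}\<close> under the words of X are disjoint intervals of
  equal length \<open>g\<close>. Dropping the leftmost and the rightmost one, hence the two extra
  words, keeps the rest at distance \<open>g\<close> from both ends; this makes the attractor
  strongly separated.\<close>

lemma cantor_set:
  assumes "a < b" "0 \<le> t" "n \<ge> 1" "finite X" "card X \<ge> c + 2" "c \<ge> 2"
    and X: "\<And>w. w \<in> X \<Longrightarrow> length w = n \<and> arr t {a..<b} w {a..<b}"
  obtains W wtop Z where "scheme t a b n W wtop Z" "ennreal (log \<beta> c / n) \<le> hausdorff_dim Z"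
proof -
  define g where "g = (b - a) / \<beta> ^ n"
  have g: "g > 0" using assms by (simp add: g_def)
  have valb: "val w y \<le> val w a + g" if "w \<in> X" "y \<le> b" for w y
    using X[OF that(1)] that(2) by (simp add: val_shift[of w y a] g_def divide_right_mono)
  have valb': "val w b = val w a + g" if "w \<in> X" for w
    using X[OF that] by (simp add: val_shift[of w b a] g_def)
  have X0: "adm 0 w y" if "w \<in> X" "y \<in> {a..<b}" for w y
    using X[OF that(1)] that(2) adm_antimono[of t w y 0] assms(2) by (auto simp: arr_def)
  have va: "a \<le> val w a" if "w \<in> X" for w
    using X[OF that] assms(1) by (auto simp: arr_def)
  \<comment> \<open>At the open end b, \<open>arr\<close> says nothing directly; since
    \<open>val w\<close> has slope at most 1, overshooting at b would mean overshooting slightly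
    before b.\<close>
  have vb: "val w b \<le> b" if "w \<in> X" for w
  proof (rule ccontr)
    assume "\<not> ?thesis"
    then have gt: "val w b > b" by simp
    define y where "y = max a (b - (val w b - b))"
    have y: "a \<le> y" "y < b" "b - y \<le> val w b - b" using gt assms(1) by (auto simp: y_def)
    have "(b - y) / \<beta> ^ n \<le> b - y"
      using y beta_power_ge_1[of n] by (simp add: divide_le_eq mult_le_cancel_left1)
    moreover have "val w y = val w b - (b - y) / \<beta> ^ n"
      using X[OF that] by (simp add: val_shift[of w y b] diff_divide_distrib)
    ultimately have "val w y \<ge> b" using y by linarith
    moreover have "val w y < b" using X[OF that] y by (auto simp: arr_def)
    ultimately show False by simp
  qed
  \<comment> \<open>If two images overlapped, the left end of one would be a point of the other and
    have two expansions.\<close>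
  have sep: "val w a + g \<le> val w' a" if w: "w \<in> X" "w' \<in> X" "val w a \<le> val w' a" "w \<noteq> w'" for w w'
  proof (rule ccontr)
    assume "\<not> ?thesis"
    then have lt: "val w' a < val w a + g" by simp
    define y where "y = a + (val w' a - val w a) * \<beta> ^ n"
    have "(val w' a - val w a) * \<beta> ^ n < g * \<beta> ^ n" using lt by (intro mult_strict_right_mono) auto
    then have "y \<in> {a..<b}" using w(3) beta_pos by (simp add: y_def g_def)
    moreover have "val w y = val w' a"
      unfolding val_shift[of w y a] using X[OF w(1)] beta_pos by (simp add: y_def)
    ultimately have "w = w'"
      using X0 w X assms(1) by (intro val_inj[of w y w' a]) auto
    with w show False by simp
  qed
  have Xne: "X \<noteq> {}" using assms by auto
  have fin: "finite ((\<lambda>w. val w a) ` X)" "(\<lambda>w. val w a) ` X \<noteq> {}" using assms(4) Xne by auto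
  obtain wtop where wtop: "wtop \<in> X" "\<And>w. w \<in> X \<Longrightarrow> val w a \<le> val wtop a"
    using Max_in[OF fin] Max_ge[OF fin(1)] by auto
  obtain bot where bot: "bot \<in> X" "\<And>w. w \<in> X \<Longrightarrow> val bot a \<le> val w a"
    using Min_in[OF fin] Min_le[OF fin(1)] by auto
  have "card {wtop, bot} \<le> 2" by (simp add: card_insert_if)
  then have "card (X - {wtop, bot}) \<ge> c"
    using assms(5) diff_card_le_card_Diff[of "{wtop, bot}" X] by simp
  then obtain W where W: "W \<subseteq> X - {wtop, bot}" "card W = c" "finite W"
    by (meson obtain_subset_with_card_n)
  have WX: "w \<in> X" if "w \<in> W" for w using W that by auto
  have Wlow: "a + g \<le> val w a" if "w \<in> W" for w
    using sep[of bot w] bot va[of bot] WX[OF that] W(1) that by force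
  have Wtop: "val w a + g \<le> val wtop a" if "w \<in> W" for w
    using sep[of w wtop] wtop WX[OF that] W(1) that by force
  have topb: "val wtop a + g \<le> b" using vb[OF wtop(1)] valb'[OF wtop(1)] by simp
  have Wy: "a + g \<le> val w y \<and> val w y \<le> val wtop a" if "w \<in> W" "y \<in> {a..b}" for w y
  proof -
    have "val w a \<le> val w y" using that by simp
    moreover have "val w y \<le> val w a + g" using valb WX that by auto
    ultimately show ?thesis using Wlow[OF that(1)] Wtop[OF that(1)] by linarith
  qed
  \<comment> \<open>Adjacent images may touch, but points of \<open>{a + g..b - g}\<close> are sent
    at least \<open>g / \<beta> ^ n\<close> to the right of the left end of their image.\<close>
  have sep2: "\<bar>val w y - val w' y'\<bar> \<ge> g / \<beta> ^ n"
    if "w \<in> W" "w' \<in> W" "w \<noteq> w'" "y \<in> {a + g..b - g}" "y' \<in> {a + g..b - g}" for w w' y y'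
  proof -
    have *: "val w' y' - val w y \<ge> g / \<beta> ^ n"
      if "w \<in> W" "w' \<in> W" "w \<noteq> w'" "y \<in> {a + g..b - g}" "y' \<in> {a + g..b - g}"
        "val w a \<le> val w' a" for w w' y y'
    proof -
      have 1: "val w a + g \<le> val w' a" using sep that WX by blast
      have 2: "val w y = val w a + (y - a) / \<beta> ^ n" "val w' y' = val w' a + (y' - a) / \<beta> ^ n"
        using X[OF WX[OF that(1)]] X[OF WX[OF that(2)]] by (simp_all add: val_shift[of w y a] val_shift[of w' y' a])
      have "y - a \<le> b - a" using that g by simp
      then have 3: "(y - a) / \<beta> ^ n \<le> g" unfolding g_def by (intro divide_right_mono) auto
      have 4: "(y' - a) / \<beta> ^ n \<ge> g / \<beta> ^ n" using that by (intro divide_right_mono) auto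
      show ?thesis using 1 2 3 4 by linarith
    qed
    show ?thesis using *[of w w' y y'] *[of w' w y' y] that by (cases "val w a \<le> val w' a") auto
  qed
  obtain h where h: "bij_betw h {..<c} W"
    using W by (metis bij_betw_from_nat_into_finite finite_same_card_bij finite_lessThan card_lessThan)
  have hW: "h i \<in> W" if "i < c" for i using h that by (auto simp: bij_betw_def)
  define \<Omega> where "\<Omega> = {\<omega> :: nat \<Rightarrow> nat. \<forall>k. \<omega> k < c}"
  \<comment> \<open>Coding map of the attractor, written as a series because
    \<open>val w y = val w 0 + y / \<beta> ^ n\<close>.\<close>
  define \<pi> where "\<pi> \<omega> = ser (\<beta> ^ n) (\<lambda>k. val (h (\<omega> k)) 0)" for \<omega>
  define sh where "sh \<omega> = (\<lambda>k. \<omega> (Suc k))" for \<omega> :: "nat \<Rightarrow> nat"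
  have sh: "sh \<omega> \<in> \<Omega>" if "\<omega> \<in> \<Omega>" for \<omega> using that by (auto simp: sh_def \<Omega>_def)
  define B where "B = Max ((\<lambda>w. \<bar>val w 0\<bar>) ` W)"
  have r1: "\<beta> ^ n > 1" using beta_gt_1 assms(3) by (simp add: one_less_power)
  have val0: "0 \<le> val w 0" for w by (induction w) (use beta_pos in auto)
  have B: "0 \<le> val (h (\<omega> k)) 0" "val (h (\<omega> k)) 0 \<le> B" "\<bar>val (h (\<omega> k)) 0\<bar> \<le> B" if "\<omega> \<in> \<Omega>" for \<omega> k
  proof -
    have "\<bar>val (h (\<omega> k)) 0\<bar> \<le> B" unfolding B_def using hW that W(3)
      by (intro Max_ge) (auto simp: \<Omega>_def)
    with val0[of "h (\<omega> k)"] show "0 \<le> val (h (\<omega> k)) 0" "val (h (\<omega> k)) 0 \<le> B" "\<bar>val (h (\<omega> k)) 0\<bar> \<le> B" by auto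
  qed
  have pirec: "\<pi> \<omega> = val (h (\<omega> 0)) (\<pi> (sh \<omega>))" if "\<omega> \<in> \<Omega>" for \<omega>
  proof -
    have "\<pi> \<omega> = val (h (\<omega> 0)) 0 + \<pi> (sh \<omega>) / \<beta> ^ n"
      unfolding \<pi>_def sh_def using ser_rec[OF r1, of "\<lambda>k. val (h (\<omega> k)) 0" B] B[OF that] by simp
    also have "\<dots> = val (h (\<omega> 0)) (\<pi> (sh \<omega>))"
      using X[OF WX[OF hW]] that by (subst val_shift[of _ "\<pi> (sh \<omega>)" 0]) (auto simp: \<Omega>_def)
    finally show ?thesis .
  qed
  define M where "M = B * \<beta> ^ n / (\<beta> ^ n - 1) + \<bar>a\<bar> + \<bar>b\<bar>"
  have pibound: "0 \<le> \<pi> \<omega> \<and> \<pi> \<omega> \<le> B * \<beta> ^ n / (\<beta> ^ n - 1)" if "\<omega> \<in> \<Omega>" for \<omega>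
    unfolding \<pi>_def using ser_bounds[OF r1 B(1)[OF that] B(2)[OF that]] by simp
  \<comment> \<open>The series bound locates the attractor only roughly; every contraction that maps
    \<open>{a..b}\<close> into itself shrinks the error by \<open>\<beta> ^ n\<close>.\<close>
  have approx: "a - M / (\<beta> ^ n) ^ m \<le> \<pi> \<omega> \<and> \<pi> \<omega> \<le> b + M / (\<beta> ^ n) ^ m" if "\<omega> \<in> \<Omega>" for m \<omega>
    using that
  proof (induction m arbitrary: \<omega>)
    case 0
    then show ?case using pibound[of \<omega>] by (auto simp: M_def)
  next
    case (Suc m)
    let ?w = "h (\<omega> 0)"
    have w: "?w \<in> W" using hW Suc.prems by (auto simp: \<Omega>_def)
    have *: "val ?w (x + e) = val ?w x + e / \<beta> ^ n" for x e
      using X[OF WX[OF w]] by (simp add: val_shift[of ?w "x + e" x])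
    have "val ?w (a + (- (M / (\<beta> ^ n) ^ m))) \<le> \<pi> \<omega> \<and> \<pi> \<omega> \<le> val ?w (b + M / (\<beta> ^ n) ^ m)"
      unfolding pirec[OF Suc.prems] using Suc.IH[OF sh[OF Suc.prems]] by simp
    then show ?case unfolding * using va[OF WX[OF w]] vb[OF WX[OF w]] by (auto simp: mult.commute)
  qed
  have lim: "(\<lambda>m. M / (\<beta> ^ n) ^ m) \<longlonglongrightarrow> 0"
    using LIMSEQ_divide_realpow_zero[of "\<beta> ^ n" M] r1 by simp
  have piab: "\<pi> \<omega> \<in> {a..b}" if "\<omega> \<in> \<Omega>" for \<omega>
  proof -
    have "(\<lambda>m. a - M / (\<beta> ^ n) ^ m) \<longlonglongrightarrow> a - 0" by (intro tendsto_intros lim)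
    then have "a - 0 \<le> \<pi> \<omega>" by (rule LIMSEQ_le_const2) (use approx[OF that] in auto)
    moreover have "(\<lambda>m. b + M / (\<beta> ^ n) ^ m) \<longlonglongrightarrow> b + 0" by (intro tendsto_intros lim)
    then have "\<pi> \<omega> \<le> b + 0" by (rule LIMSEQ_le_const) (use approx[OF that] in auto)
    ultimately show ?thesis by simp
  qed
  have piab': "\<pi> \<omega> \<in> {a + g..b - g}" if "\<omega> \<in> \<Omega>" for \<omega>
    using Wy[OF hW[of "\<omega> 0"] piab[OF sh[OF that]]] topb that unfolding pirec[OF that] by (simp add: \<Omega>_def)
  have far: "\<bar>\<pi> \<omega> - \<pi> \<omega>'\<bar> \<ge> g / \<beta> ^ n / (\<beta> ^ n) ^ k"
    if "\<omega> \<in> \<Omega>" "\<omega>' \<in> \<Omega>" "\<And>i. i < k \<Longrightarrow> \<omega> i = \<omega>' i" "\<omega> k \<noteq> \<omega>' k" for k \<omega> \<omega>'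
    using that
  proof (induction k arbitrary: \<omega> \<omega>')
    case 0
    have lt: "\<omega> 0 < c" "\<omega>' 0 < c" using 0 by (auto simp: \<Omega>_def)
    then have "h (\<omega> 0) \<noteq> h (\<omega>' 0)" using h 0 by (auto simp: bij_betw_def inj_on_def)
    then show ?case unfolding pirec[OF 0(1)] pirec[OF 0(2)]
      using sep2[OF hW[OF lt(1)] hW[OF lt(2)] _ piab'[OF sh[OF 0(1)]] piab'[OF sh[OF 0(2)]]] by simp
  next
    case (Suc k)
    have IH: "\<bar>\<pi> (sh \<omega>) - \<pi> (sh \<omega>')\<bar> \<ge> g / \<beta> ^ n / (\<beta> ^ n) ^ k"
      using Suc.prems by (intro Suc.IH sh) (auto simp: sh_def)
    have len: "length (h (\<omega> 0)) = n" using X[OF WX[OF hW]] Suc.prems(1) by (auto simp: \<Omega>_def)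
    have "\<pi> \<omega> - \<pi> \<omega>' = (\<pi> (sh \<omega>) - \<pi> (sh \<omega>')) / \<beta> ^ n"
    proof -
      have e: "\<omega>' 0 = \<omega> 0" using Suc.prems(3)[of 0] by simp
      show ?thesis
        unfolding pirec[OF Suc.prems(1)] pirec[OF Suc.prems(2)] e val_diff len by simp
    qed
    then have "\<bar>\<pi> \<omega> - \<pi> \<omega>'\<bar> = \<bar>\<pi> (sh \<omega>) - \<pi> (sh \<omega>')\<bar> / \<beta> ^ n" using beta_pos by simp
    moreover have "\<dots> \<ge> g / \<beta> ^ n / (\<beta> ^ n) ^ k / \<beta> ^ n" using IH beta_pos by (intro divide_right_mono) auto
    ultimately show ?case by (simp add: mult.commute mult.left_commute)
  qed
  have inj: "inj_on \<pi> \<Omega>"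
  proof (rule inj_onI)
    fix \<omega> \<omega>' assume *: "\<omega> \<in> \<Omega>" "\<omega>' \<in> \<Omega>" "\<pi> \<omega> = \<pi> \<omega>'"
    show "\<omega> = \<omega>'"
    proof (rule ccontr)
      assume "\<omega> \<noteq> \<omega>'"
      then obtain k where "\<omega> k \<noteq> \<omega>' k" "\<And>i. i < k \<Longrightarrow> \<omega> i = \<omega>' i" by (rule first_difference) blast
      then have "g / \<beta> ^ n / (\<beta> ^ n) ^ k \<le> 0" using far[OF *(1,2), of k] *(3) by simp
      moreover have "g / \<beta> ^ n / (\<beta> ^ n) ^ k > 0" using g beta_pos by simp
      ultimately show False by simp
    qed
  qed
  define Z where "Z = \<pi> ` \<Omega>"
  define \<phi> where "\<phi> z = base_val c (inv_into \<Omega> \<pi> z)" for z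
  \<comment> \<open>Chosen so that \<open>(\<beta> ^ n) powr s = c\<close>: the scale
    \<open>1 / c ^ k\<close> of \<open>base_val\<close> is the s-th power of the scale of Z at depth
    k.\<close>
  define s where "s = log \<beta> (real c) / real n"
  have s: "s > 0" using assms beta_gt_1 by (simp add: s_def)
  have cs: "(\<beta> ^ n) powr s = real c"
  proof -
    have "(\<beta> ^ n) powr s = (\<beta> powr real n) powr s" using beta_pos by (simp add: powr_realpow)
    also have "\<dots> = real c" using assms beta_gt_1 by (simp add: powr_powr s_def)
    finally show ?thesis .
  qed
  have "ennreal s \<le> hausdorff_dim Z"
  proof (rule hausdorff_dim_ge_hoelder[where \<phi> = \<phi> and C = "(\<beta> ^ n / g) powr s"])
    show "{0..<1} \<subseteq> \<phi> ` Z"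
    proof
      fix x :: real assume "x \<in> {0..<1}"
      then obtain \<omega> where "\<And>k. \<omega> k < c" "base_val c \<omega> = x" using base_val_onto[OF assms(6)] by auto
      then show "x \<in> \<phi> ` Z" using inj unfolding \<phi>_def Z_def
        by (intro image_eqI[of _ _ "\<pi> \<omega>"]) (auto simp: \<Omega>_def)
    qed
    fix x y assume "x \<in> Z" "y \<in> Z"
    then obtain \<omega> \<omega>' where *: "\<omega> \<in> \<Omega>" "\<omega>' \<in> \<Omega>" "x = \<pi> \<omega>" "y = \<pi> \<omega>'" by (auto simp: Z_def)
    then have \<phi>: "\<phi> x = base_val c \<omega>" "\<phi> y = base_val c \<omega>'" using inj by (auto simp: \<phi>_def)
    show "\<bar>\<phi> x - \<phi> y\<bar> \<le> (\<beta> ^ n / g) powr s * dist x y powr s"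
    proof (cases "\<omega> = \<omega>'")
      case True
      then show ?thesis using \<phi> by simp
    next
      case False
      then obtain k where k: "\<omega> k \<noteq> \<omega>' k" "\<And>i. i < k \<Longrightarrow> \<omega> i = \<omega>' i" by (rule first_difference) blast
      have "\<bar>\<phi> x - \<phi> y\<bar> \<le> 1 / real c ^ k"
        unfolding \<phi> using * k assms(6) by (intro base_val_close) (auto simp: \<Omega>_def)
      also have "\<dots> = (1 / (\<beta> ^ n) ^ k) powr s"
      proof -
        have "((\<beta> ^ n) ^ k) powr s = ((\<beta> ^ n) powr s) ^ k"
          by (induction k) (simp_all add: powr_mult)
        then show ?thesis using beta_pos by (simp add: powr_divide cs)
      qed
      also have "\<dots> \<le> (\<beta> ^ n / g * dist x y) powr s"
      proof -
        have "g / \<beta> ^ n / (\<beta> ^ n) ^ k \<le> dist x y" using far[OF *(1,2) k(2,1)] * by (simp add: dist_real_def)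
        then have "1 / (\<beta> ^ n) ^ k \<le> \<beta> ^ n / g * dist x y" using g beta_pos by (simp add: field_simps)
        then show ?thesis using s beta_pos by (intro powr_mono2) auto
      qed
      also have "\<dots> = (\<beta> ^ n / g) powr s * dist x y powr s" by (rule powr_mult)
      finally show ?thesis .
    qed
  qed (use s g beta_pos in auto)
  moreover have "scheme t a b n W wtop Z"
    unfolding scheme_def g_def[symmetric]
  proof (intro conjI ballI)
    show "W \<noteq> {}" using W assms(6) by auto
    show "length w = n" "arr t {a..<b} w {a..<b}" if "w \<in> insert wtop W" for w
      using X wtop(1) WX that by auto
    show "a + g \<le> val w y" "val w y \<le> val wtop a" if "w \<in> W" "y \<in> {a..b}" for w y using Wy[OF that] by auto
    show "val wtop a \<le> b - g" using topb by simp
    show "Z \<noteq> {}" using assms(6) by (auto simp: Z_def \<Omega>_def intro!: exI[of _ "\<lambda>_. 0"])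
    show "Z \<subseteq> {a + g..b - g}" using piab' unfolding Z_def by blast
    show "\<exists>w\<in>W. \<exists>z'\<in>Z. z = val w z'" if z: "z \<in> Z" for z
    proof -
      obtain \<omega> where \<omega>: "\<omega> \<in> \<Omega>" "z = \<pi> \<omega>" using z by (auto simp: Z_def)
      have "h (\<omega> 0) \<in> W" using hW \<omega> by (auto simp: \<Omega>_def)
      moreover have "\<pi> (sh \<omega>) \<in> Z" using sh \<omega> unfolding Z_def by blast
      ultimately show ?thesis using pirec[OF \<omega>(1)] \<omega>(2) by blast
    qed
  qed (use assms W in auto)
  ultimately show thesis using that unfolding s_def by blast
qed


section \<open>Admissible words and the dimension of the survivor set\<close>

definition adm_words :: "real \<Rightarrow> nat list set" where
  "adm_words t = {w. \<exists>y. adm t w y}"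

lemma finite_adm_words:
  assumes "0 \<le> t"
  shows "finite {w \<in> adm_words t. length w = n}"
proof (rule finite_subset)
  show "{w \<in> adm_words t. length w = n} \<subseteq> {w. set w \<subseteq> {..<nat \<lceil>\<beta>\<rceil>} \<and> length w = n}"
    using adm_digits assms unfolding adm_words_def by blast
qed (simp add: finite_lists_length_eq)

lemma adm_words_eq_paths:
  assumes "t < 1"
  shows "adm_words t = paths t {} (t, 1)"
proof -
  have "alive (run t (t, 1) w) \<longleftrightarrow> (\<exists>y. adm t w y)" for w
  proof -
    have "alive (run t (t, 1) w) \<longleftrightarrow> (\<exists>y. y \<in> itv (run t (t, 1) w))" unfolding alive_iff by blast
    also have "\<dots> \<longleftrightarrow> (\<exists>y. adm t w y)"
      using itv_run[of t "(t, 1)" _ w] adm_bounds[of t w] by (auto simp: inside_def itv_def[of "(t, 1)"])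
    finally show ?thesis .
  qed
  then show ?thesis by (auto simp: adm_words_def paths_def)
qed

lemma card_adm_words_add:
  assumes "0 \<le> t"
  shows "card {w \<in> adm_words t. length w = m + n}
    \<le> card {w \<in> adm_words t. length w = m} * card {w \<in> adm_words t. length w = n}"
proof -
  let ?A = "\<lambda>n. {w \<in> adm_words t. length w = n}"
  have "?A (m + n) \<subseteq> (\<lambda>(u, v). u @ v) ` (?A m \<times> ?A n)"
  proof
    fix w assume w: "w \<in> ?A (m + n)"
    then obtain y where y: "adm t w y" by (auto simp: adm_words_def)
    then have "adm t (take m w) (val (drop m w) y)" "adm t (drop m w) y"
      using adm_append[of t "take m w" "drop m w" y] by auto
    then have "(take m w, drop m w) \<in> ?A m \<times> ?A n" using w by (auto simp: adm_words_def)
    then show "w \<in> (\<lambda>(u, v). u @ v) ` (?A m \<times> ?A n)" by (rule rev_image_eqI) simp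
  qed
  then have "card (?A (m + n)) \<le> card ((\<lambda>(u, v). u @ v) ` (?A m \<times> ?A n))"
    using finite_adm_words[OF assms] by (intro card_mono) auto
  also have "\<dots> \<le> card (?A m \<times> ?A n)" using finite_adm_words[OF assms] by (intro card_image_le) auto
  finally show ?thesis by (simp add: card_cartesian_product)
qed

lemma card_adm_words_mult:
  assumes "0 \<le> t"
  shows "card {w \<in> adm_words t. length w = k * n} \<le> card {w \<in> adm_words t. length w = n} ^ k"
proof (induction k)
  case 0
  have "{w \<in> adm_words t. length w = 0 * n} \<subseteq> {[]}" by auto
  then have "card {w \<in> adm_words t. length w = 0 * n} \<le> card {[] :: nat list}" by (intro card_mono) auto
  then show ?case by simp
next
  case (Suc k)
  have "card {w \<in> adm_words t. length w = Suc k * n}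
      \<le> card {w \<in> adm_words t. length w = n} * card {w \<in> adm_words t. length w = k * n}"
    using card_adm_words_add[OF assms, of n "k * n"] by simp
  also have "\<dots> \<le> card {w \<in> adm_words t. length w = n} * card {w \<in> adm_words t. length w = n} ^ k"
    by (rule mult_le_mono2[OF Suc])
  finally show ?case by simp
qed

lemma survivor_beta_map:
  assumes "x \<in> survivor_set \<beta> t"
  shows "beta_map \<beta> x \<in> survivor_set \<beta> t"
proof -
  have "(beta_map \<beta> ^^ n) (beta_map \<beta> x) \<ge> t" for n
    using assms unfolding survivor_set_def by (metis (mono_tags, lifting) funpow_Suc_right comp_apply mem_Collect_eq)
  then show ?thesis unfolding survivor_set_def by (simp add: beta_map_def frac_lt_1)
qed

lemma survivor_funpow:
  "x \<in> survivor_set \<beta> t \<Longrightarrow> (beta_map \<beta> ^^ k) x \<in> survivor_set \<beta> t"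
  by (induction k) (auto intro: survivor_beta_map)

lemma survivor_bounds: "x \<in> survivor_set \<beta> t \<Longrightarrow> t \<le> x \<and> 0 \<le> x \<and> x < 1"
  unfolding survivor_set_def by (auto dest: spec[of _ 0])

lemma survivor_expansion:
  assumes "x \<in> survivor_set \<beta> t"
  shows "\<exists>w. length w = n \<and> adm t w ((beta_map \<beta> ^^ n) x) \<and> val w ((beta_map \<beta> ^^ n) x) = x"
  using assms
proof (induction n arbitrary: x)
  case (Suc n)
  have x: "t \<le> x" "0 \<le> x" "x < 1" using survivor_bounds[OF Suc.prems] by auto
  obtain w where w: "length w = n" "adm t w ((beta_map \<beta> ^^ n) (beta_map \<beta> x))"
    "val w ((beta_map \<beta> ^^ n) (beta_map \<beta> x)) = beta_map \<beta> x"
    using Suc.IH[OF survivor_beta_map[OF Suc.prems]] by blast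
  have "0 \<le> \<beta> * x" using x beta_pos by simp
  then have "real (nat \<lfloor>\<beta> * x\<rfloor>) + beta_map \<beta> x = \<beta> * x" by (simp add: beta_map_def frac_def)
  then have v: "val (nat \<lfloor>\<beta> * x\<rfloor> # w) ((beta_map \<beta> ^^ Suc n) x) = x"
    using w beta_pos by (simp add: funpow_swap1)
  then have "adm t (nat \<lfloor>\<beta> * x\<rfloor> # w) ((beta_map \<beta> ^^ Suc n) x)"
    using w(2) x by (simp add: funpow_swap1)
  with v w show ?case by (intro exI[of _ "nat \<lfloor>\<beta> * x\<rfloor> # w"]) simp
qed (use survivor_bounds in auto)

lemma in_survivorI:
  assumes "\<And>n. t \<le> (beta_map \<beta> ^^ n) x" "0 \<le> t" "x < 1"
  shows "x \<in> survivor_set \<beta> t"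
  using assms(1)[of 0] assms unfolding survivor_set_def by auto

lemma survivor_antimono: "t \<le> t' \<Longrightarrow> survivor_set \<beta> t' \<subseteq> survivor_set \<beta> t"
  unfolding survivor_set_def by (auto intro: order_trans)

text \<open>A word \<open>w\<close> confines \<open>x\<close> to an interval of length \<open>\<beta>\<^sup>-\<^sup>n\<close>, which covers the survivor set
  by as many intervals as there are admissible words.\<close>

lemma dim_survivor_le:
  fixes c :: real
  assumes "0 \<le> t" "n \<ge> 1" "0 \<le> c" "real (card {w \<in> adm_words t. length w = n}) \<le> \<beta> powr (c * n)"
  shows "hausdorff_dim (survivor_set \<beta> t) \<le> ennreal c"
proof -
  have null: "hausdorff_measure s (survivor_set \<beta> t) = 0" if "s > c" for s
    unfolding hausdorff_measure_eq_0_iff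
  proof (intro allI impI)
    fix \<delta> e :: real assume "\<delta> > 0" "e > 0"
    \<comment> \<open>Covering with words of length \<open>k * n\<close> costs at most
      \<open>q ^ k\<close>.\<close>
    define q where "q = \<beta> powr (- (s - c) * n)"
    define p where "p = 1 / \<beta> ^ n"
    have "- (s - c) * n < 0" using that assms(2) by (intro mult_neg_pos) auto
    then have "q < \<beta> powr 0" unfolding q_def using beta_gt_1 by (intro powr_less_mono)
    then have q: "0 < q" "q < 1" using beta_pos by (auto simp: q_def)
    have p: "0 < p" "p < 1" using assms(2) beta_gt_1 beta_pos by (auto simp: p_def one_less_power)
    have "(\<lambda>k. q ^ k) \<longlonglongrightarrow> 0" "(\<lambda>k. p ^ k) \<longlonglongrightarrow> 0" using p q by (intro LIMSEQ_realpow_zero; simp)+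
    then have "\<forall>\<^sub>F k in sequentially. q ^ k < e" "\<forall>\<^sub>F k in sequentially. p ^ k < \<delta>"
      using \<open>e > 0\<close> \<open>\<delta> > 0\<close> by (auto dest: order_tendstoD)
    then have "\<forall>\<^sub>F k in sequentially. q ^ k < e \<and> p ^ k < \<delta>" by eventually_elim auto
    then obtain k where k: "q ^ k < e" "p ^ k < \<delta>" using eventually_happens'[OF sequentially_bot] by blast
    let ?A = "{w \<in> adm_words t. length w = k * n}"
    define \<U> where "\<U> = (\<lambda>w. val w ` {0..<1}) ` ?A"
    have fin: "finite \<U>" unfolding \<U>_def using finite_adm_words[OF assms(1)] by auto
    have cov: "survivor_set \<beta> t \<subseteq> \<Union>\<U>"
    proof
      fix x assume x: "x \<in> survivor_set \<beta> t"
      obtain w where w: "length w = k * n" "adm t w ((beta_map \<beta> ^^ (k * n)) x)"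
        "val w ((beta_map \<beta> ^^ (k * n)) x) = x" using survivor_expansion[OF x] by blast
      have "(beta_map \<beta> ^^ (k * n)) x \<in> {0..<1}"
        using survivor_bounds[OF survivor_funpow[OF x]] by auto
      then have "x \<in> val w ` {0..<1}" using w(3) by (intro image_eqI[of _ _ "(beta_map \<beta> ^^ (k * n)) x"]) auto
      moreover have "w \<in> ?A" using w by (auto simp: adm_words_def)
      ultimately show "x \<in> \<Union>\<U>" unfolding \<U>_def by blast
    qed
    have diam: "bounded U \<and> diameter U \<le> p ^ k" if U: "U \<in> \<U>" for U
    proof -
      obtain w where w: "length w = k * n" "U = val w ` {0..<1}" using U by (auto simp: \<U>_def)
      have "dist x y \<le> p ^ k" if "x \<in> U" "y \<in> U" for x y
      proof -
        obtain x' y' where *: "x = val w x'" "y = val w y'" "x' \<in> {0..<1}" "y' \<in> {0..<1}"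
          using \<open>x \<in> U\<close> \<open>y \<in> U\<close> w by auto
        have "dist x y = \<bar>x' - y'\<bar> / \<beta> ^ (k * n)"
          unfolding * dist_real_def val_diff w(1) by simp
        also have "\<dots> \<le> 1 / \<beta> ^ (k * n)" using * by (intro divide_right_mono) auto
        also have "\<dots> = p ^ k" by (simp add: p_def power_one_over mult.commute flip: power_mult)
        finally show ?thesis .
      qed
      note dist = this
      have "val w 0 \<in> U" using w by auto
      then have "bounded U" using dist unfolding bounded_def by blast
      moreover have "diameter U \<le> p ^ k"
        using dist p by (intro diameter_le) (auto simp: dist_real_def)
      ultimately show ?thesis by blast
    qed
    have "0 \<le> p ^ k" "s > 0" using p assms(3) that by auto
    then obtain V where V: "survivor_set \<beta> t \<subseteq> (\<Union>i. V i)" "\<forall>i. bounded (V i) \<and> diameter (V i) \<le> p ^ k"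
      "(\<Sum>i::nat. diam_pow s (V i)) \<le> ennreal (real (card \<U>) * (p ^ k) powr s)"
      using hausdorff_measure_0_finite_cover[OF fin cov diam, of s] by blast
    have "card \<U> \<le> card ?A" unfolding \<U>_def using finite_adm_words[OF assms(1)] by (intro card_image_le)
    also have "\<dots> \<le> card {w \<in> adm_words t. length w = n} ^ k" by (rule card_adm_words_mult[OF assms(1)])
    finally have "real (card \<U>) \<le> real (card {w \<in> adm_words t. length w = n}) ^ k"
      by (metis of_nat_le_iff of_nat_power)
    also have "\<dots> \<le> (\<beta> powr (c * n)) ^ k" using assms(4) by (intro power_mono) auto
    finally have le: "real (card \<U>) \<le> (\<beta> powr (c * n)) ^ k" .
    have "(p ^ k) powr s = (p powr s) ^ k" by (induction k) (simp_all add: powr_mult)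
    also have "p powr s = \<beta> powr (- s * n)"
      using beta_pos by (simp add: p_def powr_divide powr_minus_divide powr_powr mult.commute flip: powr_realpow)
    finally have pe: "(p ^ k) powr s = (\<beta> powr (- s * n)) ^ k" .
    have "real (card \<U>) * (p ^ k) powr s \<le> (\<beta> powr (c * n)) ^ k * (p ^ k) powr s"
      using le by (intro mult_right_mono) auto
    also have "\<dots> = q ^ k"
      unfolding pe by (simp add: q_def algebra_simps flip: power_mult_distrib powr_add)
    finally have "real (card \<U>) * (p ^ k) powr s < e" using k by simp
    then have "(\<Sum>i::nat. diam_pow s (V i)) < ennreal e"
      using V(3) \<open>e > 0\<close> by (meson ennreal_lessI order_le_less_trans)
    moreover have "\<forall>i. bounded (V i) \<and> diameter (V i) \<le> \<delta>" using V(2) k by (meson less_imp_le order_trans)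
    ultimately show "\<exists>U. survivor_set \<beta> t \<subseteq> (\<Union>i. U i) \<and> (\<forall>i. bounded (U i) \<and> diameter (U i) \<le> \<delta>) \<and>
        (\<Sum>i::nat. diam_pow s (U i)) < ennreal e" using V(1) by blast
  qed
  have "hausdorff_dim (survivor_set \<beta> t) \<le> ennreal (c + e)" if "e > 0" for e
    using null[of "c + e"] that assms(3) by (intro hausdorff_dim_le) auto
  note le = this
  show ?thesis
  proof (rule ennreal_le_epsilon)
    fix e :: real assume "e > 0"
    then have "ennreal (c + e) = ennreal c + ennreal e" using assms(3) by (intro ennreal_plus) auto
    then show "hausdorff_dim (survivor_set \<beta> t) \<le> ennreal c + ennreal e" using le[OF \<open>e > 0\<close>] by simp
  qed
qed

text \<open>Too few words of one single length n would already bound the dimension below s, so the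
  estimate holds at every length without a constant.\<close>

lemma card_adm_words_ge:
  fixes s :: real
  assumes "0 \<le> t" "0 < s" "ennreal s \<le> hausdorff_dim (survivor_set \<beta> t)" "n \<ge> 1"
  shows "\<beta> powr (s * n) \<le> real (card {w \<in> adm_words t. length w = n})"
proof (rule ccontr)
  let ?N = "real (card {w \<in> adm_words t. length w = n})"
  assume "\<not> ?thesis"
  then have lt: "?N < \<beta> powr (s * n)" by simp
  define c where "c = (if ?N \<le> 1 then 0 else log \<beta> ?N / n)"
  have "?N \<le> \<beta> powr (c * n)" "0 \<le> c" using assms(4) beta_gt_1 by (auto simp: c_def)
  then have "hausdorff_dim (survivor_set \<beta> t) \<le> ennreal c"
    using assms by (intro dim_survivor_le)
  moreover have "c < s"
  proof (cases "?N \<le> 1")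
    case False
    then have "log \<beta> ?N < s * n" using lt beta_gt_1 by (subst log_less_iff) auto
    then show ?thesis using False assms(4) by (simp add: c_def field_simps)
  qed (use assms in \<open>auto simp: c_def\<close>)
  ultimately have "ennreal s \<le> ennreal c" "c < s" using assms(3) by auto
  then show False using assms(2) \<open>0 \<le> c\<close> by (simp add: ennreal_le_iff2)
qed

text \<open>Each length contributes at least 1. The case where s equals the dimension is the one
  needed later.\<close>

lemma not_summable_adm_words:
  assumes "0 \<le> t" "0 < s" "ennreal s \<le> hausdorff_dim (survivor_set \<beta> t)"
  shows "\<not> summable_weight (\<beta> powr - s) (adm_words t)"
proof
  assume "summable_weight (\<beta> powr - s) (adm_words t)"
  then obtain C where C: "\<And>F. finite F \<Longrightarrow> F \<subseteq> adm_words t \<Longrightarrow> weight (\<beta> powr - s) F \<le> C"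
    unfolding summable_weight_def by blast
  let ?A = "\<lambda>n. {w \<in> adm_words t. length w = n}"
  have one: "1 \<le> weight (\<beta> powr - s) (?A n)" if "n \<ge> 1" for n
  proof -
    have "1 = \<beta> powr (s * n) * (\<beta> powr - s) ^ n"
      using beta_pos by (simp add: powr_power flip: powr_add)
    also have "\<dots> \<le> real (card (?A n)) * (\<beta> powr - s) ^ n"
      using card_adm_words_ge[OF assms that] by (intro mult_right_mono) auto
    also have "\<dots> = weight (\<beta> powr - s) (?A n)" by (simp add: weight_def)
    finally show ?thesis .
  qed
  have "real N \<le> C" for N
  proof -
    have "real N = (\<Sum>n\<in>{1..N}. 1)" by simp
    also have "\<dots> \<le> (\<Sum>n\<in>{1..N}. weight (\<beta> powr - s) (?A n))" using one by (intro sum_mono) auto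
    also have "\<dots> = weight (\<beta> powr - s) (\<Union>n\<in>{1..N}. ?A n)"
      unfolding weight_def using finite_adm_words[OF assms(1)] by (intro sum.UNION_disjoint[symmetric]) auto
    also have "\<dots> \<le> C" using finite_adm_words[OF assms(1)] by (intro C) auto
    finally show ?thesis .
  qed
  then show False using reals_Archimedean2[of C] by (auto simp: not_less[symmetric])
qed

text \<open>Divergence at s yields lengths with more than \<open>(\<beta> powr s1) ^ n\<close>
  loops, for any \<open>s1 < s\<close>; the passage from \<open>s1\<close> to \<open>s'\<close> pays
  for the two discarded words.\<close>

lemma rich_scheme:
  assumes "0 \<le> t" "a < b" "\<And>w. w \<in> X \<Longrightarrow> arr t {a..<b} w {a..<b}"
    and "\<not> summable_weight (\<beta> powr - s) X" "0 \<le> s'" "s' < s"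
  obtains n W wtop Z where "scheme t a b n W wtop Z" "ennreal s' \<le> hausdorff_dim Z"
proof -
  define s1 where "s1 = (s' + s) / 2"
  have s1: "s' < s1" "s1 < s" using assms by (auto simp: s1_def)
  have fin: "finite {w \<in> X. length w = n}" for n
  proof (rule finite_subset)
    show "{w \<in> X. length w = n} \<subseteq> {w \<in> adm_words t. length w = n}"
      using assms(2,3) unfolding adm_words_def arr_def by (auto intro!: exI[of _ a])
  qed (rule finite_adm_words[OF assms(1)])
  have r: "\<beta> powr s1 * \<beta> powr - s < 1"
    using s1 beta_gt_1 by (simp flip: powr_add add: powr_less_one)
  have "\<beta> powr (s1 - s') > 1" using s1 beta_gt_1 by simp
  \<comment> \<open>The factor 5 gives at least \<open>(\<beta> powr s') ^ n + 4\<close> words,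
    which leaves enough after removing two and ensures \<open>c \<ge> 2\<close>.\<close>
  then obtain n0 where n0: "(\<beta> powr (s1 - s')) ^ n0 > 5" using real_arch_pow by blast
  have "\<exists>n\<ge>Suc n0. \<not> real (card {w \<in> X. length w = n}) \<le> (\<beta> powr s1) ^ n"
  proof (rule ccontr)
    assume "\<not> ?thesis"
    then have "summable_weight (\<beta> powr - s) X"
      using fin r by (intro summable_weight_growth[of _ "Suc n0" "\<beta> powr s1"]) auto
    with assms(4) show False by simp
  qed
  then obtain n where n: "n \<ge> Suc n0" "(\<beta> powr s1) ^ n < real (card {w \<in> X. length w = n})" by auto
  define c where "c = card {w \<in> X. length w = n} - 2"
  have "5 \<le> (\<beta> powr (s1 - s')) ^ n"
    using n0 n(1) power_increasing[of n0 n "\<beta> powr (s1 - s')"] \<open>\<beta> powr (s1 - s') > 1\<close> by linarith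
  moreover have one: "1 \<le> (\<beta> powr s') ^ n" using assms(5) beta_gt_1 by (intro one_le_power ge_one_powr_ge_zero) auto
  ultimately have "(\<beta> powr s') ^ n * 5 \<le> (\<beta> powr s') ^ n * (\<beta> powr (s1 - s')) ^ n"
    by (intro mult_left_mono) auto
  also have "\<dots> = (\<beta> powr s1) ^ n" by (simp flip: power_mult_distrib powr_add)
  finally have "(\<beta> powr s') ^ n + 4 < real (card {w \<in> X. length w = n})" using one n(2) by linarith
  then have c: "(\<beta> powr s') ^ n \<le> real c" "c \<ge> 2" "card {w \<in> X. length w = n} \<ge> c + 2"
    using one by (auto simp: c_def)
  obtain W wtop Z where Z: "scheme t a b n W wtop Z" "ennreal (log \<beta> c / n) \<le> hausdorff_dim Z"
  proof -
    have "n \<ge> 1" using n(1) by simp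
    moreover have "length w = n \<and> arr t {a..<b} w {a..<b}" if "w \<in> {w \<in> X. length w = n}" for w
      using that assms(3) by blast
    ultimately show thesis using cantor_set[OF assms(2,1) _ fin c(3,2)] that by blast
  qed
  have "s' * n = log \<beta> ((\<beta> powr s') ^ n)" using beta_gt_1 by (simp add: powr_power mult.commute)
  also have "\<dots> \<le> log \<beta> c" using c(1) one beta_gt_1 by (subst log_le_cancel_iff) auto
  finally have "s' \<le> log \<beta> c / n" using n(1) by (simp add: field_simps)
  then have "ennreal s' \<le> hausdorff_dim Z" using Z(2) ennreal_leI order_trans by blast
  with Z(1) show thesis using that by blast
qed

lemma schemeD:
  assumes "scheme t a b n W wtop Z"
  shows "n \<ge> 1" "W \<noteq> {}" "Z \<noteq> {}"
    and "w \<in> insert wtop W \<Longrightarrow> length w = n"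
    and "w \<in> insert wtop W \<Longrightarrow> arr t {a..<b} w {a..<b}"
    and "w \<in> W \<Longrightarrow> y \<in> {a..b} \<Longrightarrow> a + (b - a) / \<beta> ^ n \<le> val w y"
    and "w \<in> W \<Longrightarrow> y \<in> {a..b} \<Longrightarrow> val w y \<le> val wtop a"
    and "Z \<subseteq> {a + (b - a) / \<beta> ^ n..b - (b - a) / \<beta> ^ n}"
    and "z \<in> Z \<Longrightarrow> \<exists>w\<in>W. \<exists>z'\<in>Z. z = val w z'"
  using assms unfolding scheme_def by (simp_all, auto)

lemma scheme_gap:
  assumes "scheme t a b n W wtop Z" "a < b"
  shows "(b - a) / \<beta> ^ n > 0"
  using assms by simp

lemma scheme_subset:
  assumes "scheme t a b n W wtop Z" "a < b"
  shows "Z \<subseteq> {a..<b}"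
proof
  fix z assume "z \<in> Z"
  then have "z \<in> {a + (b - a) / \<beta> ^ n..b - (b - a) / \<beta> ^ n}" using schemeD(8)[OF assms(1)] by blast
  then show "z \<in> {a..<b}" using scheme_gap[OF assms] by simp
qed

lemma scheme_blocks:
  assumes sch: "scheme t a b n W wtop Z" "a < b" "0 \<le> t" "z \<in> Z"
  shows "\<exists>u z'. length u = m * n \<and> arr t {a..<b} u {a..<b} \<and> z' \<in> Z \<and> z = val u z'"
  using assms(4)
proof (induction m arbitrary: z)
  case 0
  have "arr t {a..<b} [] {a..<b}"
  proof -
    have "arr t {a..<b} wtop {a..<b}" using schemeD(5)[OF sch(1)] by blast
    then show ?thesis using adm_end by (fastforce simp: arr_def)
  qed
  then show ?case using 0 by (intro exI[of _ "[]"] exI[of _ z]) auto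
next
  case (Suc m)
  obtain w z1 where w: "w \<in> W" "z1 \<in> Z" "z = val w z1" using schemeD(9)[OF sch(1) Suc.prems] by blast
  obtain u z' where u: "length u = m * n" "arr t {a..<b} u {a..<b}" "z' \<in> Z" "z1 = val u z'"
    using Suc.IH[OF w(2)] by blast
  have "length w = n" "arr t {a..<b} w {a..<b}" using w schemeD(4,5)[OF sch(1)] by blast+
  then show ?case using u w arr_append
    by (intro exI[of _ "w @ u"] exI[of _ z'] conjI) auto
qed

text \<open>Points of Z lie at least \<open>(b - a) / \<beta> ^ n\<close> above a, and every suffix
  of a word of W sends a itself to t or higher; a suffix shrinks the surplus at most by
  \<open>\<beta> ^ n\<close>.\<close>

lemma scheme_survivor:
  assumes sch: "scheme t a b n W wtop Z" "a < b" "0 \<le> t"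
  shows "Z \<subseteq> survivor_set \<beta> (t + (b - a) / \<beta> ^ n / \<beta> ^ n)"
proof
  fix z assume z: "z \<in> Z"
  let ?g = "(b - a) / \<beta> ^ n"
  have n: "n \<ge> 1" by (rule schemeD(1)[OF sch(1)])
  have "t + ?g / \<beta> ^ n \<le> (beta_map \<beta> ^^ k) z" for k
    using z
  proof (induction k arbitrary: z rule: less_induct)
    case (less k)
    obtain w z' where w: "w \<in> W" "z' \<in> Z" "z = val w z'" using schemeD(9)[OF sch(1) less.prems] by blast
    have len: "length w = n" "arr t {a..<b} w {a..<b}" using w schemeD(4,5)[OF sch(1)] by blast+
    have z': "z' \<in> {a..<b}" "a + ?g \<le> z'"
      using scheme_subset[OF sch(1,2)] w schemeD(8)[OF sch(1)] by auto
    have adm: "adm t w z'" "adm t w a" using len(2) z'(1) sch(2) by (auto simp: arr_def)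
    show ?case
    proof (cases "k \<le> n - 1")
      case True
      have "(beta_map \<beta> ^^ k) z = val (drop k w) z'"
        unfolding w(3) using adm(1) sch(3) True n len by (intro beta_map_funpow_val) auto
      also have "\<dots> = val (drop k w) a + (z' - a) / \<beta> ^ (n - k)"
        using len by (simp add: val_shift[of _ z' a])
      also have "\<dots> \<ge> t + ?g / \<beta> ^ n"
      proof (intro add_mono)
        show "t \<le> val (drop k w) a" using adm(2) adm_drop adm_bounds by blast
        have "?g / \<beta> ^ n \<le> ?g / \<beta> ^ (n - k)"
          using beta_gt_1 sch(2) by (intro divide_left_mono power_increasing) auto
        also have "\<dots> \<le> (z' - a) / \<beta> ^ (n - k)" using z' by (intro divide_right_mono) auto
        finally show "?g / \<beta> ^ n \<le> (z' - a) / \<beta> ^ (n - k)" .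
      qed
      finally show ?thesis .
    next
      case False
      have "(beta_map \<beta> ^^ n) z = z'"
        unfolding w(3) using beta_map_funpow_val[OF adm(1) sch(3), of n] len by simp
      then have "(beta_map \<beta> ^^ k) z = (beta_map \<beta> ^^ (k - n)) z'"
        using False n funpow_add[of "k - n" n "beta_map \<beta>"] by simp
      then show ?thesis using less.IH[of "k - n" z'] False n w by simp
    qed
  qed
  moreover have "z < 1"
  proof -
    obtain w z' where w: "w \<in> W" "z' \<in> Z" "z = val w z'" using schemeD(9)[OF sch(1) z] by blast
    then have "adm t w z'" using scheme_subset[OF sch(1,2)] schemeD(5)[OF sch(1), of w] by (auto simp: arr_def)
    then show ?thesis using adm_bounds w by blast
  qed
  ultimately show "z \<in> survivor_set \<beta> (t + ?g / \<beta> ^ n)"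
    using sch by (intro in_survivorI) auto
qed

text \<open>Converse of \<open>not_summable_adm_words\<close>, up to an arbitrarily small loss in
  the exponent.\<close>

lemma dim_survivor_ge:
  assumes "0 \<le> t" "t < 1" "0 < s" "\<not> summable_weight (\<beta> powr - s) (adm_words t)" "0 \<le> s'" "s' < s"
  shows "ennreal s' \<le> hausdorff_dim (survivor_set \<beta> t)"
proof -
  have z: "\<beta> powr - s < 1" using assms beta_gt_1 by (simp add: powr_less_one)
  obtain L where L: "(\<beta> powr - s) ^ L < 1 / 2" using real_arch_pow_inv[of "1/2", OF _ z] by auto
  obtain v where v: "inside t v" "alive v" "\<not> summable_weight (\<beta> powr - s) (loops t v)"
  proof -
    have "\<not> summable_weight (\<beta> powr - s) (paths t {} (t, 1))"
      using assms by (simp add: adm_words_eq_paths)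
    moreover have "inside t (t, 1)" by (simp add: inside_def)
    moreover have "0 \<le> \<beta> powr - s" "\<beta> powr - s \<le> 1" "2 * (\<beta> powr - s) ^ L < 1" using z L by auto
    ultimately show thesis using recurrent_state[of t "\<beta> powr - s" L "(t, 1)"] assms(1) that by blast
  qed
  have arr: "arr t {fst v..<snd v} w {fst v..<snd v}" if "w \<in> loops t v" for w
    using arr_run[OF v(1), of w] that by (auto simp: loops_def itv_def)
  have ab: "fst v < snd v" using v by (simp add: alive_def)
  obtain n W wtop Z where Z: "scheme t (fst v) (snd v) n W wtop Z" "ennreal s' \<le> hausdorff_dim Z"
    using rich_scheme[OF assms(1) ab arr v(3) assms(5,6)] by blast
  have "Z \<subseteq> survivor_set \<beta> t"
    using scheme_survivor[OF Z(1) ab assms(1)] survivor_antimono[of t] scheme_gap[OF Z(1) ab]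
    by (meson divide_nonneg_pos beta_power_pos le_add_same_cancel1 less_imp_le order_trans)
  then show ?thesis using Z(2) hausdorff_dim_mono order_trans by blast
qed

end

lemma powser_affine_limit_0:
  fixes q :: real
  assumes "0 \<le> q" "q < 1"
  shows "(\<lambda>n. (A + B * real n) * q ^ n) \<longlonglongrightarrow> 0"
proof -
  have "(\<lambda>n. A * q ^ n + B * (of_nat n * q ^ n)) \<longlonglongrightarrow> A * 0 + B * 0"
    using assms by (intro tendsto_intros LIMSEQ_realpow_zero powser_times_n_limit_0) auto
  then show ?thesis by (simp add: algebra_simps)
qed

context beta_base
begin

section \<open>Left continuity of the dimension\<close>

lemma fst_run_shift:
  assumes "fst s \<le> fst s0 + e" "t \<le> t0 + e" "0 \<le> e" "snd s = snd s0"
  shows "fst (run t s w) \<le> fst (run t0 s0 w) + \<beta> ^ length w * e \<and> snd (run t s w) = snd (run t0 s0 w)"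
  using assms
proof (induction w arbitrary: s s0 e)
  case (Cons d w)
  have "\<beta> * fst s \<le> \<beta> * (fst s0 + e)" using Cons.prems(1) beta_pos by (intro mult_left_mono) auto
  moreover have "1 * e \<le> \<beta> * e" using Cons.prems(3) beta_gt_1 by (intro mult_right_mono) auto
  ultimately have "fst (nxt t s d) \<le> fst (nxt t0 s0 d) + \<beta> * e" "t \<le> t0 + \<beta> * e" "0 \<le> \<beta> * e"
    using Cons.prems(2,3) by (auto simp: nxt_def algebra_simps)
  from Cons.IH[OF this] Cons.prems(4) show ?case by (simp add: nxt_def mult.assoc mult.left_commute)
qed auto

lemma run_dead: "fst s > snd s \<Longrightarrow> fst (run t s w) > snd (run t s w)"
proof (induction w arbitrary: s)
  case (Cons d w)
  have "\<beta> * snd s < \<beta> * fst s" using Cons.prems beta_pos by simp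
  then have "snd (nxt t s d) < fst (nxt t s d)" by (auto simp: nxt_def)
  then show ?case using Cons.IH by simp
qed auto

text \<open>From a single point the next digit must leave a remainder in \<open>{t..1}\<close>, an
  interval shorter than 1 because \<open>t > 0\<close>.\<close>

lemma run_degenerate_unique:
  assumes "fst s = snd s" "t > 0" "length w = length w'"
    and "fst (run t s w) \<le> snd (run t s w)" "fst (run t s w') \<le> snd (run t s w')"
  shows "w = w'"
  using assms
proof (induction w arbitrary: s w')
  case (Cons d w)
  then obtain d' v where w': "w' = d' # v" by (cases w') auto
  have *: "fst (nxt t s e) \<le> snd (nxt t s e)" if "fst (run t s (e # u)) \<le> snd (run t s (e # u))" for e u
    using run_dead[of "nxt t s e" t u] that by (simp add: not_less[symmetric]) blast
  have d: "fst (nxt t s d) \<le> snd (nxt t s d)" and d': "fst (nxt t s d') \<le> snd (nxt t s d')"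
    using *[of d w] *[of d' v] Cons.prems(4,5) w' by auto
  then have "t \<le> \<beta> * snd s - real d" "\<beta> * snd s - real d \<le> 1"
    "t \<le> \<beta> * snd s - real d'" "\<beta> * snd s - real d' \<le> 1"
    using Cons.prems(1) by (auto simp: nxt_def)
  with \<open>t > 0\<close> have "d = d'" by linarith
  moreover have "fst (nxt t s d) = snd (nxt t s d)"
    using d Cons.prems(1) by (auto simp: nxt_def)
  ultimately show ?case using Cons w' by auto
qed auto

text \<open>A word that is admissible for all \<open>t0 < t\<close> but not for \<open>t\<close> leads through an interval that
  degenerates to a point, from where on its digits are determined if \<open>t > 0\<close>.\<close>

lemma dim_survivor_left:
  fixes c :: real
  assumes "0 < t" "t < 1" "hausdorff_dim (survivor_set \<beta> t) < ennreal c"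
  obtains t0 where "0 \<le> t0" "t0 < t" "hausdorff_dim (survivor_set \<beta> t0) \<le> ennreal c"
proof -
  obtain e where e: "hausdorff_dim (survivor_set \<beta> t) < e" "e < ennreal c" using assms(3) dense by blast
  then obtain c1 where c1: "e = ennreal c1" "0 \<le> c1" by (cases e) auto
  then have "c1 < c" using e(2) by (simp add: ennreal_less_iff)
  define c2 where "c2 = (c1 + c) / 2"
  have c2: "c1 < c2" "c2 < c" "0 < c2" using \<open>c1 < c\<close> c1 by (auto simp: c2_def)
  let ?A = "\<lambda>n. {w \<in> adm_words t. length w = n}"
  have finA: "finite (?A n)" for n using finite_adm_words assms(1) by simp
  have "summable_weight (\<beta> powr - c2) (adm_words t)"
    using dim_survivor_ge[of t c2 c1] assms c1 c2 e(1) by (auto simp: not_less[symmetric])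
  then obtain C where C: "\<And>F. finite F \<Longrightarrow> F \<subseteq> adm_words t \<Longrightarrow> weight (\<beta> powr - c2) F \<le> C"
    unfolding summable_weight_def by blast
  have C0: "0 \<le> C" using C[of "{}"] by (simp add: weight_def)
  have cardA: "real (card (?A n)) \<le> C * (\<beta> powr c2) ^ n" for n
  proof -
    have "real (card (?A n)) * (\<beta> powr - c2) ^ n = weight (\<beta> powr - c2) (?A n)" by (simp add: weight_def)
    also have "\<dots> \<le> C" using finA by (intro C) auto
    finally have "real (card (?A n)) * (\<beta> powr - c2) ^ n * (\<beta> powr c2) ^ n \<le> C * (\<beta> powr c2) ^ n"
      by (intro mult_right_mono) auto
    then show ?thesis using beta_pos by (simp add: mult.assoc flip: power_mult_distrib powr_add)
  qed
  \<comment> \<open>Words that survive every threshold below t. Their number is shown to exceed that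
    of the t-admissible words only by a linear factor.\<close>
  define M where "M n = {w. length w = n \<and> (\<forall>t0\<in>{0..<t}. w \<in> adm_words t0)}" for n
  define D where "D = nat \<lceil>\<beta>\<rceil>"
  let ?s = "(t, 1 :: real)"
  have M_weak: "fst (run t ?s w) \<le> snd (run t ?s w)" if w: "w \<in> M n" for w n
  proof -
    have "fst (run t ?s w) \<le> snd (run t ?s w) + e" if "e > 0" for e :: real
    proof -
      define \<eta> where "\<eta> = min (e / \<beta> ^ length w) t"
      have "e / \<beta> ^ length w > 0" using that by simp
      then have \<eta>: "0 < \<eta>" "\<eta> \<le> t" "\<beta> ^ length w * \<eta> \<le> e"
        using assms(1) by (auto simp: \<eta>_def min_def field_simps)
      let ?r = "(t - \<eta>, 1 :: real)"
      have "w \<in> adm_words (t - \<eta>)" using w \<eta> by (auto simp: M_def)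
      then have "alive (run (t - \<eta>) ?r w)"
        using adm_words_eq_paths[of "t - \<eta>"] \<eta> assms(2) by (auto simp: paths_def)
      moreover have "fst (run t ?s w) \<le> fst (run (t - \<eta>) ?r w) + \<beta> ^ length w * \<eta>
          \<and> snd (run t ?s w) = snd (run (t - \<eta>) ?r w)"
        using \<eta> by (intro fst_run_shift) auto
      ultimately show ?thesis using \<eta> by (auto simp: alive_def)
    qed
    then show ?thesis by (rule field_le_epsilon)
  qed
  have M_digits: "set w \<subseteq> {..<D}" if "w \<in> M n" for w n
  proof -
    have "w \<in> adm_words 0" using that assms(1) by (auto simp: M_def)
    then show ?thesis using adm_digits[of 0 w] by (auto simp: adm_words_def D_def)
  qed
  have alive_A: "w \<in> adm_words t \<longleftrightarrow> alive (run t ?s w)" for w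
    using adm_words_eq_paths[OF assms(2)] by (auto simp: paths_def)
  \<comment> \<open>Sorted by where the interval first degenerates: after that position a word is
    determined by its prefix.\<close>
  define S where "S n k = {w \<in> M n. take k w \<in> adm_words t \<and>
      fst (run t ?s (take (Suc k) w)) = snd (run t ?s (take (Suc k) w))}" for n k
  have cardS: "card (S n k) \<le> card (?A k) * D" if "k < n" for n k
  proof -
    have inj: "inj_on (take (Suc k)) (S n k)"
    proof (rule inj_onI)
      fix w w' assume w: "w \<in> S n k" "w' \<in> S n k" "take (Suc k) w = take (Suc k) w'"
      have weak: "fst (run t (run t ?s (take (Suc k) v)) (drop (Suc k) v))
          \<le> snd (run t (run t ?s (take (Suc k) v)) (drop (Suc k) v))" if "v \<in> S n k" for v
        using M_weak[of v n] that by (simp add: S_def flip: run_simps(3))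
      have "drop (Suc k) w = drop (Suc k) w'"
      proof (rule run_degenerate_unique[of "run t ?s (take (Suc k) w)" t])
        show "fst (run t ?s (take (Suc k) w)) = snd (run t ?s (take (Suc k) w))" using w(1) by (simp add: S_def)
        show "length (drop (Suc k) w) = length (drop (Suc k) w')" using w by (auto simp: S_def M_def)
      qed (use weak[OF w(1)] weak[OF w(2)] w(3) assms(1) in auto)
      with w(3) show "w = w'" by (metis append_take_drop_id)
    qed
    have "take (Suc k) ` S n k \<subseteq> (\<lambda>(u, d). u @ [d]) ` (?A k \<times> {..<D})"
    proof
      fix v assume "v \<in> take (Suc k) ` S n k"
      then obtain w where w: "w \<in> S n k" "v = take (Suc k) w" by auto
      then have len: "length w = n" by (simp add: S_def M_def)
      then have "v = take k w @ [w ! k]" using w that by (simp add: take_Suc_conv_app_nth)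
      moreover have "w ! k \<in> {..<D}" using M_digits[of w n] w(1) len that nth_mem[of k w] unfolding S_def by blast
      moreover have "take k w \<in> ?A k" using w len that by (auto simp: S_def)
      ultimately show "v \<in> (\<lambda>(u, d). u @ [d]) ` (?A k \<times> {..<D})"
        by (intro image_eqI[of _ _ "(take k w, w ! k)"]) auto
    qed
    then have "card (take (Suc k) ` S n k) \<le> card ((\<lambda>(u, d). u @ [d]) ` (?A k \<times> {..<D}))"
      using finA by (intro card_mono) auto
    also have "\<dots> \<le> card (?A k \<times> {..<D})" using finA by (intro card_image_le) auto
    finally show ?thesis using card_image[OF inj] by (simp add: card_cartesian_product)
  qed
  have M_sub: "M n \<subseteq> ?A n \<union> (\<Union>k<n. S n k)" for n
  proof
    fix w assume w: "w \<in> M n"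
    then have len: "length w = n" by (simp add: M_def)
    show "w \<in> ?A n \<union> (\<Union>k<n. S n k)"
    proof (cases "w \<in> adm_words t")
      case False
      define j where "j = (LEAST j. take j w \<notin> adm_words t)"
      have n: "take n w \<notin> adm_words t" using False len by simp
      have j: "take j w \<notin> adm_words t" "j \<le> n"
        unfolding j_def using LeastI[of "\<lambda>j. take j w \<notin> adm_words t", OF n] Least_le[of "\<lambda>j. take j w \<notin> adm_words t", OF n] by auto
      have "take 0 w \<in> adm_words t" using assms(2) by (auto simp: adm_words_def intro!: exI[of _ t])
      with j(1) have "j \<noteq> 0" by metis
      then obtain k where k: "j = Suc k" by (cases j) auto
      have "take k w \<in> adm_words t"
        using not_less_Least[of k "\<lambda>j. take j w \<notin> adm_words t"] k unfolding j_def by auto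
      moreover have "fst (run t ?s (take j w)) = snd (run t ?s (take j w))"
      proof (rule order_antisym)
        have "fst (run t (run t ?s (take j w)) (drop j w)) \<le> snd (run t (run t ?s (take j w)) (drop j w))"
          using M_weak[OF w] by (simp flip: run_simps(3))
        then show "fst (run t ?s (take j w)) \<le> snd (run t ?s (take j w))"
          using run_dead[of "run t ?s (take j w)" t "drop j w"] by force
        show "snd (run t ?s (take j w)) \<le> fst (run t ?s (take j w))"
          using j(1) alive_A by (auto simp: alive_def)
      qed
      ultimately have "w \<in> S n k" using w k by (simp add: S_def)
      then show ?thesis using j k by auto
    qed (use len in auto)
  qed
  have finM: "finite (M n)" for n
  proof (rule finite_subset)
    show "M n \<subseteq> {w. set w \<subseteq> {..<D} \<and> length w = n}" using M_digits by (auto simp: M_def)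
  qed (simp add: finite_lists_length_eq)
  have b1: "1 \<le> \<beta> powr c2" using c2 beta_gt_1 by (intro ge_one_powr_ge_zero) auto
  have cardM: "real (card (M n)) \<le> (C + D * C * real n) * (\<beta> powr c2) ^ n" for n
  proof -
    have "card (M n) \<le> card (?A n \<union> (\<Union>k<n. S n k))"
      using finA finM by (intro card_mono M_sub) (auto simp: S_def)
    also have "\<dots> \<le> card (?A n) + card (\<Union>k<n. S n k)" by (rule card_Un_le)
    also have "card (\<Union>k<n. S n k) \<le> (\<Sum>k<n. card (S n k))" by (intro card_UN_le) auto
    also have "\<dots> \<le> (\<Sum>k<n. card (?A k) * D)" using cardS by (intro sum_mono) auto
    finally have "card (M n) \<le> card (?A n) + (\<Sum>k<n. card (?A k) * D)" by simp
    then have "real (card (M n)) \<le> real (card (?A n)) + (\<Sum>k<n. real (card (?A k)) * D)"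
      by (metis (no_types, lifting) of_nat_add of_nat_le_iff of_nat_mult of_nat_sum sum.cong)
    also have "\<dots> \<le> C * (\<beta> powr c2) ^ n + (\<Sum>k<n. C * (\<beta> powr c2) ^ n * D)"
    proof (intro add_mono sum_mono mult_right_mono cardA)
      fix k assume "k \<in> {..<n}"
      have "real (card (?A k)) \<le> C * (\<beta> powr c2) ^ k" by (rule cardA)
      also have "\<dots> \<le> C * (\<beta> powr c2) ^ n"
        using \<open>k \<in> {..<n}\<close> b1 C0 by (intro mult_left_mono power_increasing) auto
      finally show "real (card (?A k)) \<le> C * (\<beta> powr c2) ^ n" .
    qed auto
    also have "\<dots> = (C + D * C * real n) * (\<beta> powr c2) ^ n" by (simp add: algebra_simps)
    finally show ?thesis .
  qed
  define q where "q = \<beta> powr (c2 - c)"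
  have q: "0 \<le> q" "q < 1" using c2 beta_gt_1 by (auto simp: q_def powr_less_one)
  have "\<forall>\<^sub>F n in sequentially. (C + D * C * real n) * q ^ n < 1"
    using powser_affine_limit_0[OF q] by (rule order_tendstoD) simp
  then have "\<forall>\<^sub>F n in sequentially. (C + D * C * real n) * q ^ n < 1 \<and> n \<ge> 1"
    using eventually_ge_at_top by (rule eventually_conj)
  then obtain n where n: "(C + D * C * real n) * q ^ n < 1" "n \<ge> 1"
    using eventually_happens'[OF sequentially_bot] by blast
  have "(\<beta> powr c2) ^ n = q ^ n * (\<beta> powr c) ^ n"
    by (simp add: q_def flip: power_mult_distrib powr_add)
  then have "real (card (M n)) \<le> (C + D * C * real n) * q ^ n * (\<beta> powr c) ^ n" using cardM[of n] by (simp add: mult.assoc)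
  also have "\<dots> \<le> 1 * (\<beta> powr c) ^ n" using n by (intro mult_right_mono) auto
  also have "\<dots> = \<beta> powr (c * n)" using beta_pos by (simp add: powr_power mult.commute)
  finally have cM: "real (card (M n)) \<le> \<beta> powr (c * n)" .
  \<comment> \<open>The finitely many other words of length n each die at some threshold below t;
    the largest of these thresholds kills all of them, and one length suffices to bound the
    dimension.\<close>
  define B where "B = {w \<in> adm_words 0. length w = n} - M n"
  have finB: "finite B" unfolding B_def using finite_adm_words[of 0] by simp
  have "\<forall>w\<in>B. \<exists>t0. 0 \<le> t0 \<and> t0 < t \<and> w \<notin> adm_words t0" by (auto simp: B_def M_def)
  then obtain \<tau> where \<tau>: "\<And>w. w \<in> B \<Longrightarrow> 0 \<le> \<tau> w \<and> \<tau> w < t \<and> w \<notin> adm_words (\<tau> w)" by metis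
  define t0 where "t0 = Max (insert 0 (\<tau> ` B))"
  have t0: "0 \<le> t0" "t0 < t" "\<And>w. w \<in> B \<Longrightarrow> \<tau> w \<le> t0"
    unfolding t0_def using finB assms(1) \<tau> by (auto intro: Max_ge)
  have anti: "adm_words t'' \<subseteq> adm_words t'" if "t' \<le> t''" for t' t''
    using adm_antimono that unfolding adm_words_def by blast
  have sub: "{w \<in> adm_words t0. length w = n} \<subseteq> M n"
  proof (rule ccontr)
    assume "\<not> ?thesis"
    then obtain w where w: "w \<in> adm_words t0" "length w = n" "w \<notin> M n" by auto
    then have "w \<in> B" using anti[OF t0(1)] by (auto simp: B_def)
    then show False using \<tau> t0(3) anti[of "\<tau> w" t0] w by blast
  qed
  have "real (card {w \<in> adm_words t0. length w = n}) \<le> real (card (M n))"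
    using card_mono[OF finM sub] by simp
  also note cM
  finally have "hausdorff_dim (survivor_set \<beta> t0) \<le> ennreal c"
    using t0(1) n(2) c2 by (intro dim_survivor_le) auto
  with t0 show thesis using that by blast
qed

section \<open>The bifurcation sets\<close>

lemma frac_add_small: "0 \<le> e \<Longrightarrow> e < 1 - frac z \<Longrightarrow> frac (z + e) = frac z + e"
  using frac_ge_0[of z] by (subst frac_unique_iff) (simp add: frac_def)

text \<open>\<open>frac\<close> is continuous from the right with slope 1.\<close>

lemma beta_map_funpow_right:
  "\<exists>\<delta>>0. \<forall>y\<in>{x..<x + \<delta>}. (beta_map \<beta> ^^ n) y = (beta_map \<beta> ^^ n) x + \<beta> ^ n * (y - x)"
proof (induction n)
  case 0
  then show ?case by (auto intro: exI[of _ 1])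
next
  case (Suc n)
  then obtain \<delta> where \<delta>: "\<delta> > 0"
    "\<And>y. y \<in> {x..<x + \<delta>} \<Longrightarrow> (beta_map \<beta> ^^ n) y = (beta_map \<beta> ^^ n) x + \<beta> ^ n * (y - x)" by blast
  let ?X = "(beta_map \<beta> ^^ n) x"
  define \<delta>' where "\<delta>' = min \<delta> ((1 - frac (\<beta> * ?X)) / \<beta> ^ Suc n)"
  have "\<delta>' > 0" using \<delta>(1) frac_lt_1[of "\<beta> * ?X"] beta_pos unfolding \<delta>'_def min_less_iff_conj
    by (intro conjI divide_pos_pos) auto
  moreover have "(beta_map \<beta> ^^ Suc n) y = (beta_map \<beta> ^^ Suc n) x + \<beta> ^ Suc n * (y - x)"
    if "y \<in> {x..<x + \<delta>'}" for y
  proof -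
    have y: "y \<in> {x..<x + \<delta>}" "y - x < (1 - frac (\<beta> * ?X)) / \<beta> ^ Suc n" "0 \<le> y - x"
      using that by (auto simp: \<delta>'_def)
    have "\<beta> ^ Suc n * (y - x) < 1 - frac (\<beta> * ?X)"
      using y(2) pos_less_divide_eq[OF beta_power_pos] by (metis mult.commute)
    moreover have "0 \<le> \<beta> ^ Suc n * (y - x)" using y(3) by (intro mult_nonneg_nonneg beta_power_nonneg)
    ultimately have "frac (\<beta> * ?X + \<beta> ^ Suc n * (y - x)) = frac (\<beta> * ?X) + \<beta> ^ Suc n * (y - x)"
      by (intro frac_add_small)
    moreover have "\<beta> * (beta_map \<beta> ^^ n) y = \<beta> * ?X + \<beta> ^ Suc n * (y - x)"
      unfolding \<delta>(2)[OF y(1)] by (simp add: algebra_simps)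
    moreover have "(beta_map \<beta> ^^ Suc n) u = frac (\<beta> * (beta_map \<beta> ^^ n) u)" for u
      by (simp add: beta_map_def)
    ultimately show ?thesis by (simp only:)
  qed
  ultimately show ?case by blast
qed

text \<open>The bifurcation points are the t with t in K(t). If some iterate sends t below t, it
  does the same on a right neighbourhood of t, so no point of it survives and K does not change
  there.\<close>

lemma set_bifurcation_iff:
  "t \<in> set_bifurcation \<beta> \<longleftrightarrow> 0 \<le> t \<and> t < 1 \<and> (\<forall>n. t \<le> (beta_map \<beta> ^^ n) t)"
proof
  assume t: "t \<in> set_bifurcation \<beta>"
  then have t01: "0 \<le> t" "t < 1" by (auto simp: set_bifurcation_def)
  have "t \<le> (beta_map \<beta> ^^ n) t" for n
  proof (rule ccontr)
    let ?X = "(beta_map \<beta> ^^ n) t"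
    assume "\<not> t \<le> ?X"
    then have lt: "?X < t" by simp
    from beta_map_funpow_right[of t n] obtain \<delta> where
      \<delta>0: "\<delta> > 0 \<and> (\<forall>y\<in>{t..<t + \<delta>}. (beta_map \<beta> ^^ n) y = ?X + \<beta> ^ n * (y - t))" ..
    then have \<delta>: "\<delta> > 0" "\<And>y. y \<in> {t..<t + \<delta>} \<Longrightarrow> (beta_map \<beta> ^^ n) y = ?X + \<beta> ^ n * (y - t)" by blast+
    define t' where "t' = t + min \<delta> ((t - ?X) / \<beta> ^ n)"
    have t': "t < t'" using \<delta>(1) lt by (auto simp: t'_def)
    have low: "(beta_map \<beta> ^^ n) y < t" if y: "t \<le> y" "y < t'" for y
    proof -
      have "y \<in> {t..<t + \<delta>}" "y - t < (t - ?X) / \<beta> ^ n" using y by (auto simp: t'_def)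
      then have "\<beta> ^ n * (y - t) < t - ?X" using pos_less_divide_eq[OF beta_power_pos] by (metis mult.commute)
      then show ?thesis using \<delta>(2)[OF \<open>y \<in> {t..<t + \<delta>}\<close>] by simp
    qed
    have "survivor_set \<beta> t \<subseteq> survivor_set \<beta> t'"
    proof
      fix x assume x: "x \<in> survivor_set \<beta> t"
      have "t' \<le> (beta_map \<beta> ^^ k) x" for k
      proof (rule ccontr)
        assume "\<not> ?thesis"
        moreover have "t \<le> (beta_map \<beta> ^^ k) x" using survivor_bounds[OF survivor_funpow[OF x]] by simp
        ultimately have "(beta_map \<beta> ^^ n) ((beta_map \<beta> ^^ k) x) < t" using low by auto
        moreover have "t \<le> (beta_map \<beta> ^^ n) ((beta_map \<beta> ^^ k) x)"
          using survivor_bounds[OF survivor_funpow[OF survivor_funpow[OF x]]] by simp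
        ultimately show False by simp
      qed
      then show "x \<in> survivor_set \<beta> t'" using survivor_bounds[OF x] t' t01 by (intro in_survivorI) auto
    qed
    moreover have "survivor_set \<beta> t' \<noteq> survivor_set \<beta> t" using t t' by (auto simp: set_bifurcation_def)
    ultimately show False using survivor_antimono[of t t'] t' by auto
  qed
  with t01 show "0 \<le> t \<and> t < 1 \<and> (\<forall>n. t \<le> (beta_map \<beta> ^^ n) t)" by blast
next
  assume t: "0 \<le> t \<and> t < 1 \<and> (\<forall>n. t \<le> (beta_map \<beta> ^^ n) t)"
  then have "t \<in> survivor_set \<beta> t" by (intro in_survivorI) auto
  moreover have "t \<notin> survivor_set \<beta> t'" if "t' > t" for t' using survivor_bounds[of t t'] that by auto
  ultimately show "t \<in> set_bifurcation \<beta>" using t unfolding set_bifurcation_def by auto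
qed

lemma set_bifurcation_subset_survivor:
  assumes "t0 \<le> x" "x \<in> set_bifurcation \<beta>"
  shows "x \<in> survivor_set \<beta> t0"
  using assms unfolding set_bifurcation_iff survivor_set_def by (auto intro: order_trans)

lemma survivor_empty: "1 \<le> t \<Longrightarrow> survivor_set \<beta> t = {}"
  using survivor_bounds by fastforce

lemma dim_survivor_finite:
  assumes "0 \<le> t"
  shows "\<exists>s\<ge>0. hausdorff_dim (survivor_set \<beta> t) = ennreal s"
proof -
  let ?N = "real (card {w \<in> adm_words t. length w = 1})"
  define c where "c = (if ?N \<le> 1 then 0 else log \<beta> ?N)"
  have "?N \<le> \<beta> powr (c * real 1)" "0 \<le> c" using beta_gt_1 by (auto simp: c_def)
  then have "hausdorff_dim (survivor_set \<beta> t) \<le> ennreal c"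
    using assms by (intro dim_survivor_le[of t 1]) auto
  then have "hausdorff_dim (survivor_set \<beta> t) < top" by (simp add: order_le_less_trans)
  then show ?thesis by (cases "hausdorff_dim (survivor_set \<beta> t)") auto
qed

lemma dim_survivor_antimono:
  "t \<le> t' \<Longrightarrow> hausdorff_dim (survivor_set \<beta> t') \<le> hausdorff_dim (survivor_set \<beta> t)"
  by (intro hausdorff_dim_mono survivor_antimono)

lemma dim_bifurcationD:
  assumes "t \<in> dim_bifurcation \<beta>"
  shows "0 \<le> t" "t < 1" "t \<in> set_bifurcation \<beta>"
    "\<exists>s>0. hausdorff_dim (survivor_set \<beta> t) = ennreal s"
    "t' > t \<Longrightarrow> hausdorff_dim (survivor_set \<beta> t') < hausdorff_dim (survivor_set \<beta> t)"
proof -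
  show t0: "0 \<le> t" using assms by (simp add: dim_bifurcation_def)
  show d: "hausdorff_dim (survivor_set \<beta> t') < hausdorff_dim (survivor_set \<beta> t)" if "t' > t" for t'
    using assms that by (simp add: dim_bifurcation_def)
  show t1: "t < 1"
  proof (rule ccontr)
    assume "\<not> t < 1"
    then show False using d[of "t + 1"] by (simp add: survivor_empty)
  qed
  show "t \<in> set_bifurcation \<beta>"
    unfolding set_bifurcation_def using t0 t1 d by fastforce
  obtain s where s: "s \<ge> 0" "hausdorff_dim (survivor_set \<beta> t) = ennreal s"
    using dim_survivor_finite[OF t0] by blast
  have "s \<noteq> 0" using d[of "t + 1"] s by auto
  with s show "\<exists>s>0. hausdorff_dim (survivor_set \<beta> t) = ennreal s" by (intro exI[of _ s]) auto
qed

section \<open>Dipping loops and minimal orbit points\<close>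

lemma hausdorff_dim_val_preimages:
  assumes "finite Ws" "\<And>z. z \<in> Z \<Longrightarrow> \<exists>w\<in>Ws. val w z \<in> M"
  shows "hausdorff_dim Z \<le> hausdorff_dim M"
proof -
  \<comment> \<open>Inverse of \<open>val w\<close>; being a similarity, it maps M to a set of no
    larger dimension.\<close>
  define h where "h w x = (x - val w 0) * \<beta> ^ length w" for w x
  have inv: "h w (val w z) = z" for w z
    unfolding h_def using beta_pos by (simp add: val_diff)
  have "Z \<subseteq> (\<Union>w\<in>Ws. h w ` M)"
  proof
    fix z assume "z \<in> Z"
    then obtain w where w: "w \<in> Ws" "val w z \<in> M" using assms(2) by blast
    then show "z \<in> (\<Union>w\<in>Ws. h w ` M)" using inv[of w z] by (intro UN_I[of w] image_eqI[of _ _ "val w z"]) auto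
  qed
  then have "hausdorff_dim Z \<le> hausdorff_dim (\<Union>w\<in>Ws. h w ` M)" by (rule hausdorff_dim_mono)
  also have "\<dots> \<le> hausdorff_dim M"
  proof (rule hausdorff_dim_UN_le[OF assms(1)])
    fix w
    show "hausdorff_dim (h w ` M) \<le> hausdorff_dim M"
    proof (rule hausdorff_dim_lipschitz_image)
      show "dist (h w x) (h w y) \<le> \<beta> ^ length w * dist x y" for x y
      proof -
        have "h w x - h w y = \<beta> ^ length w * (x - y)" by (simp add: h_def algebra_simps)
        then show ?thesis unfolding dist_real_def by (simp add: abs_mult)
      qed
    qed simp
  qed
  finally show ?thesis .
qed

text \<open>Since the free loops carry more dimension than \<open>K(t')\<close>, one of their products must
  dip below \<open>t'\<close>.\<close>

lemma loops_dip_below: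
  fixes c :: real
  assumes "0 \<le> t" "a < b" "X \<subseteq> {w. arr t {a..<b} w {a..<b}}"
    and "\<not> summable_weight (\<beta> powr - c) X" "hausdorff_dim (survivor_set \<beta> t') < ennreal c" "0 \<le> t'"
  obtains n W wtop Z u k where "scheme t a b n W wtop Z" "arr t {a..<b} u {a..<b}"
    "k + N \<le> length u" "\<forall>y\<in>{a..<b}. val (drop k u) y < t'"
proof -
  obtain e where e: "hausdorff_dim (survivor_set \<beta> t') < e" "e < ennreal c" using assms(5) dense by blast
  then obtain s' where s': "e = ennreal s'" "0 \<le> s'" by (cases e) auto
  then have "s' < c" using e(2) by (simp add: ennreal_less_iff)
  obtain n W wtop Z where Z: "scheme t a b n W wtop Z" "ennreal s' \<le> hausdorff_dim Z"
    using rich_scheme[OF assms(1,2) _ assms(4) s'(2) \<open>s' < c\<close>] assms(3) by blast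
  have "\<not> Z \<subseteq> survivor_set \<beta> t'"
    using hausdorff_dim_mono[of Z "survivor_set \<beta> t'"] Z(2) e(1) s'(1) by auto
  then obtain z where z: "z \<in> Z" "z \<notin> survivor_set \<beta> t'" by blast
  have "z \<in> survivor_set \<beta> t"
    using scheme_survivor[OF Z(1) assms(2,1)] z(1) survivor_antimono[of t] scheme_gap[OF Z(1) assms(2)]
    by (meson divide_nonneg_pos beta_power_pos le_add_same_cancel1 less_imp_le subsetD)
  then have "z < 1" using survivor_bounds by blast
  then have "\<not> (\<forall>k. t' \<le> (beta_map \<beta> ^^ k) z)" using z(2) in_survivorI[of t' z] assms(6) by blast
  then obtain k where k: "(beta_map \<beta> ^^ k) z < t'" by (auto simp: not_le)
  have n1: "n \<ge> 1" by (rule schemeD(1)[OF Z(1)])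
  obtain j where j: "(1 / \<beta>) ^ j < t' - (beta_map \<beta> ^^ k) z"
    using real_arch_pow_inv[of "t' - (beta_map \<beta> ^^ k) z" "1 / \<beta>"] k beta_gt_1 by auto
  \<comment> \<open>Long enough that the digits after position k fix the dip up to
    \<open>(1 / \<beta>) ^ j\<close>, whatever the tail, and leave N digits to spare.\<close>
  define m where "m = k + N + j"
  have mn: "m * 1 \<le> m * n" using n1 by (intro mult_le_mono2)
  obtain u z' where u: "length u = m * n" "arr t {a..<b} u {a..<b}" "z' \<in> Z" "z = val u z'"
    using scheme_blocks[OF Z(1) assms(2,1) z(1), of m] by blast
  have len: "k + N + j \<le> length u" using mn u(1) by (simp add: m_def)
  have z': "z' \<in> {a..<b}" using u(3) scheme_subset[OF Z(1) assms(2)] by blast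
  have adm: "adm t u y" if "y \<in> {a..<b}" for y using u(2) that by (auto simp: arr_def)
  have "val (drop k u) y < t'" if y: "y \<in> {a..<b}" for y
  proof -
    have 1: "(beta_map \<beta> ^^ k) z = val (drop k u) z'"
      unfolding u(4) using adm[OF z'] assms(1) len by (intro beta_map_funpow_val) auto
    have "y < 1" "0 \<le> z'" using adm_end[OF adm[OF y]] adm_end[OF adm[OF z']] assms(1) by auto
    then have "(y - z') / \<beta> ^ length (drop k u) \<le> 1 / \<beta> ^ length (drop k u)"
      by (intro divide_right_mono) auto
    also have "\<dots> \<le> 1 / \<beta> ^ j"
      using len beta_gt_1 by (intro divide_left_mono power_increasing) auto
    finally have "val (drop k u) y \<le> val (drop k u) z' + (1 / \<beta>) ^ j"
      using val_shift[of "drop k u" y z'] by (simp add: power_one_over)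
    then show ?thesis using j 1 by linarith
  qed
  then show thesis using that[OF Z(1) u(2), of k] len by auto
qed

text \<open>After l the orbit runs through that of z and stays at or above r, while some suffix
  value is below r. Hence the least suffix value is the minimum of its own forward orbit.\<close>

lemma minimal_orbit_point:
  assumes "arr t {a..<b} l {a..<b}" "0 \<le> t" "z \<in> {a..<b}" "z \<in> survivor_set \<beta> r"
    and "k \<le> length l" "val (drop k l) z < r"
  obtains j where "j \<le> length l" "val (drop j l) z \<in> set_bifurcation \<beta>"
    "\<forall>i\<le>length l. val (drop j l) z \<le> val (drop i l) z" "t \<le> val (drop j l) z"
proof -
  let ?S = "(\<lambda>i. val (drop i l) z) ` {..length l}"
  have "Min ?S \<in> ?S" by (intro Min_in) auto
  then obtain j where "Min ?S = val (drop j l) z" "j \<in> {..length l}" by (rule imageE)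
  then have j: "j \<le> length l" "val (drop j l) z = Min ?S" by simp_all
  have min: "val (drop j l) z \<le> val (drop i l) z" if "i \<le> length l" for i
    unfolding j(2) using that by (intro Min_le) auto
  have adm: "adm t l z" using assms(1,3) by (auto simp: arr_def)
  have admj: "adm t (drop j l) z" by (rule adm_drop[OF adm])
  let ?x = "val (drop j l) z"
  have bx: "t \<le> ?x" "?x < 1" using adm_bounds[OF admj] by auto
  have "?x \<le> (beta_map \<beta> ^^ m) ?x" for m
  proof (cases "m \<le> length (drop j l)")
    case True
    then have "(beta_map \<beta> ^^ m) ?x = val (drop (m + j) l) z"
      using beta_map_funpow_val[OF admj assms(2), of m] by (simp add: add.commute)
    then show ?thesis using min[of "m + j"] True j(1) by simp
  next
    case False
    let ?n = "length (drop j l)"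
    have "(beta_map \<beta> ^^ ?n) ?x = z" using beta_map_funpow_val[OF admj assms(2), of ?n] by simp
    then have "(beta_map \<beta> ^^ m) ?x = (beta_map \<beta> ^^ (m - ?n)) z"
      using False funpow_add[of "m - ?n" ?n "beta_map \<beta>"] by simp
    moreover have "r \<le> (beta_map \<beta> ^^ (m - ?n)) z"
      using survivor_bounds[OF survivor_funpow[OF assms(4)]] by simp
    ultimately show ?thesis using min[OF assms(5)] assms(6) by simp
  qed
  then have "?x \<in> set_bifurcation \<beta>" using bx assms(2) by (simp add: set_bifurcation_iff)
  with j(1) min bx(1) show thesis using that by blast
qed

lemma dim_bifurcation_recurrent_state:
  fixes s :: real
  assumes "t \<in> dim_bifurcation \<beta>" "hausdorff_dim (survivor_set \<beta> t) = ennreal s" "0 < s"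
    and "2 * (\<beta> powr - s) ^ L < 1"
  obtains a b where "(a, b) \<in> low_states t L" "inside t (a, b)" "a < b"
    "\<not> summable_weight (\<beta> powr - s) (loops t (a, b))"
    "loops t (a, b) \<subseteq> {w. arr t {a..<b} w {a..<b}}"
proof -
  note t = dim_bifurcationD[OF assms(1)]
  have "\<not> summable_weight (\<beta> powr - s) (paths t {} (t, 1))"
    using not_summable_adm_words[OF t(1) assms(3)] assms(2) adm_words_eq_paths[OF t(2)] by simp
  moreover have "inside t (t, 1)" by (simp add: inside_def)
  moreover have "0 \<le> \<beta> powr - s" "\<beta> powr - s \<le> 1"
    using assms(3) beta_gt_1 by (auto simp: powr_minus_divide ge_one_powr_ge_zero)
  ultimately obtain v where v: "v \<in> low_states t L" "inside t v" "alive v"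
    "\<not> summable_weight (\<beta> powr - s) (loops t v)"
    using recurrent_state[of t "\<beta> powr - s" L "(t, 1)"] t(1) assms(4) by blast
  obtain a b where [simp]: "v = (a, b)" by (cases v)
  have "arr t {a..<b} w {a..<b}" if "w \<in> loops t (a, b)" for w
    using arr_run[OF v(2), of w] that by (auto simp: loops_def itv_def)
  then have "loops t (a, b) \<subseteq> {w. arr t {a..<b} w {a..<b}}" by blast
  then show thesis using that[of a b] v by (simp add: alive_def)
qed

lemma exists_low_level:
  fixes s :: real
  assumes "0 < s"
  obtains L where "2 * (\<beta> powr - s) ^ L < 1"
proof -
  have "\<beta> powr - s < 1" using assms beta_gt_1 by (simp add: powr_less_one)
  then obtain L where "(\<beta> powr - s) ^ L < 1 / 2" using real_arch_pow_inv[of "1/2"] by auto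
  then show thesis using that[of L] by simp
qed

text \<open>One recurrent state serves twice: its loops generate Z, and they contain the loop l that
  dips. The second conclusion is right continuity of the dimension at bifurcation points.\<close>

lemma set_bifurcation_dim_ge:
  fixes c s :: real
  assumes t: "t \<in> dim_bifurcation \<beta>" and s: "hausdorff_dim (survivor_set \<beta> t) = ennreal s"
    and c: "0 \<le> c" "c < s" and t': "t < t'"
  shows "ennreal c \<le> hausdorff_dim (set_bifurcation \<beta> \<inter> {t..<t'})"
    "\<exists>r>t. ennreal c \<le> hausdorff_dim (survivor_set \<beta> r)"
proof -
  note tD = dim_bifurcationD[OF t]
  have "0 < s" using c by simp
  obtain L where L: "2 * (\<beta> powr - s) ^ L < 1" using exists_low_level[OF \<open>0 < s\<close>] .
  obtain a b where v: "inside t (a, b)" "a < b" "\<not> summable_weight (\<beta> powr - s) (loops t (a, b))"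
    "loops t (a, b) \<subseteq> {w. arr t {a..<b} w {a..<b}}"
    using dim_bifurcation_recurrent_state[OF t s \<open>0 < s\<close> L] by blast
  obtain n W wtop Z where Z: "scheme t a b n W wtop Z" "ennreal c \<le> hausdorff_dim Z"
    using rich_scheme[OF tD(1) v(2) _ v(3) c] v(4) by blast
  define r where "r = t + (b - a) / \<beta> ^ n / \<beta> ^ n"
  have r: "t < r" using v(2) by (simp add: r_def)
  have Zr: "Z \<subseteq> survivor_set \<beta> r" unfolding r_def by (rule scheme_survivor[OF Z(1) v(2) tD(1)])
  have "ennreal c \<le> hausdorff_dim (survivor_set \<beta> r)"
    using Z(2) hausdorff_dim_mono[OF Zr] by (rule order_trans)
  with r show "\<exists>r>t. ennreal c \<le> hausdorff_dim (survivor_set \<beta> r)" by blast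
  define t2 where "t2 = min r t'"
  have t2: "t < t2" "t2 \<le> r" "t2 \<le> t'" using r t' by (auto simp: t2_def)
  have "hausdorff_dim (survivor_set \<beta> t2) < ennreal s" using tD(5)[OF t2(1)] s by simp
  moreover have "0 \<le> t2" using t2(1) tD(1) by simp
  ultimately obtain n' W' wtop' Z' l k where "scheme t a b n' W' wtop' Z'" "arr t {a..<b} l {a..<b}"
    "k + 0 \<le> length l" "\<forall>y\<in>{a..<b}. val (drop k l) y < t2"
    by (rule loops_dip_below[OF tD(1) v(2,4,3)])
  then have l: "arr t {a..<b} l {a..<b}" "k \<le> length l" "\<And>y. y \<in> {a..<b} \<Longrightarrow> val (drop k l) y < t2"
    by auto
  have "\<exists>w\<in>(\<lambda>j. drop j l) ` {..length l}. val w z \<in> set_bifurcation \<beta> \<inter> {t..<t'}" if z: "z \<in> Z" for z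
  proof -
    have zI: "z \<in> {a..<b}" using z scheme_subset[OF Z(1) v(2)] by blast
    have "z \<in> survivor_set \<beta> r" "k \<le> length l" "val (drop k l) z < r" using z Zr l(2) l(3)[OF zI] t2 by auto
    from minimal_orbit_point[OF l(1) tD(1) zI this] obtain j where j: "j \<le> length l"
      "val (drop j l) z \<in> set_bifurcation \<beta>" "\<forall>i\<le>length l. val (drop j l) z \<le> val (drop i l) z"
      "t \<le> val (drop j l) z" .
    have "val (drop j l) z < t'" using j(3) l(2) l(3)[OF zI] t2 by force
    with j show ?thesis by auto
  qed
  then have "hausdorff_dim Z \<le> hausdorff_dim (set_bifurcation \<beta> \<inter> {t..<t'})"
    by (intro hausdorff_dim_val_preimages[of "(\<lambda>j. drop j l) ` {..length l}"]) auto
  with Z(2) show "ennreal c \<le> hausdorff_dim (set_bifurcation \<beta> \<inter> {t..<t'})" by (rule order_trans)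
qed

text \<open>The hypothesis on \<open>M\<close> is the lower bound; the upper bounds come from \<open>M \<subseteq> K(t)\<close>
  to the right of \<open>t\<close> and from left continuity.\<close>

lemma local_dimension:
  assumes t: "t \<in> dim_bifurcation \<beta>" and M: "M \<subseteq> set_bifurcation \<beta>"
    and ge: "\<And>c t'. 0 \<le> c \<Longrightarrow> ennreal c < hausdorff_dim (survivor_set \<beta> t) \<Longrightarrow> t < t'
      \<Longrightarrow> ennreal c \<le> hausdorff_dim (M \<inter> {t..<t'})"
  shows "((\<lambda>\<epsilon>. hausdorff_dim (M \<inter> {t - \<epsilon><..<t + \<epsilon>})) \<longlongrightarrow> hausdorff_dim (survivor_set \<beta> t)) (at_right 0)"
    and "((\<lambda>\<epsilon>. hausdorff_dim (M \<inter> {t..<t + \<epsilon>})) \<longlongrightarrow> hausdorff_dim (survivor_set \<beta> t)) (at_right 0)"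
proof -
  note tD = dim_bifurcationD[OF t]
  let ?d = "hausdorff_dim (survivor_set \<beta> t)"
  have ge': "?d \<le> hausdorff_dim (M \<inter> {t..<t + \<epsilon>})" if "\<epsilon> > 0" for \<epsilon>
  proof (rule dense_le)
    fix y assume y: "y < ?d"
    then obtain c where "y = ennreal c" "0 \<le> c" by (cases y) auto
    then show "y \<le> hausdorff_dim (M \<inter> {t..<t + \<epsilon>})" using ge[of c "t + \<epsilon>"] y that by simp
  qed
  have sub: "M \<inter> {t0..<t'} \<subseteq> survivor_set \<beta> t0" for t0 t'
    using M set_bifurcation_subset_survivor by auto
  have "hausdorff_dim (M \<inter> {t..<t + \<epsilon>}) = ?d" if "\<epsilon> > 0" for \<epsilon>
    using ge'[OF that] hausdorff_dim_mono[OF sub[of t "t + \<epsilon>"]] by (rule order_antisym[rotated])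
  then have "\<forall>\<^sub>F \<epsilon> in at_right 0. hausdorff_dim (M \<inter> {t..<t + \<epsilon>}) = ?d"
    unfolding eventually_at_right_field by (intro exI[of _ 1]) auto
  then show "((\<lambda>\<epsilon>. hausdorff_dim (M \<inter> {t..<t + \<epsilon>})) \<longlongrightarrow> ?d) (at_right 0)"
    by (rule tendsto_eventually)
  show "((\<lambda>\<epsilon>. hausdorff_dim (M \<inter> {t - \<epsilon><..<t + \<epsilon>})) \<longlongrightarrow> ?d) (at_right 0)"
  proof (rule order_tendstoI)
    fix y assume y: "y < ?d"
    have "y < hausdorff_dim (M \<inter> {t - \<epsilon><..<t + \<epsilon>})" if "\<epsilon> > 0" for \<epsilon>
    proof -
      have "M \<inter> {t..<t + \<epsilon>} \<subseteq> M \<inter> {t - \<epsilon><..<t + \<epsilon>}" using that by auto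
      then show ?thesis using y ge'[OF that] hausdorff_dim_mono by (meson order_less_le_trans)
    qed
    then show "\<forall>\<^sub>F \<epsilon> in at_right 0. y < hausdorff_dim (M \<inter> {t - \<epsilon><..<t + \<epsilon>})"
      unfolding eventually_at_right_field by (intro exI[of _ 1]) auto
  next
    fix y assume y: "?d < y"
    show "\<forall>\<^sub>F \<epsilon> in at_right 0. hausdorff_dim (M \<inter> {t - \<epsilon><..<t + \<epsilon>}) < y"
    proof (cases "t = 0")
      \<comment> \<open>Left continuity is available for \<open>t > 0\<close> only; at 0 nothing of
        M lies to the left.\<close>
      case True
      have "M \<inter> {t - \<epsilon><..<t + \<epsilon>} \<subseteq> survivor_set \<beta> t" for \<epsilon>
      proof -
        have "M \<inter> {t - \<epsilon><..<t + \<epsilon>} \<subseteq> M \<inter> {t..<t + \<epsilon>}"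
          using M True by (auto simp: set_bifurcation_iff)
        then show ?thesis using sub by blast
      qed
      then have "hausdorff_dim (M \<inter> {t - \<epsilon><..<t + \<epsilon>}) < y" for \<epsilon>
        using order_le_less_trans[OF hausdorff_dim_mono y] by simp
      then show ?thesis by simp
    next
      case False
      obtain e where e: "?d < e" "e < y" using y dense by blast
      then have "e < top" using top.not_eq_extremum by fastforce
      then obtain c where c: "e = ennreal c" "0 \<le> c" by (cases e) auto
      obtain t0 where t0: "0 \<le> t0" "t0 < t" "hausdorff_dim (survivor_set \<beta> t0) \<le> ennreal c"
        using dim_survivor_left[of t c] tD(1,2) False e c by auto
      have "hausdorff_dim (M \<inter> {t - \<epsilon><..<t + \<epsilon>}) < y" if "\<epsilon> > 0" "\<epsilon> < t - t0" for \<epsilon>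
      proof -
        have "M \<inter> {t - \<epsilon><..<t + \<epsilon>} \<subseteq> M \<inter> {t0..<t + \<epsilon>}" using that by auto
        then have "M \<inter> {t - \<epsilon><..<t + \<epsilon>} \<subseteq> survivor_set \<beta> t0" using sub by blast
        then have "hausdorff_dim (M \<inter> {t - \<epsilon><..<t + \<epsilon>}) \<le> ennreal c"
          using t0(3) hausdorff_dim_mono order_trans by blast
        then show ?thesis using e c by simp
      qed
      then show ?thesis unfolding eventually_at_right_field
        using t0(2) by (intro exI[of _ "t - t0"]) auto
    qed
  qed
qed


lemma divide_beta_power_le: "0 \<le> x \<Longrightarrow> x / \<beta> ^ n \<le> x"
  using divide_left_mono[OF beta_power_ge_1, of x n] by simp

section \<open>The quasi-greedy expansion of 1\<close>

definition right_ends :: "real set" where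
  "right_ends = range (\<lambda>j. (stepB ^^ j) 1)"

lemma stepB_bounds:
  assumes "0 < b"
  shows "0 < stepB b" "stepB b \<le> 1"
proof -
  have "0 < \<beta> * b" using assms beta_pos by simp
  then show "0 < stepB b" "stepB b \<le> 1" unfolding stepB_def by linarith+
qed

lemma stepB_funpow_bounds: "0 < (stepB ^^ j) 1 \<and> (stepB ^^ j) 1 \<le> 1"
  by (induction j) (auto intro: stepB_bounds)

text \<open>Value of the shifted sequence; the division accounts for \<open>ser\<close> starting at
  exponent 0.\<close>

definition tail :: "(nat \<Rightarrow> nat) \<Rightarrow> nat \<Rightarrow> real" where
  "tail d k = ser \<beta> (\<lambda>i. real (d (k + i))) / \<beta>"

lemma tail_rec:
  assumes "\<And>i. d i \<le> N"
  shows "tail d k = (real (d k) + tail d (Suc k)) / \<beta>"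
  using ser_rec[OF beta_gt_1, of "\<lambda>i. real (d (k + i))" "real N"] assms by (simp add: tail_def)

lemma tail_bounds:
  assumes "\<And>i. d i \<le> N"
  shows "0 \<le> tail d k" "tail d k \<le> real N * \<beta> / (\<beta> - 1) / \<beta>"
proof -
  have *: "0 \<le> ser \<beta> (\<lambda>i. real (d (k + i)))" "ser \<beta> (\<lambda>i. real (d (k + i))) \<le> real N * \<beta> / (\<beta> - 1)"
    using ser_bounds[OF beta_gt_1, of "\<lambda>i. real (d (k + i))" "real N"] assms by simp_all
  show "0 \<le> tail d k" unfolding tail_def using *(1) beta_pos by simp
  show "tail d k \<le> real N * \<beta> / (\<beta> - 1) / \<beta>"
    unfolding tail_def using beta_pos by (intro divide_right_mono *(2)) simp
qed

lemma tail_pos: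
  assumes "\<And>i. d i \<le> N" "d (k + n) \<noteq> 0"
  shows "0 < tail d k"
  using assms(2)
proof (induction n arbitrary: k)
  case 0
  then show ?case using tail_rec[of d N k, OF assms(1)] tail_bounds(1)[of d N "Suc k", OF assms(1)] beta_pos
    by (simp add: add_pos_nonneg)
next
  case (Suc n)
  then have "0 < tail d (Suc k)" by simp
  then show ?case using tail_rec[of d N k, OF assms(1)] beta_pos by (simp add: add_nonneg_pos)
qed

text \<open>The difference of two bounded solutions of the digit recursion grows by the factor
  \<open>\<beta>\<close> in each step, so it vanishes.\<close>

lemma tail_eqI:
  assumes "\<And>i. d i \<le> N" "\<And>k. \<bar>D k\<bar> \<le> C" "\<And>k. D k = (real (d k) + D (Suc k)) / \<beta>"
  shows "tail d k = D k"
proof (rule ccontr)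
  assume "tail d k \<noteq> D k"
  then have pos: "0 < \<bar>tail d k - D k\<bar>" by simp
  have step: "\<bar>tail d k - D k\<bar> = \<bar>tail d (k + n) - D (k + n)\<bar> / \<beta> ^ n" for n
  proof (induction n)
    case (Suc n)
    have "tail d (k + n) - D (k + n) = (tail d (Suc (k + n)) - D (Suc (k + n))) / \<beta>"
      by (subst tail_rec[of d N, OF assms(1)], subst assms(3)) (simp flip: diff_divide_distrib)
    then show ?case using Suc beta_pos by (simp add: mult.commute)
  qed simp
  define M where "M = real N * \<beta> / (\<beta> - 1) / \<beta> + C"
  have M: "\<bar>tail d j - D j\<bar> \<le> M" for j
    using tail_bounds[of d N j, OF assms(1)] assms(2)[of j] by (auto simp: M_def)
  have "M > 0" using M[of k] pos by linarith
  then obtain n where n: "(1 / \<beta>) ^ n < \<bar>tail d k - D k\<bar> / M"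
    using real_arch_pow_inv[of "\<bar>tail d k - D k\<bar> / M" "1 / \<beta>"] pos beta_gt_1 by auto
  have "\<bar>tail d k - D k\<bar> \<le> M / \<beta> ^ n" unfolding step[of n] by (intro divide_right_mono M) simp
  also have "\<dots> = M * (1 / \<beta>) ^ n" by (simp add: power_one_over)
  also have "\<dots> < M * (\<bar>tail d k - D k\<bar> / M)" using n \<open>M > 0\<close> by (rule mult_strict_left_mono)
  finally show False using \<open>M > 0\<close> by simp
qed

lemma tail_0_sums:
  assumes "\<And>i. d i \<le> N"
  shows "(\<lambda>i. real (d i) / \<beta> ^ (i + 1)) sums tail d 0"
proof -
  have "summable (\<lambda>i. real (d i) / \<beta> ^ i)"
    using assms by (intro ser_summable[OF beta_gt_1, of _ "real N"]) auto
  then have "(\<lambda>i. real (d i) / \<beta> ^ i / \<beta>) sums (ser \<beta> (\<lambda>i. real (d i)) / \<beta>)"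
    unfolding ser_def by (intro sums_divide summable_sums)
  then show ?thesis by (simp add: tail_def mult.commute)
qed

lemma infinite_expansionD:
  assumes "infinite_expansion_of_one \<beta> d"
  shows "d i \<le> nat \<lceil>\<beta>\<rceil>" "tail d 0 = 1" "0 < tail d k"
proof -
  show le: "d i \<le> nat \<lceil>\<beta>\<rceil>" for i
  proof -
    have "int (d i) \<le> \<lceil>\<beta>\<rceil> - 1" using assms by (auto simp: infinite_expansion_of_one_def)
    then show ?thesis by linarith
  qed
  show "tail d 0 = 1"
    using tail_0_sums[of d, OF le] assms sums_unique2 unfolding infinite_expansion_of_one_def by blast
  obtain i where "i \<ge> k" "d i \<noteq> 0" using assms by (auto simp: infinite_expansion_of_one_def)
  then show "0 < tail d k" using tail_pos[of d _ k "i - k", OF le] by simp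
qed

text \<open>Digits produced by \<open>stepB\<close> along the orbit of 1, so that the tails of this
  sequence are the right ends.\<close>

definition qg :: "nat \<Rightarrow> nat" where
  "qg j = nat (\<lceil>\<beta> * (stepB ^^ j) 1\<rceil> - 1)"

lemma qg_le: "int (qg j) \<le> \<lceil>\<beta>\<rceil> - 1"
proof -
  have "\<beta> * (stepB ^^ j) 1 \<le> \<beta>" using stepB_funpow_bounds[of j] beta_pos by (simp add: mult_left_le)
  then have "\<lceil>\<beta> * (stepB ^^ j) 1\<rceil> \<le> \<lceil>\<beta>\<rceil>" by (rule ceiling_mono)
  moreover have "1 \<le> \<lceil>\<beta>\<rceil>" using beta_gt_1 by linarith
  ultimately show ?thesis by (simp add: qg_def)
qed

lemma qg_le': "qg j \<le> nat \<lceil>\<beta>\<rceil>"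
  using qg_le[of j] by linarith

lemma tail_qg: "tail qg k = (stepB ^^ k) 1"
proof (rule tail_eqI[of qg, OF qg_le'])
  show "\<bar>(stepB ^^ k) 1\<bar> \<le> 1" for k using stepB_funpow_bounds[of k] by simp
  show "(stepB ^^ k) 1 = (real (qg k) + (stepB ^^ Suc k) 1) / \<beta>" for k
    using beta_pos by (simp add: qg_def stepB_def)
qed

lemma infinite_expansion_qg: "infinite_expansion_of_one \<beta> qg"
  unfolding infinite_expansion_of_one_def
proof (intro conjI allI)
  show "int (qg i) \<in> {0..\<lceil>\<beta>\<rceil> - 1}" for i using qg_le[of i] by simp
  show "(\<lambda>i. real (qg i) / \<beta> ^ (i + 1)) sums 1"
    using tail_0_sums[of qg, OF qg_le'] tail_qg[of 0] by simp
  show "\<exists>i\<ge>m. qg i \<noteq> 0" for m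
  proof (rule ccontr)
    assume "\<not> ?thesis"
    then have "tail qg m = 0" by (simp add: tail_def ser_def)
    then show False using tail_qg[of m] stepB_funpow_bounds[of m] by simp
  qed
qed

text \<open>Up to the first difference the tails agree. There the tail of \<open>qg\<close> is at
  most 1 and that of e is positive, so the digit of e must be the smaller one.\<close>

lemma qg_maximal:
  assumes e: "infinite_expansion_of_one \<beta> e" "e \<noteq> qg"
  shows "less_fun e qg"
proof -
  note D = infinite_expansionD[OF e(1)]
  obtain k where k: "e k \<noteq> qg k" "\<And>i. i < k \<Longrightarrow> e i = qg i" using first_difference[OF e(2)] by blast
  have "tail e i = tail qg i" if "i \<le> k" for i
    using that
  proof (induction i)
    case 0
    then show ?case using D(2) tail_qg[of 0] by simp
  next
    case (Suc i)
    have "\<beta> * tail e i = real (e i) + tail e (Suc i)" "\<beta> * tail qg i = real (qg i) + tail qg (Suc i)"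
      using tail_rec[of e _ i, OF D(1)] tail_rec[of qg _ i, OF qg_le'] beta_pos by simp_all
    then show ?case using Suc k(2)[of i] by simp
  qed
  then have eq: "tail e k = tail qg k" by simp
  have "\<beta> * tail e k = real (e k) + tail e (Suc k)" "\<beta> * tail qg k = real (qg k) + tail qg (Suc k)"
    using tail_rec[of e _ k, OF D(1)] tail_rec[of qg _ k, OF qg_le'] beta_pos by simp_all
  then have "real (e k) + tail e (Suc k) = real (qg k) + tail qg (Suc k)" using eq by simp
  moreover have "tail qg (Suc k) \<le> 1" unfolding tail_qg using stepB_funpow_bounds by blast
  moreover have "0 < tail e (Suc k)" by (rule D(3))
  ultimately have "e k < qg k" using k(1) by linarith
  then show ?thesis unfolding less_fun_def using k(2) by blast
qed

lemma quasi_greedy_eq: "quasi_greedy \<beta> = qg"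
  unfolding quasi_greedy_def
proof (rule the_equality)
  show "infinite_expansion_of_one \<beta> qg \<and>
      (\<forall>e. infinite_expansion_of_one \<beta> e \<longrightarrow> e = qg \<or> less_fun e qg)"
    using infinite_expansion_qg qg_maximal by blast
next
  fix d assume d: "infinite_expansion_of_one \<beta> d \<and>
      (\<forall>e. infinite_expansion_of_one \<beta> e \<longrightarrow> e = d \<or> less_fun e d)"
  then have "qg = d \<or> less_fun qg d" using infinite_expansion_qg by blast
  moreover have "d = qg \<or> less_fun d qg" using d qg_maximal by blast
  ultimately show "d = qg" using less_fun_asym by blast
qed

text \<open>A right end is determined by the digits from its index on, so periodic digits give a
  periodic orbit.\<close>

lemma finite_right_ends:
  assumes "eventually_periodic (quasi_greedy \<beta>)"
  shows "finite right_ends"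
proof -
  obtain m p where p: "p > 0" "\<And>i. i \<ge> m \<Longrightarrow> qg (i + p) = qg i"
    using assms unfolding quasi_greedy_eq eventually_periodic_def by blast
  let ?B = "\<lambda>j. (stepB ^^ j) 1"
  have per: "?B (k + p) = ?B k" if "k \<ge> m" for k
  proof -
    have "qg (k + p + i) = qg (k + i)" for i using p(2)[of "k + i"] that by (simp add: add.assoc add.commute add.left_commute)
    then have "tail qg (k + p) = tail qg k" by (simp add: tail_def)
    then show ?thesis by (simp only: tail_qg)
  qed
  have "?B k \<in> ?B ` {..<m + p}" for k
  proof (induction k rule: less_induct)
    case (less k)
    show ?case
    proof (cases "k < m + p")
      case False
      then have "?B k = ?B (k - p)" using per[of "k - p"] by simp
      then show ?thesis using less[of "k - p"] False p(1) by simp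
    qed auto
  qed
  then have "right_ends \<subseteq> ?B ` {..<m + p}" unfolding right_ends_def by blast
  then show ?thesis using finite_subset by blast
qed

lemma snd_run_right_ends:
  assumes "inside t s" "0 \<le> t" "alive (run t s w)" "snd s \<in> right_ends"
  shows "snd (run t s w) \<in> right_ends"
  using assms
proof (induction w arbitrary: s)
  case (Cons d w)
  have al: "alive (nxt t s d)" using alive_run_append[of t s "[d]" w] Cons.prems by simp
  have "stepB b \<in> right_ends" if "b \<in> right_ends" for b
    using that unfolding right_ends_def by (metis (no_types, lifting) funpow.simps(2) comp_apply rangeE rangeI)
  moreover have "1 \<in> right_ends" unfolding right_ends_def by (rule range_eqI[of _ _ 0]) simp
  ultimately have "snd (nxt t s d) \<in> right_ends"
    using nxt_cases(4)[OF Cons.prems(1,2) al] Cons.prems(4) by simp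
  then show ?case using Cons.IH[of "nxt t s d"] Cons.prems by simp
qed auto

section \<open>Irreducibility and strict monotonicity\<close>

text \<open>The words \<open>g @ \<kappa>\<close> with g from X form a prefix code, since \<kappa>
  contains u, which dips below x' and so cannot occur inside a word of X. A large finite part has
  weight above 2 at \<open>s1\<close>, and by continuity still at some larger exponent.\<close>

lemma loops_strict_increase:
  fixes s1 :: real
  assumes "0 \<le> x" "x < x'" "a < b"
    and X: "X \<subseteq> {w. arr x' {a..<b} w {a..<b}}" "\<not> summable_weight (\<beta> powr - s1) X"
    and \<kappa>: "arr x {a..<b} \<kappa> {a..<b}" "\<kappa> = \<kappa>1 @ u" "\<And>y. 0 \<le> y \<Longrightarrow> y < 1 \<Longrightarrow> val u y < x'"
  shows "\<exists>s2>s1. \<not> summable_weight (\<beta> powr - s2) {w. arr x {a..<b} w {a..<b}}"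
proof -
  let ?J = "{a..<b}"
  define K where "K = length \<kappa>"
  have Xne: "X \<noteq> {}" using X(2) summable_weight_finite[of "{}" "\<beta> powr - s1"] by auto
  have J: "x' \<le> y \<and> y < 1" if "y \<in> ?J" for y
    using Xne X(1) that adm_end by (fastforce simp: arr_def)
  have "a \<in> ?J" using assms(3) by simp
  have "\<kappa> \<noteq> []"
  proof
    assume "\<kappa> = []"
    then show False using \<kappa>(2) \<kappa>(3)[of a] J[OF \<open>a \<in> ?J\<close>] assms(1,2) by simp
  qed
  then have "K > 0" by (simp add: K_def)
  \<comment> \<open>With lengths congruent modulo K, a proper prefix is shorter by at least K, so
    \<kappa> would fit completely inside the other word of X.\<close>
  define Xr where "Xr r = {w \<in> X. length w mod K = r}" for r
  have "X = (\<Union>r\<in>{..<K}. Xr r)" using \<open>K > 0\<close> by (auto simp: Xr_def)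
  then obtain r where r: "\<not> summable_weight (\<beta> powr - s1) (Xr r)"
    using summable_weight_UN[of "{..<K}" "\<beta> powr - s1" Xr] X(2) by auto
  define z1 where "z1 = \<beta> powr - s1"
  have z1: "z1 > 0" using beta_pos by (simp add: z1_def)
  obtain F where F: "finite F" "F \<subseteq> Xr r" "weight z1 F > 3 / z1 ^ K"
    using large_finite_weight[OF r] unfolding z1_def by blast
  define R where "R = (\<lambda>g. g @ \<kappa>) ` F"
  have wR: "weight z R = z ^ K * weight z F" for z
  proof -
    have "inj_on (\<lambda>g. g @ \<kappa>) F" by (auto intro: inj_onI)
    then show ?thesis unfolding weight_def R_def
      by (simp add: sum.reindex power_add sum_distrib_left K_def mult.commute)
  qed
  have "2 < weight z1 R" unfolding wR using F(3) z1 by (simp add: field_simps)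
  have "((\<lambda>s. weight (\<beta> powr - s) R) \<longlongrightarrow> weight (\<beta> powr - s1) R) (at_right s1)"
    unfolding weight_def using beta_pos by (intro tendsto_intros) auto
  then have "\<forall>\<^sub>F s in at_right s1. 2 < weight (\<beta> powr - s) R"
    using \<open>2 < weight z1 R\<close> unfolding z1_def by (rule order_tendstoD)
  moreover have "\<forall>\<^sub>F s in at_right s1. s > s1" by (rule eventually_at_right_less)
  ultimately have "\<forall>\<^sub>F s in at_right s1. 2 < weight (\<beta> powr - s) R \<and> s > s1" by (rule eventually_conj)
  then obtain s2 where s2: "2 < weight (\<beta> powr - s2) R" "s2 > s1"
    using eventually_happens' trivial_limit_at_right_real by blast
  have "\<not> summable_weight (\<beta> powr - s2) {w. arr x ?J w ?J}"
  proof (rule not_summable_weight_prefix_code[of R])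
    show "finite R" using F by (simp add: R_def)
    show "2 \<le> weight (\<beta> powr - s2) R" using s2 by simp
    show "[] \<in> {w. arr x ?J w ?J}" using J assms(2) by (auto simp: arr_def intro: order_trans less_imp_le)
    fix u1 v1
    have arrR: "arr x ?J v ?J" if v: "v \<in> R" for v
    proof -
      obtain g where g: "g \<in> F" "v = g @ \<kappa>" using v by (auto simp: R_def)
      then have "arr x' ?J g ?J" using F(2) X(1) by (auto simp: Xr_def)
      then have "arr x ?J g ?J" using adm_antimono assms(2) unfolding arr_def by (meson less_imp_le)
      then show ?thesis unfolding g(2) using \<kappa>(1) by (rule arr_append)
    qed
    show "u1 @ v1 \<in> {w. arr x ?J w ?J}" if "u1 \<in> R" "v1 \<in> {w. arr x ?J w ?J}"
      using arr_append[OF arrR[OF that(1)]] that(2) by blast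
    fix w assume uv: "u1 \<in> R" "v1 \<in> R" "u1 @ w = v1"
    obtain g g' where g: "g \<in> F" "u1 = g @ \<kappa>" "g' \<in> F" "v1 = g' @ \<kappa>" using uv by (auto simp: R_def)
    have eq: "g @ \<kappa> @ w = g' @ \<kappa>" using uv(3) g by simp
    have len: "length g + length w = length g'" using arg_cong[OF eq, of length] by simp
    have md: "length g mod K = length g' mod K" using g F(2) by (auto simp: Xr_def)
    show "u1 = v1"
    proof (cases "length w = 0")
      case True
      then show ?thesis using uv(3) by simp
    next
      case False
      have "K dvd length g' - length g" using md len mod_eq_dvd_iff_nat[of "length g" "length g'" K] by (metis le_add1)
      moreover have "length g' - length g = length w" using len by simp
      ultimately have "K \<le> length w" using False by (intro dvd_imp_le) auto
      define m where "m = length (g @ \<kappa>)"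
      have "m \<le> length g'" using \<open>K \<le> length w\<close> len by (simp add: m_def K_def)
      then have "take m (g' @ \<kappa>) = take m g'" by simp
      moreover have "take m (g @ \<kappa> @ w) = g @ \<kappa>" by (simp add: m_def)
      ultimately have "g @ \<kappa> = take m g'" using eq by metis
      then have "g' = (g @ \<kappa>) @ drop m g'" by (metis append_take_drop_id)
      then obtain h where h: "g' = (g @ \<kappa>1) @ u @ h" using \<kappa>(2) by (metis append.assoc)
      have "adm x' g' a" using g(3) F(2) X(1) \<open>a \<in> ?J\<close> by (auto simp: Xr_def arr_def)
      then have "adm x' u (val h a)" "adm x' h a" unfolding h adm_append by auto
      then have "x' \<le> val u (val h a)" "0 \<le> val h a" "val h a < 1"
        using adm_bounds[of x' u "val h a"] adm_bounds[of x' h a] assms(1,2) by auto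
      then show ?thesis using \<kappa>(3)[of "val h a"] by simp
    qed
  qed auto
  then show ?thesis using s2(2) by blast
qed

text \<open>For the initial digits \<open>dw\<close> of t, with \<open>T0\<close> the corresponding
  iterate of t, this is the set of all y with \<open>adm t dw y\<close>.\<close>

definition gate :: "nat list \<Rightarrow> real \<Rightarrow> real set" where
  "gate dw T0 = {y. T0 \<le> y \<and> (\<forall>k\<le>length dw. val (drop k dw) y < 1)}"

text \<open>Looking back from a point close to \<open>t\<close>, the most recent moment at which the left end of
  the follower interval was \<open>t\<close> gives a position from which every point of \<open>gate\<close> can be reached.
  The right end is harmless because it belongs to the finite set \<open>right_ends\<close> and hence is
  not too close to \<open>t\<close>.\<close>

lemma connected_to_gate:
  fixes c :: real
  assumes t: "0 \<le> t"
    and dw: "adm t dw T0" "val dw T0 = t"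
    and gap: "\<And>b. b \<in> right_ends \<Longrightarrow> t < b \<Longrightarrow> t + 1 / \<beta> ^ length dw \<le> b"
    and \<rho>0: "\<And>k. k \<le> length dw \<Longrightarrow> \<beta> ^ length dw * \<rho> \<le> 1 - val (drop k dw) T0" "0 < \<rho>"
    and ab: "inside t (a, b)" "b \<in> right_ends" "a < b" "\<rho> \<le> b - a"
    and X: "X \<subseteq> {w. arr t {a..<b} w {a..<b}}" "\<not> summable_weight (\<beta> powr - c) X"
    and dim: "hausdorff_dim (survivor_set \<beta> (t + \<rho>)) < ennreal c"
  shows "\<exists>p q. arr t {a..<b} p (gate dw T0) \<and> arr t (gate dw T0) q {a..<b}"
proof -
  let ?I = "{a..<b}" and ?Q = "gate dw T0" and ?K = "length dw"
  have "0 \<le> t + \<rho>" using t \<rho>0(2) by simp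
  from loops_dip_below[OF t ab(3) X dim this, of ?K] obtain n W wtop Z u k where
    sch: "scheme t a b n W wtop Z" and u: "arr t ?I u ?I" "k + ?K \<le> length u"
    "\<forall>y\<in>?I. val (drop k u) y < t + \<rho>" .
  obtain l where l: "l \<in> W" using schemeD(2)[OF sch] by blast
  have lar: "arr t ?I l ?I" "length l = n" "a + (b - a) / \<beta> ^ n \<le> val l a"
    using schemeD(4,5)[OF sch, of l] schemeD(6)[OF sch l, of a] l ab(3) by auto
  define p where "p = l @ take k u"
  define uu where "uu = drop k u"
  have pu: "p @ uu = l @ u" by (simp add: p_def uu_def)
  have aI: "a \<in> ?I" using ab(3) by simp
  have adm_lu: "adm t (l @ u) y" "val (l @ u) y \<in> ?I" if "y \<in> ?I" for y
    using arr_append[OF lar(1) u(1)] that unfolding arr_def by blast+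
  have uuy: "t \<le> val uu y" "val uu y < t + \<rho>" if "y \<in> ?I" for y
    using adm_bounds[OF adm_drop[of t u y k]] u(1,3) that by (auto simp: arr_def uu_def)
  define \<tau> where "\<tau> = val uu a"
  have \<tau>: "t \<le> \<tau>" "\<tau> < t + \<rho>" using uuy[OF aI] by (auto simp: \<tau>_def)
  \<comment> \<open>Replacing \<tau> by t lowers the value by at most \<rho>, hence by at most
    \<open>b - a\<close>; the word l in front was chosen to absorb this, as it lifts a by
    \<open>(b - a) / \<beta> ^ n\<close>.\<close>
  have pt: "a \<le> val p t"
  proof -
    have "val (take k u) \<tau> = val u a" unfolding \<tau>_def uu_def by (simp flip: val_append)
    then have "a \<le> val (take k u) \<tau>" using u(1) aI by (auto simp: arr_def)
    moreover have "val (take k u) t = val (take k u) \<tau> - (\<tau> - t) / \<beta> ^ length (take k u)"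
      using val_shift[of "take k u" t \<tau>] by (simp add: diff_divide_distrib)
    moreover have "(\<tau> - t) / \<beta> ^ length (take k u) \<le> \<tau> - t"
      using \<tau>(1) beta_power_ge_1[of "length (take k u)"] by (simp add: divide_le_eq mult_le_cancel_left1)
    ultimately have "a + (- (b - a)) \<le> val (take k u) t" using \<tau>(2) ab(4) by linarith
    then have "val l (a + (- (b - a))) \<le> val p t" by (simp add: p_def)
    moreover have "val l (a + (- (b - a))) = val l a - (b - a) / \<beta> ^ n"
      by (subst val_shift[of l _ a]) (simp add: lar(2) diff_divide_distrib)
    ultimately show ?thesis using lar(3) by linarith
  qed
  define g where "g w = (t - val w 0) * \<beta> ^ length w" for w
  have val_g: "val w (g w) = t" for w
  proof -
    have "val w (g w) = val w 0 + (g w - 0) / \<beta> ^ length w" by (rule val_shift)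
    also have "\<dots> = t" using beta_pos by (simp add: g_def)
    finally show ?thesis .
  qed
  \<comment> \<open>The least tail for which all suffixes of p stay at or above t. Where the maximum
    is attained, the path sits exactly at t.\<close>
  define A where "A = Max ((\<lambda>j. g (drop j p)) ` {..length p})"
  have "A \<in> (\<lambda>j. g (drop j p)) ` {..length p}" unfolding A_def by (intro Max_in) auto
  then obtain j where j: "A = g (drop j p)" "j \<le> length p" by auto
  have A_ge: "g (drop i p) \<le> A" if "i \<le> length p" for i unfolding A_def using that by (intro Max_ge) auto
  have A_t: "t \<le> val (drop i p) A" if "i \<le> length p" for i
  proof -
    have "val (drop i p) (g (drop i p)) \<le> val (drop i p) A" using A_ge[OF that] by simp
    then show ?thesis by (simp add: val_g)
  qed
  have tA: "t \<le> A" using A_ge[of "length p"] by (simp add: g_def)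
  define p0 ps where "p0 = take j p" and "ps = drop j p"
  have p0ps: "p0 @ ps = p" "val ps A = t" using j val_g by (simp_all add: p0_def ps_def)
  have lu: "l @ u = p0 @ ps @ uu" using pu p0ps(1) by (metis append.assoc)
  have drop_p0: "drop i p0 @ ps = drop i p" if "i \<le> length p0" for i
    using that p0ps(1) by (metis drop_append drop_0 diff_is_0_eq)
  have adm_u0: "adm t (ps @ uu) y" if "y \<in> ?I" for y
    using adm_lu(1)[OF that] unfolding lu adm_append by blast
  have A_le: "A \<le> val uu y" if "y \<in> ?I" for y
  proof -
    have "t \<le> val (ps @ uu) y" using adm_bounds[OF adm_u0[OF that]] by blast
    then have "val ps A \<le> val ps (val uu y)" using p0ps(2) by simp
    then show ?thesis by simp
  qed
  have t_le: "t \<le> val ps \<tau>"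
    using adm_bounds[OF adm_u0[OF aI]] by (simp add: \<tau>_def)
  have "t \<in> itv (run t (a, b) p0)"
  proof (subst itv_run[OF ab(1)], intro conjI)
    show "adm t p0 t"
      unfolding adm_iff_drop
    proof (intro allI impI)
      fix i assume i: "i \<le> length p0"
      then have "i \<le> length p" by (simp add: p0_def)
      have "val (drop i p0) t = val (drop i p) A"
        using drop_p0[OF i] p0ps(2) by (metis val_append)
      then have "t \<le> val (drop i p0) t" using A_t[OF \<open>i \<le> length p\<close>] by simp
      moreover have "val (drop i p0) t \<le> val (drop i p0) (val ps \<tau>)" using t_le by simp
      moreover have "val (drop i p0) (val ps \<tau>) < 1"
        using adm_bounds[OF adm_drop[OF adm_lu(1)[OF aI], of i]] i by (simp add: lu \<tau>_def)
      ultimately show "t \<le> val (drop i p0) t \<and> val (drop i p0) t < 1" by linarith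
    qed
    have "val p0 t = val p A" using p0ps by (metis val_append)
    then have "a \<le> val p0 t" using pt tA val_le_iff[of p t A] by linarith
    moreover have "val p0 t \<le> val p0 (val ps \<tau>)" using t_le by simp
    moreover have "val p0 (val ps \<tau>) < b" using adm_lu(2)[OF aI] by (simp add: lu \<tau>_def)
    ultimately have "a \<le> val p0 t" "val p0 t < b" by linarith+
    then show "val p0 t \<in> itv (a, b)" by (simp add: itv_def)
  qed
  then have run: "alive (run t (a, b) p0)" "fst (run t (a, b) p0) \<le> t" "t < snd (run t (a, b) p0)"
    by (auto simp: itv_def alive_def)
  have "snd (run t (a, b) p0) \<in> right_ends"
    using snd_run_right_ends[OF ab(1) t run(1)] ab(2) by simp
  \<comment> \<open>Points starting with \<open>dw\<close> and lying above t are within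
    \<open>1 / \<beta> ^ ?K\<close> of t, so they all fit below this right end.\<close>
  then have far: "t + 1 / \<beta> ^ ?K \<le> snd (run t (a, b) p0)" using gap run(3) by blast
  have T01: "0 \<le> T0" using adm_end[OF dw(1)] t by simp
  have "arr t ?I (p0 @ dw) ?Q"
    unfolding arr_def
  proof
    fix y assume y: "y \<in> ?Q"
    then have y': "T0 \<le> y" "\<And>k. k \<le> ?K \<Longrightarrow> val (drop k dw) y < 1" by (auto simp: gate_def)
    have "t \<le> val (drop i dw) y" if "i \<le> ?K" for i
      using adm_bounds[OF adm_drop[OF dw(1), of i]] y'(1) val_le_iff[of "drop i dw" T0 y] by linarith
    then have adm1: "adm t dw y" using y'(2) by (simp add: adm_iff_drop)
    have "y < 1" using y'(2)[of ?K] by simp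
    then have "(y - T0) / \<beta> ^ ?K < 1 / \<beta> ^ ?K" using T01 by (intro divide_strict_right_mono) auto
    then have "val dw y < t + 1 / \<beta> ^ ?K" using val_shift[of dw y T0] dw(2) by simp
    moreover have "t \<le> val dw y" using adm_bounds[OF adm1] by simp
    ultimately have "val dw y \<in> itv (run t (a, b) p0)" using run far by (simp add: itv_def)
    then have "adm t p0 (val dw y)" "val p0 (val dw y) \<in> ?I"
      unfolding itv_run[OF ab(1)] by (auto simp: itv_def)
    with adm1 show "adm t (p0 @ dw) y \<and> val (p0 @ dw) y \<in> ?I" by (simp add: adm_append)
  qed
  moreover have "arr t ?Q (drop ?K (ps @ uu)) ?I"
    unfolding arr_def
  proof
    fix y assume y: "y \<in> ?I"
    let ?u0 = "ps @ uu"
    let ?y' = "val (drop ?K ?u0) y"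
    have adm0: "adm t ?u0 y" by (rule adm_u0[OF y])
    have len: "?K \<le> length ?u0" using u(2) by (simp add: uu_def)
    have split: "take ?K ?u0 @ drop ?K ?u0 = ?u0" by (rule append_take_drop_id)
    have Y: "val ?u0 y = val (take ?K ?u0) ?y'" using arg_cong[OF split, of "\<lambda>w. val w y"] val_append by metis
    have Yt: "t \<le> val ?u0 y" using adm_bounds[OF adm0] by blast
    have "val ?u0 y = t + (val uu y - A) / \<beta> ^ length ps"
      using val_shift[of ps "val uu y" A] p0ps(2) by simp
    also have "\<dots> \<le> t + (val uu y - A)"
      using A_le[OF y] beta_power_ge_1[of "length ps"] by (simp add: divide_le_eq mult_le_cancel_left1)
    also have "\<dots> < t + \<rho>" using uuy(2)[OF y] tA by simp
    finally have Y\<rho>: "val ?u0 y < t + \<rho>" .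
    \<comment> \<open>The path passes within \<rho> of t, and \<rho> is so small that such points
      share their first digits with t. Uniqueness of digits identifies them with
      \<open>dw\<close>.\<close>
    define y2 where "y2 = T0 + \<beta> ^ ?K * (val ?u0 y - t)"
    have y2: "val dw y2 = val ?u0 y" using val_shift[of dw y2 T0] dw(2) beta_pos by (simp add: y2_def)
    have "adm 0 dw y2"
      unfolding adm_iff_drop
    proof (intro allI impI)
      fix i assume i: "i \<le> ?K"
      have "T0 \<le> y2" using Yt by (simp add: y2_def)
      then have "val (drop i dw) T0 \<le> val (drop i dw) y2" by simp
      moreover have "0 \<le> val (drop i dw) T0" using adm_bounds[OF adm_drop[OF dw(1), of i]] t by simp
      moreover have "val (drop i dw) y2 < 1"
      proof -
        have "val (drop i dw) y2 = val (drop i dw) T0 + \<beta> ^ ?K * (val ?u0 y - t) / \<beta> ^ (?K - i)"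
          using val_shift[of "drop i dw" y2 T0] by (simp add: y2_def)
        also have "\<beta> ^ ?K * (val ?u0 y - t) / \<beta> ^ (?K - i) \<le> \<beta> ^ ?K * (val ?u0 y - t)"
          using Yt by (intro divide_beta_power_le mult_nonneg_nonneg) auto
        also have "\<beta> ^ ?K * (val ?u0 y - t) < \<beta> ^ ?K * \<rho>"
          using Y\<rho> by (intro mult_strict_left_mono) auto
        also have "\<dots> \<le> 1 - val (drop i dw) T0" by (rule \<rho>0(1)[OF i])
        finally show ?thesis by simp
      qed
      ultimately show "0 \<le> val (drop i dw) y2 \<and> val (drop i dw) y2 < 1" by linarith
    qed
    moreover have adms: "adm t (take ?K ?u0) ?y'" "adm t (drop ?K ?u0) y"
      using adm0 adm_append[of t "take ?K ?u0" "drop ?K ?u0" y] unfolding split by blast+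
    moreover have "adm 0 (take ?K ?u0) ?y'" using adms(1) t by (rule adm_antimono)
    ultimately have tk: "take ?K ?u0 = dw"
      using val_inj[of "take ?K ?u0" ?y' dw y2] len Y y2 by simp
    have "T0 \<le> ?y'"
    proof -
      have "t \<le> val dw ?y'" using Yt Y unfolding tk by (rule ord_le_eq_trans)
      then show ?thesis using val_le_iff[of dw T0 ?y'] unfolding dw(2) by blast
    qed
    moreover have "adm t dw ?y'" using adms(1) unfolding tk .
    then have "val (drop i dw) ?y' < 1" for i
      using adm_bounds[OF adm_drop] by blast
    ultimately have "?y' \<in> ?Q" unfolding gate_def by blast
    with adms(2) show "adm t (drop ?K ?u0) y \<and> ?y' \<in> ?Q" by blast
  qed
  ultimately show ?thesis by blast
qed

end

section \<open>Local dimension\<close>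

lemma finite_gap:
  fixes G :: "real set"
  assumes "finite G"
  obtains e where "e > 0" "\<forall>x\<in>G. x \<noteq> t \<longrightarrow> e \<le> \<bar>x - t\<bar>"
proof -
  obtain d where "d > 0" "\<forall>x\<in>G. x \<noteq> t \<longrightarrow> d \<le> dist t x"
    using finite_set_avoid[OF assms, of t] by blast
  then show thesis using that[of d] by (simp add: dist_real_def abs_minus_commute)
qed

lemma finite_positive_lower_bound:
  fixes G :: "real set"
  assumes "finite G" "\<forall>x\<in>G. x > 0"
  obtains e where "e > 0" "\<forall>x\<in>G. e \<le> x"
proof -
  have "Min (insert 1 G) \<in> insert 1 G" using assms(1) by (intro Min_in) auto
  then have "0 < Min (insert 1 G)" using assms(2) by auto
  moreover have "\<forall>x\<in>G. Min (insert 1 G) \<le> x" using assms(1) by (auto intro: Min_le)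
  ultimately show thesis using that by blast
qed

context beta_base
begin

text \<open>As the orbit of t stays at or above t, the cut-off at x is inactive for x slightly to
  the right, so the left ends of the low states are affine in the threshold.\<close>

lemma stepA_funpow_right:
  assumes t: "t \<in> set_bifurcation \<beta>"
  obtains \<delta> where "\<delta> > 0"
    "\<forall>x\<in>{t..<t + \<delta>}. \<forall>i\<le>L. (stepA x ^^ i) x = (beta_map \<beta> ^^ i) t + \<beta> ^ i * (x - t)"
proof -
  let ?T = "\<lambda>i. (beta_map \<beta> ^^ i) t"
  have tT: "0 \<le> t" "\<And>n. t \<le> (beta_map \<beta> ^^ n) t" using t by (auto simp: set_bifurcation_iff)
  have "\<exists>\<delta>>0. \<forall>x\<in>{t..<t + \<delta>}. \<forall>i\<le>L. (beta_map \<beta> ^^ i) x = (beta_map \<beta> ^^ i) t + \<beta> ^ i * (x - t)"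
  proof (induction L)
    case 0
    then show ?case by (auto intro: exI[of _ 1])
  next
    case (Suc L)
    obtain \<delta>1 where 1: "\<delta>1 > 0"
      "\<forall>x\<in>{t..<t + \<delta>1}. \<forall>i\<le>L. (beta_map \<beta> ^^ i) x = (beta_map \<beta> ^^ i) t + \<beta> ^ i * (x - t)"
      using Suc by blast
    obtain \<delta>2 where 2: "\<delta>2 > 0"
      "\<forall>x\<in>{t..<t + \<delta>2}. (beta_map \<beta> ^^ Suc L) x = (beta_map \<beta> ^^ Suc L) t + \<beta> ^ Suc L * (x - t)"
      using beta_map_funpow_right[of t "Suc L"] by blast
    show ?case
    proof (intro exI[of _ "min \<delta>1 \<delta>2"] conjI ballI allI impI)
      show "0 < min \<delta>1 \<delta>2" using 1(1) 2(1) by simp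
      fix x i assume "x \<in> {t..<t + min \<delta>1 \<delta>2}" and i: "i \<le> Suc L"
      then have x: "x \<in> {t..<t + \<delta>1}" "x \<in> {t..<t + \<delta>2}" by auto
      show "(beta_map \<beta> ^^ i) x = (beta_map \<beta> ^^ i) t + \<beta> ^ i * (x - t)"
        using i 1(2)[rule_format, OF x(1), of i] 2(2)[rule_format, OF x(2)] by (cases "i = Suc L") (blast, linarith)
    qed
  qed
  then obtain \<delta> where \<delta>: "\<delta> > 0"
    "\<forall>x\<in>{t..<t + \<delta>}. \<forall>i\<le>L. (beta_map \<beta> ^^ i) x = (beta_map \<beta> ^^ i) t + \<beta> ^ i * (x - t)" by blast
  have "(stepA x ^^ i) x = (beta_map \<beta> ^^ i) t + \<beta> ^ i * (x - t)" if x: "x \<in> {t..<t + \<delta>}" and "i \<le> L" for x i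
  proof -
    have "(stepA x ^^ i) x = (beta_map \<beta> ^^ i) x"
      using \<open>i \<le> L\<close>
    proof (induction i)
      case (Suc i)
      let ?y = "(beta_map \<beta> ^^ i) x"
      have ge: "x \<le> (beta_map \<beta> ^^ i) x" if "i \<le> L" for i
      proof -
        have "x = t + 1 * (x - t)" by simp
        also have "\<dots> \<le> ?T i + \<beta> ^ i * (x - t)"
          using x beta_power_ge_1 by (intro add_mono tT(2) mult_right_mono) auto
        also have "\<dots> = (beta_map \<beta> ^^ i) x" using \<delta>(2)[rule_format, OF x that] by simp
        finally show ?thesis .
      qed
      have "0 \<le> x" using x tT(1) by simp
      then have "0 \<le> \<beta> * ?y" using ge[of i] Suc.prems beta_pos by simp
      then have "stepA x ?y = max (beta_map \<beta> ?y) x" by (simp add: stepA_def beta_map_def frac_def)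
      also have "\<dots> = (beta_map \<beta> ^^ Suc i) x" using ge[OF Suc.prems] by simp
      finally show ?case using Suc by simp
    qed simp
    then show ?thesis using \<delta>(2)[rule_format, OF x that(2)] by simp
  qed
  with \<delta>(1) show thesis using that by blast
qed

text \<open>Replacing the tail of a minimal orbit point \<open>x\<close> by the
  largest loop gives a loop of \<open>K(x)\<close> that dips below \<open>x'\<close>.\<close>

lemma dim_bifurcation_dim_ge_aux:
  fixes c0 s :: real
  assumes fin: "finite right_ends" and tnb: "t \<notin> right_ends"
    and aper: "\<And>i j. (beta_map \<beta> ^^ i) t = (beta_map \<beta> ^^ j) t \<Longrightarrow> i = j"
    and tB: "t \<in> dim_bifurcation \<beta>" and s: "hausdorff_dim (survivor_set \<beta> t) = ennreal s"
    and c0: "0 \<le> c0" "c0 < s" and t': "t < t'"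
  shows "ennreal c0 \<le> hausdorff_dim (dim_bifurcation \<beta> \<inter> {t..<t'})"
proof -
  note tD = dim_bifurcationD[OF tB]
  let ?T = "\<lambda>i. (beta_map \<beta> ^^ i) t"
  have "0 < s" using c0 by simp
  have tE: "\<And>n. t \<le> ?T n" using tD(3) by (simp add: set_bifurcation_iff)
  have tK: "t \<in> survivor_set \<beta> t" by (rule set_bifurcation_subset_survivor[OF order_refl tD(3)])
  obtain gap0 where gap0: "gap0 > 0" "\<forall>b\<in>right_ends. b \<noteq> t \<longrightarrow> gap0 \<le> \<bar>b - t\<bar>"
    using finite_gap[OF fin] by blast
  \<comment> \<open>The first K0 digits of t single out a cylinder shorter than the distance from t
    to the other right ends.\<close>
  obtain K0 where K0: "(1 / \<beta>) ^ K0 < gap0" using real_arch_pow_inv[OF gap0(1), of "1 / \<beta>"] beta_gt_1 by auto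
  obtain dw where dw: "length dw = K0" "adm t dw (?T K0)" "val dw (?T K0) = t"
    using survivor_expansion[OF tK] by blast
  define Q where "Q = gate dw (?T K0)"
  have gap: "t + 1 / \<beta> ^ length dw \<le> b" if "b \<in> right_ends" "t < b" for b
    using gap0(2)[rule_format, OF that(1)] that(2) K0 dw(1) by (simp add: power_one_over)
  obtain \<rho>0 where \<rho>0: "\<rho>0 > 0" "\<forall>x\<in>(\<lambda>k. (1 - val (drop k dw) (?T K0)) / \<beta> ^ K0) ` {..K0}. \<rho>0 \<le> x"
  proof (rule finite_positive_lower_bound)
    show "\<forall>x\<in>(\<lambda>k. (1 - val (drop k dw) (?T K0)) / \<beta> ^ K0) ` {..K0}. 0 < x"
      using adm_bounds[OF adm_drop[OF dw(2)]] by auto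
  qed (auto intro: that)
  \<comment> \<open>One level for all exponents from \<open>s / 2\<close> on, because the dimension
    of K(x') will be known only to be at least c.\<close>
  obtain L where L: "2 * (\<beta> powr - (s / 2)) ^ L < 1" using exists_low_level[of "s / 2"] \<open>0 < s\<close> by auto
  have L': "2 * (\<beta> powr - s1) ^ L < 1" if "s / 2 \<le> s1" for s1
  proof -
    have "(\<beta> powr - s1) ^ L \<le> (\<beta> powr - (s / 2)) ^ L"
      using that beta_gt_1 by (intro power_mono powr_mono) auto
    then show ?thesis using L by linarith
  qed
  obtain \<delta>A where \<delta>A: "\<delta>A > 0"
    "\<forall>x\<in>{t..<t + \<delta>A}. \<forall>i\<le>L. (stepA x ^^ i) x = ?T i + \<beta> ^ i * (x - t)"
    using stepA_funpow_right[OF tD(3)] by blast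
  have A_t: "(stepA t ^^ i) t = ?T i" if "i \<le> L" for i
    using \<delta>A(2)[rule_format, of t i] \<delta>A(1) that by simp
  define P where "P = (\<lambda>(i, j). (?T i, (stepB ^^ j) 1)) ` ({..L} \<times> {..L})"
  have finP: "finite P" by (simp add: P_def)
  have P_low: "low_states t L \<subseteq> P" unfolding low_states_def P_def using A_t by force
  obtain \<rho>1 where \<rho>1: "\<rho>1 > 0" "\<forall>x\<in>(\<lambda>v. snd v - fst v) ` {v \<in> P. fst v < snd v}. \<rho>1 \<le> x"
    using finite_positive_lower_bound[of "(\<lambda>v. snd v - fst v) ` {v \<in> P. fst v < snd v}"] finP by auto
  define \<rho> where "\<rho> = min \<rho>0 \<rho>1"
  have \<rho>: "0 < \<rho>" "\<rho> \<le> \<rho>0" "\<rho> \<le> \<rho>1" using \<rho>0(1) \<rho>1(1) by (auto simp: \<rho>_def)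
  have \<rho>gate: "\<beta> ^ length dw * \<rho> \<le> 1 - val (drop k dw) (?T K0)" if "k \<le> length dw" for k
  proof -
    have "\<rho> \<le> (1 - val (drop k dw) (?T K0)) / \<beta> ^ K0" using \<rho>0(2) \<rho>(2) that dw(1) by force
    then show ?thesis using dw(1) pos_le_divide_eq[OF beta_power_pos] by (simp add: mult.commute)
  qed
  obtain f1 where f1: "hausdorff_dim (survivor_set \<beta> (t + \<rho>)) = ennreal f1" "f1 \<ge> 0"
    using dim_survivor_finite[of "t + \<rho>"] tD(1) \<rho>(1) by auto
  have "f1 < s" using tD(5)[of "t + \<rho>"] \<rho>(1) f1 s by (simp add: ennreal_less_iff)
  \<comment> \<open>Above dim K(t + \<rho>), as connecting to the gate requires; above
    \<open>s / 2\<close>, for the level L; and still below s.\<close>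
  define c where "c = (Max {f1, s / 2, c0} + s) / 2"
  have c: "f1 < c" "s / 2 < c" "c0 < c" "c < s" "0 < c"
    using \<open>f1 < s\<close> c0 \<open>0 < s\<close> by (auto simp: c_def)
  have connected: "\<exists>p q. arr t {a..<b} p Q \<and> arr t Q q {a..<b}"
    if "(a, b) \<in> P" "a < b" "X \<subseteq> {w. arr t {a..<b} w {a..<b}}" "\<not> summable_weight (\<beta> powr - s1) X" "c \<le> s1"
    for a b X s1
    unfolding Q_def
  proof (rule connected_to_gate[OF tD(1) dw(2,3) gap \<rho>gate \<rho>(1) _ _ that(2) _ that(3,4)])
    show "inside t (a, b)" "b \<in> right_ends"
      using that(1) tE stepB_funpow_bounds by (auto simp: P_def inside_def right_ends_def)
    show "\<rho> \<le> b - a" using \<rho>1(2) \<rho>(3) that(1,2) by force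
    show "hausdorff_dim (survivor_set \<beta> (t + \<rho>)) < ennreal s1"
      using f1 c(1) that(5) by (simp add: ennreal_less_iff)
  qed
  obtain av bv where v: "(av, bv) \<in> low_states t L" "inside t (av, bv)" "av < bv"
    "\<not> summable_weight (\<beta> powr - s) (loops t (av, bv))"
    "loops t (av, bv) \<subseteq> {w. arr t {av..<bv} w {av..<bv}}"
    using dim_bifurcation_recurrent_state[OF tB s \<open>0 < s\<close> L'[of s]] \<open>0 < s\<close> by auto
  let ?V = "{av..<bv}"
  have avV: "av \<in> ?V" using v(3) by simp
  obtain pv qv where pv: "arr t ?V pv Q" "arr t Q qv ?V"
    using connected[OF _ v(3,5,4)] v(1) P_low c(4) by (meson less_imp_le subsetD)
  obtain n W wtop Z where sch: "scheme t av bv n W wtop Z" and dimZ: "ennreal c \<le> hausdorff_dim Z"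
    using rich_scheme[OF tD(1) v(3) _ v(4) _ c(4)] v(5) c(5) by (metis less_imp_le mem_Collect_eq subsetD)
  define g where "g = (bv - av) / \<beta> ^ n"
  have g: "g > 0" using v(3) by (simp add: g_def)
  define r where "r = t + g / \<beta> ^ n"
  have r: "t < r" using g by (simp add: r_def)
  have Zr: "Z \<subseteq> survivor_set \<beta> r" unfolding r_def g_def by (rule scheme_survivor[OF sch v(3) tD(1)])
  have ZV: "Z \<subseteq> ?V" by (rule scheme_subset[OF sch v(3)])
  have arrW: "arr t ?V w ?V" "length w = n" if "w \<in> insert wtop W" for w
    using schemeD(4,5)[OF sch that] by blast+
  have Wlow: "av + g \<le> val w y" if "w \<in> W" "y \<in> {av..bv}" for w y
    using schemeD(6)[OF sch that] by (simp add: g_def)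
  have Wtop: "val w y \<le> val wtop av" if "w \<in> W" "y \<in> {av..bv}" for w y
    by (rule schemeD(7)[OF sch that])
  obtain wb where wb: "wb \<in> W" using schemeD(2)[OF sch] by blast
  define Vc where "Vc = {v \<in> P. \<exists>p q. arr t {fst v..<snd v} p Q \<and> arr t Q q {fst v..<snd v}}"
  have "\<exists>p q. arr t {fst v..<snd v} p ?V \<and> arr t ?V q {fst v..<snd v}" if "v \<in> Vc" for v
    using that pv arr_append unfolding Vc_def by blast
  then obtain p1 p2 where p12: "\<And>v. v \<in> Vc \<Longrightarrow> arr t {fst v..<snd v} (p1 v) ?V \<and> arr t ?V (p2 v) {fst v..<snd v}"
    by metis
  have finVc: "finite Vc" unfolding Vc_def using finP by simp
  define \<Gamma>1 where "\<Gamma>1 = (\<lambda>(v, k). val (drop k (wb @ p2 v)) (fst v)) ` (SIGMA v:Vc. {..length (wb @ p2 v)})"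
  \<comment> \<open>\<Gamma>2 is for lowering the threshold of loops from x' to t, \<Gamma>1 for
    raising that of connecting paths from t to x'. By finiteness, values other than t keep a
    distance e from t.\<close>
  define \<Gamma>2 where "\<Gamma>2 = (\<lambda>(v, u). val u (fst v)) ` (P \<times> {u. set u \<subseteq> {..<nat \<lceil>\<beta>\<rceil>} \<and> length u \<le> L})"
  have "finite (\<Gamma>1 \<union> \<Gamma>2)" unfolding \<Gamma>1_def \<Gamma>2_def using finVc finP finite_lists_length_le[of "{..<nat \<lceil>\<beta>\<rceil>}" L] by auto
  from finite_gap[OF this, of t] obtain e where e: "e > 0" "\<forall>x\<in>\<Gamma>1 \<union> \<Gamma>2. x \<noteq> t \<longrightarrow> e \<le> \<bar>x - t\<bar>" .
  have "finite ((\<lambda>v. g / \<beta> ^ length (p1 v) / \<beta> ^ L) ` Vc)" using finVc by simp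
  then obtain e1 where e1: "e1 > 0" "\<forall>x\<in>(\<lambda>v. g / \<beta> ^ length (p1 v) / \<beta> ^ L) ` Vc. e1 \<le> x"
    using finite_positive_lower_bound[of "(\<lambda>v. g / \<beta> ^ length (p1 v) / \<beta> ^ L) ` Vc"] g by auto
  \<comment> \<open>\<open>e1\<close> lets the paths \<open>p1 v\<close> absorb the shift of the
    left end, \<open>e / \<beta> ^ L\<close> keeps all shifts below e, and \<open>\<delta>A\<close>
    makes the left ends affine.\<close>
  define \<rho>2 where "\<rho>2 = Min {e1, e / \<beta> ^ L, \<delta>A}"
  have \<rho>2: "0 < \<rho>2" "\<rho>2 \<le> e1" "\<rho>2 \<le> e / \<beta> ^ L" "\<rho>2 \<le> \<delta>A"
    using e(1) e1(1) \<delta>A(1) by (auto simp: \<rho>2_def)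
  define t2 where "t2 = Min {r, t', t + \<rho>2}"
  have t2: "t < t2" "t2 \<le> r" "t2 \<le> t'" "t2 \<le> t + \<rho>2" using r t' \<rho>2(1) by (auto simp: t2_def)
  have "hausdorff_dim (survivor_set \<beta> t2) < ennreal s" using tD(5)[OF t2(1)] s by simp
  moreover have "0 \<le> t2" using t2(1) tD(1) by simp
  ultimately obtain n' W' wtop' Z' u k where "scheme t av bv n' W' wtop' Z'" and u: "arr t ?V u ?V"
    "k + 0 \<le> length u" "\<forall>y\<in>?V. val (drop k u) y < t2"
    by (rule loops_dip_below[OF tD(1) v(3,5,4)])
  \<comment> \<open>The leading \<open>wb\<close> makes l start at least g above av, which leaves
    room to the path read before it.\<close>
  define l where "l = wb @ u"
  have arrl: "arr t ?V l ?V" unfolding l_def using arr_append arrW(1)[of wb] wb u(1) by blast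
  have kl: "k + n \<le> length l" "drop (k + n) l = drop k u"
    using arrW(2)[of wb] wb u(2) by (auto simp: l_def)
  have "\<exists>w\<in>(\<lambda>j. drop j l) ` {..length l}. val w z \<in> dim_bifurcation \<beta> \<inter> {t..<t'}" if z: "z \<in> Z" for z
  proof -
    have zV: "z \<in> ?V" using z ZV by blast
    have zr: "z \<in> survivor_set \<beta> r" using z Zr by blast
    have "val (drop (k + n) l) z < r" using u(3) zV t2(2) unfolding kl(2) by force
    from minimal_orbit_point[OF arrl tD(1) zV zr kl(1) this] obtain j where j: "j \<le> length l"
      "val (drop j l) z \<in> set_bifurcation \<beta>" "\<forall>i\<le>length l. val (drop j l) z \<le> val (drop i l) z"
      "t \<le> val (drop j l) z" .
    define x where "x = val (drop j l) z"
    have "x \<le> val (drop (k + n) l) z" using j(3) kl(1) by (simp add: x_def)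
    then have x: "t \<le> x" "x < t2" using u(3) zV j(4) unfolding kl(2) by (force simp: x_def)+
    have x0: "0 \<le> x" using x(1) tD(1) by simp
    have "x \<in> dim_bifurcation \<beta>"
    proof (rule ccontr)
      assume "x \<notin> dim_bifurcation \<beta>"
      then obtain x2 where x2: "x < x2" "hausdorff_dim (survivor_set \<beta> x) \<le> hausdorff_dim (survivor_set \<beta> x2)"
        using x0 by (auto simp: dim_bifurcation_def not_less)
      \<comment> \<open>The dimension is monotone, so it is constant up to every point between x and
        x2.\<close>
      define x' where "x' = min x2 ((x + t2) / 2)"
      have x': "x < x'" "x' < t2" "x' \<le> x2" using x2(1) x(2) by (auto simp: x'_def min_def field_simps)
      have "hausdorff_dim (survivor_set \<beta> x) \<le> hausdorff_dim (survivor_set \<beta> x')"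
        using x2(2) dim_survivor_antimono[OF x'(3)] by (rule order_trans)
      then have deq: "hausdorff_dim (survivor_set \<beta> x') = hausdorff_dim (survivor_set \<beta> x)"
        using dim_survivor_antimono[of x x'] x'(1) by (simp add: order_antisym)
      obtain s1 where s1: "hausdorff_dim (survivor_set \<beta> x') = ennreal s1" "0 \<le> s1"
        using dim_survivor_finite[of x'] x0 x'(1) by auto
      have "Z \<subseteq> survivor_set \<beta> x'" using Zr survivor_antimono[of x' r] x'(2) t2(2) by auto
      then have "ennreal c \<le> ennreal s1" using dimZ hausdorff_dim_mono s1(1) by (metis order_trans)
      then have cs1: "c \<le> s1" using s1(2) by simp
      define \<eta> where "\<eta> = x' - t"
      have \<eta>: "0 < \<eta>" "\<eta> < \<rho>2" using x' x t2(4) by (auto simp: \<eta>_def)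
      have "\<beta> ^ L * \<eta> < \<beta> ^ L * (e / \<beta> ^ L)" using \<eta>(2) \<rho>2(3) by (intro mult_strict_left_mono) auto
      then have \<eta>e: "\<beta> ^ L * \<eta> < e" using beta_pos by simp
      have \<eta>L: "\<eta> \<le> \<beta> ^ i * \<eta>" "i \<le> L \<Longrightarrow> \<beta> ^ i * \<eta> \<le> \<beta> ^ L * \<eta>" for i
      proof -
        show "\<eta> \<le> \<beta> ^ i * \<eta>" using mult_right_mono[OF beta_power_ge_1[of i], of \<eta>] \<eta>(1) by simp
        show "\<beta> ^ i * \<eta> \<le> \<beta> ^ L * \<eta>" if "i \<le> L" using that \<eta>(1) beta_gt_1 by (intro mult_right_mono power_increasing) auto
      qed
      have "\<eta> < e" using \<eta>e \<eta>L(1)[of L] by simp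
      have x'1: "x' < 1"
      proof (rule ccontr)
        assume "\<not> x' < 1"
        then have "ennreal s1 = 0" using s1(1) survivor_empty[of x'] by simp
        then show False using cs1 c(5) by (simp add: ennreal_eq_0_iff)
      qed
      have "0 \<le> x'" using x0 x'(1) by simp
      have "\<not> summable_weight (\<beta> powr - s1) (paths x' {} (x', 1))"
        using not_summable_adm_words[of x' s1] \<open>0 \<le> x'\<close> cs1 c(5) s1(1) adm_words_eq_paths[OF x'1] by simp
      moreover have "inside x' (x', 1)" by (simp add: inside_def)
      moreover have "0 \<le> \<beta> powr - s1" "\<beta> powr - s1 \<le> 1" "2 * (\<beta> powr - s1) ^ L < 1"
        using L'[of s1] cs1 c(2) c(5) beta_gt_1 by (auto simp: powr_minus_divide ge_one_powr_ge_zero)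
      ultimately obtain v1 where v1: "v1 \<in> low_states x' L" "inside x' v1" "alive v1"
        "\<not> summable_weight (\<beta> powr - s1) (loops x' v1)"
        using recurrent_state[of x' "\<beta> powr - s1" L "(x', 1)"] \<open>0 \<le> x'\<close> by blast
      from v1(1) obtain i j' where ij: "i \<le> L" "j' \<le> L" "v1 = ((stepA x' ^^ i) x', (stepB ^^ j') 1)"
        by (auto simp: low_states_def)
      define a where "a = ?T i"
      define b where "b = (stepB ^^ j') 1"
      define a1 where "a1 = a + \<beta> ^ i * \<eta>"
      have v1eq: "v1 = (a1, b)"
        using \<delta>A(2)[rule_format, of x' i] ij x' x \<rho>2(4) \<eta>(2) by (simp add: a1_def a_def b_def \<eta>_def)
      have a1b: "a1 < b" using v1(3) by (simp add: v1eq alive_def)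
      have aa1: "a < a1" using \<eta>(1) by (simp add: a1_def)
      let ?J = "{a1..<b}" and ?I = "{a..<b}"
      have abP: "(a, b) \<in> P" unfolding P_def a_def b_def using ij by (intro image_eqI[of _ _ "(i, j')"]) auto
      have loopsJ: "arr x' ?J w ?J" if "w \<in> loops x' v1" for w
        using arr_run[OF v1(2), of w] that by (auto simp: loops_def itv_def v1eq)
      have a1J: "a1 \<in> ?J" using a1b by simp
      have x't: "x' = t + \<eta>" by (simp add: \<eta>_def)
      \<comment> \<open>Moving the left end from a1 down to a costs at most \<eta> in suffixes of
        length at least i, which the drop of the threshold repays. Shorter suffixes have their value
        in \<Gamma>2, too close to t to lie below it.\<close>
      have loopsI: "arr t ?I w ?I" if w: "w \<in> loops x' v1" for w
        unfolding arr_def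
      proof
        fix y assume y: "y \<in> ?I"
        have adm1: "adm x' w a1" using loopsJ[OF w] a1J by (auto simp: arr_def)
        have low: "t \<le> val (drop k w) a" if "k \<le> length w" for k
        proof -
          let ?q = "drop k w"
          have 1: "val ?q a = val ?q a1 - \<beta> ^ i * \<eta> / \<beta> ^ length ?q"
            using val_shift[of ?q a1 a] by (simp add: a1_def)
          have 2: "t + \<eta> \<le> val ?q a1" using adm_bounds[OF adm_drop[OF adm1, of k]] x't by simp
          show ?thesis
          proof (cases "i \<le> length ?q")
            case True
            have "\<beta> ^ i * \<eta> / \<beta> ^ length ?q \<le> \<beta> ^ i * \<eta> / \<beta> ^ i"
              using True \<eta>(1) beta_gt_1 by (intro divide_left_mono power_increasing mult_nonneg_nonneg) auto
            also have "\<dots> = \<eta>" using beta_pos by simp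
            finally show ?thesis using 1 2 by linarith
          next
            case False
            have "\<beta> ^ i * \<eta> / \<beta> ^ length ?q \<le> \<beta> ^ i * \<eta>" using \<eta>(1) by (intro divide_beta_power_le) simp
            then have gt: "t - e < val ?q a" using 1 2 \<eta>L(2)[OF ij(1)] \<eta>e \<eta>(1) by linarith
            have "set ?q \<subseteq> {..<nat \<lceil>\<beta>\<rceil>}"
              using set_drop_subset adm_digits[OF adm1 \<open>0 \<le> x'\<close>] by (rule order_trans)
            then have "val ?q a \<in> \<Gamma>2" unfolding \<Gamma>2_def using abP False ij(1)
              by (intro image_eqI[of _ _ "((a, b), ?q)"]) auto
            then show ?thesis using e(2) gt by force
          qed
        qed
        have up: "val (drop k w) y < 1" if "k \<le> length w" for k
        proof (cases "y < a1")
          case True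
          then have "val (drop k w) y < val (drop k w) a1" by simp
          then show ?thesis using adm_bounds[OF adm_drop[OF adm1, of k]] by (meson order_less_trans)
        next
          case False
          then have "adm x' w y" using loopsJ[OF w] y by (auto simp: arr_def)
          then show ?thesis using adm_bounds[OF adm_drop] by blast
        qed
        have "adm t w y" unfolding adm_iff_drop
        proof (intro allI impI conjI)
          fix k assume k: "k \<le> length w"
          show "val (drop k w) y < 1" by (rule up[OF k])
          have "val (drop k w) a \<le> val (drop k w) y" using y by simp
          then show "t \<le> val (drop k w) y" using low[OF k] by linarith
        qed
        moreover have "a \<le> val w y"
        proof -
          have "val w a = val w a1 - \<beta> ^ i * \<eta> / \<beta> ^ length w" using val_shift[of w a1 a] by (simp add: a1_def)
          moreover have "\<beta> ^ i * \<eta> / \<beta> ^ length w \<le> \<beta> ^ i * \<eta>" using \<eta>(1) by (intro divide_beta_power_le) simp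
          moreover have "a1 \<le> val w a1" using loopsJ[OF w] a1J by (auto simp: arr_def)
          ultimately have "a \<le> val w a" by (simp add: a1_def)
          also have "val w a \<le> val w y" using y by simp
          finally show ?thesis .
        qed
        moreover have "val w y < b"
        proof (cases "y < a1")
          case True
          then have "val w y < val w a1" by simp
          moreover have "val w a1 < b" using loopsJ[OF w] a1J by (auto simp: arr_def)
          ultimately show ?thesis by linarith
        next
          case False
          then show ?thesis using loopsJ[OF w] y by (auto simp: arr_def)
        qed
        ultimately show "adm t w y \<and> val w y \<in> ?I" by simp
      qed
      have "a < b" "loops x' v1 \<subseteq> {w. arr t ?I w ?I}" using aa1 a1b loopsI by auto
      then have "\<exists>p q. arr t ?I p Q \<and> arr t Q q ?I" by (rule connected[OF abP _ _ v1(4) cs1])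
      then have abVc: "(a, b) \<in> Vc" using abP by (simp add: Vc_def)
      define \<pi>1 \<pi>2 where "\<pi>1 = p1 (a, b)" and "\<pi>2 = p2 (a, b)"
      have \<pi>: "arr t ?I \<pi>1 ?V" "arr t ?V \<pi>2 ?I" using p12[OF abVc] by (auto simp: \<pi>1_def \<pi>2_def)
      \<comment> \<open>So many blocks of z are kept that changing the tail behind them moves x by
        less than \<open>x' - x\<close>.\<close>
      obtain m where m: "(1 / \<beta>) ^ m < (x' - x) / 2"
        using real_arch_pow_inv[of "(x' - x) / 2" "1 / \<beta>"] x'(1) beta_gt_1 by auto
      obtain um zm where um: "length um = m * n" "arr t ?V um ?V" "zm \<in> Z" "z = val um zm"
        using scheme_blocks[OF sch v(3) tD(1) z, of m] by blast
      have zmV: "zm \<in> ?V" using um(3) ZV by blast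
      \<comment> \<open>The joints of the new loop: S1 is far enough above the left end, S2 lies
        above the tail of x that is replaced.\<close>
      define S1 where "S1 = {y \<in> ?V. av + g \<le> y}"
      define S2 where "S2 = {y \<in> ?V. zm < y}"
      have A: "arr x' S1 (wb @ \<pi>2) ?J"
        unfolding arr_def
      proof
        fix y assume y: "y \<in> ?J"
        have arr2: "arr t ?V (wb @ \<pi>2) ?I" using arr_append[OF arrW(1) \<pi>(2)] wb by blast
        have aI: "a \<in> ?I" "y \<in> ?I" using aa1 a1b y by auto
        have adma: "adm t (wb @ \<pi>2) a" and admy: "adm t (wb @ \<pi>2) y" using arr2 aI by (auto simp: arr_def)
        have "x' \<le> val (drop k (wb @ \<pi>2)) y" if k: "k \<le> length (wb @ \<pi>2)" for k
        proof -
          let ?q = "drop k (wb @ \<pi>2)"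
          have qa: "t \<le> val ?q a" using adm_bounds[OF adm_drop[OF adma]] by blast
          show ?thesis
          proof (cases "length ?q \<le> i")
            case True
            have "val ?q a1 \<le> val ?q y" using y by simp
            moreover have "val ?q a1 = val ?q a + \<beta> ^ i * \<eta> / \<beta> ^ length ?q"
              using val_shift[of ?q a1 a] by (simp add: a1_def)
            moreover have "\<beta> ^ i * \<eta> / \<beta> ^ i \<le> \<beta> ^ i * \<eta> / \<beta> ^ length ?q"
              using True \<eta>(1) beta_gt_1 by (intro divide_left_mono power_increasing mult_nonneg_nonneg) auto
            moreover have "\<beta> ^ i * \<eta> / \<beta> ^ i = \<eta>" using beta_pos by simp
            ultimately show ?thesis using qa x't by linarith
          next
            case False
            \<comment> \<open>Here the orbit of t must not be preperiodic: such a return to t would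
              be later than the iterate a of t.\<close>
            have "val ?q a \<noteq> t"
            proof
              assume "val ?q a = t"
              then have "?T (length ?q) = ?T i"
                using beta_map_funpow_val[OF adm_drop[OF adma, of k] tD(1) order_refl] by (simp add: a_def)
              then show False using aper False by blast
            qed
            moreover have "val ?q a \<in> \<Gamma>1" unfolding \<Gamma>1_def \<pi>2_def
              using abVc k by (intro image_eqI[of _ _ "((a, b), k)"]) (auto simp: \<pi>2_def)
            ultimately have "t + e \<le> val ?q a" using e(2) qa by force
            moreover have "val ?q a \<le> val ?q y" using aI by simp
            ultimately show ?thesis using \<open>\<eta> < e\<close> x't by linarith
          qed
        qed
        moreover have "val (drop k (wb @ \<pi>2)) y < 1" for k
          using adm_bounds[OF adm_drop[OF admy]] by blast
        ultimately have "adm x' (wb @ \<pi>2) y" unfolding adm_iff_drop by blast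
        moreover have "val (wb @ \<pi>2) y \<in> ?V" using arr2 aI by (auto simp: arr_def)
        moreover have "val \<pi>2 y \<in> ?V" using \<pi>(2) aI by (auto simp: arr_def)
        then have "av + g \<le> val (wb @ \<pi>2) y" using Wlow[OF wb, of "val \<pi>2 y"] by simp
        ultimately show "adm x' (wb @ \<pi>2) y \<and> val (wb @ \<pi>2) y \<in> S1" by (simp add: S1_def)
      qed
      \<comment> \<open>The spare word lies to the right of all images of W, hence above zm, which
        belongs to one of them.\<close>
      have B: "arr x S2 wtop S1"
        unfolding arr_def
      proof
        fix y assume "y \<in> S1"
        then have y: "y \<in> ?V" "av + g \<le> y" by (auto simp: S1_def)
        have adma: "adm t wtop av" and admy: "adm t wtop y" "val wtop y \<in> ?V"
          using arrW(1)[of wtop] avV y(1) by (auto simp: arr_def)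
        have "x \<le> val (drop k wtop) y" for k
        proof -
          have "val (drop k wtop) y = val (drop k wtop) av + (y - av) / \<beta> ^ length (drop k wtop)"
            by (rule val_shift)
          moreover have "g / \<beta> ^ n \<le> (y - av) / \<beta> ^ length (drop k wtop)"
          proof -
            have "g / \<beta> ^ n \<le> g / \<beta> ^ length (drop k wtop)"
              using arrW(2)[of wtop] g beta_gt_1 by (intro divide_left_mono power_increasing) auto
            also have "\<dots> \<le> (y - av) / \<beta> ^ length (drop k wtop)" using y(2) by (intro divide_right_mono) auto
            finally show ?thesis .
          qed
          moreover have "t \<le> val (drop k wtop) av" using adm_bounds[OF adm_drop[OF adma]] by blast
          ultimately have "r \<le> val (drop k wtop) y" by (simp add: r_def)
          then show ?thesis using x(2) t2(2) by linarith
        qed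
        moreover have "val (drop k wtop) y < 1" for k using adm_bounds[OF adm_drop[OF admy(1)]] by blast
        ultimately have "adm x wtop y" unfolding adm_iff_drop by blast
        moreover have "zm < val wtop y"
        proof -
          obtain w z' where w: "w \<in> W" "z' \<in> Z" "zm = val w z'" using schemeD(9)[OF sch um(3)] by blast
          have "z' < bv" using w(2) ZV by auto
          then have "zm < val w bv" using w(3) by simp
          also have "\<dots> \<le> val wtop av" using Wtop[OF w(1)] v(3) by simp
          also have "\<dots> \<le> val wtop y" using y by simp
          finally show ?thesis .
        qed
        ultimately show "adm x wtop y \<and> val wtop y \<in> S2" using admy(2) by (simp add: S2_def)
      qed
      \<comment> \<open>A tail above zm only raises the suffix values. At zm they are at least x:
        along l by minimality of x, along um because z survives r.\<close>
      have C: "arr x S1 (l @ um) S2"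
        unfolding arr_def
      proof
        fix y assume "y \<in> S2"
        then have y: "y \<in> ?V" "zm < y" by (auto simp: S2_def)
        have arr3: "arr t ?V (l @ um) ?V" by (rule arr_append[OF arrl um(2)])
        have adm3: "adm t (l @ um) y" "val (l @ um) y \<in> ?V" using arr3 y(1) by (auto simp: arr_def)
        have admz: "adm t um zm" using um(2) zmV by (auto simp: arr_def)
        have "x \<le> val (drop k (l @ um)) zm" if "k \<le> length (l @ um)" for k
        proof (cases "k \<le> length l")
          case True
          then have "val (drop k (l @ um)) zm = val (drop k l) z" using um(4) by simp
          then show ?thesis using j(3) True by (simp add: x_def)
        next
          case False
          have "val (drop k (l @ um)) zm = val (drop (k - length l) um) zm" using False by simp
          also have "\<dots> = (beta_map \<beta> ^^ (k - length l)) z"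
            unfolding um(4) using beta_map_funpow_val[OF admz tD(1), of "k - length l"] that by simp
          also have "\<dots> \<ge> r" using survivor_bounds[OF survivor_funpow[OF zr]] by blast
          finally show ?thesis using x(2) t2(2) by linarith
        qed
        moreover have "val (drop k (l @ um)) zm \<le> val (drop k (l @ um)) y" for k
          using y(2) by (simp only: val_le_iff)
        ultimately have "x \<le> val (drop k (l @ um)) y" if "k \<le> length (l @ um)" for k
          using that order_trans by blast
        moreover have "val (drop k (l @ um)) y < 1" for k using adm_bounds[OF adm_drop[OF adm3(1)]] by blast
        ultimately have "adm x (l @ um) y" unfolding adm_iff_drop by blast
        moreover have "val (u @ um) y \<in> ?V" using arr_append[OF u(1) um(2)] y(1) by (auto simp: arr_def)
        then have "av + g \<le> val (l @ um) y" using Wlow[OF wb, of "val (u @ um) y"] by (simp add: l_def)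
        ultimately show "adm x (l @ um) y \<and> val (l @ um) y \<in> S1" using adm3(2) by (simp add: S1_def)
      qed
      \<comment> \<open>Starting g above av gains at least \<open>\<beta> ^ L * \<eta>\<close> at
        every suffix, enough for the threshold and for the left end a1.\<close>
      have E: "arr x ?J \<pi>1 S1"
        unfolding arr_def
      proof
        fix y assume "y \<in> S1"
        then have y: "y \<in> ?V" "av + g \<le> y" by (auto simp: S1_def)
        have adma: "adm t \<pi>1 av" "a \<le> val \<pi>1 av" and admy: "adm t \<pi>1 y" "val \<pi>1 y \<in> ?I"
          using \<pi>(1) avV y(1) by (auto simp: arr_def)
        have "e1 \<le> g / \<beta> ^ length \<pi>1 / \<beta> ^ L" using e1(2) abVc by (auto simp: \<pi>1_def)
        then have "\<eta> \<le> g / \<beta> ^ length \<pi>1 / \<beta> ^ L" using \<eta>(2) \<rho>2(2) by linarith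
        then have "\<beta> ^ L * \<eta> \<le> \<beta> ^ L * (g / \<beta> ^ length \<pi>1 / \<beta> ^ L)" by (intro mult_left_mono) auto
        then have big: "\<beta> ^ L * \<eta> \<le> g / \<beta> ^ length \<pi>1" using beta_pos by simp
        have gap1: "val (drop k \<pi>1) av + \<beta> ^ L * \<eta> \<le> val (drop k \<pi>1) y" for k
        proof -
          have "g / \<beta> ^ length \<pi>1 \<le> g / \<beta> ^ length (drop k \<pi>1)"
            using g beta_gt_1 by (intro divide_left_mono power_increasing) auto
          also have "\<dots> \<le> (y - av) / \<beta> ^ length (drop k \<pi>1)" using y(2) by (intro divide_right_mono) auto
          finally show ?thesis using big val_shift[of "drop k \<pi>1" y av] by linarith
        qed
        have "x \<le> val (drop k \<pi>1) y" for k
        proof -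
          have "t \<le> val (drop k \<pi>1) av" using adm_bounds[OF adm_drop[OF adma(1)]] by blast
          then show ?thesis using gap1[of k] \<eta>L(1)[of L] x'(1) x't by linarith
        qed
        moreover have "val (drop k \<pi>1) y < 1" for k using adm_bounds[OF adm_drop[OF admy(1)]] by blast
        ultimately have "adm x \<pi>1 y" unfolding adm_iff_drop by blast
        moreover have "a1 \<le> val \<pi>1 y"
          using gap1[of 0] adma(2) \<eta>L(2)[OF ij(1)] by (simp add: a1_def)
        ultimately show "adm x \<pi>1 y \<and> val \<pi>1 y \<in> ?J" using admy(2) by simp
      qed
      have A': "arr x S1 (wb @ \<pi>2) ?J"
        using A adm_antimono x'(1) unfolding arr_def by (meson less_imp_le)
      let ?\<kappa> = "\<pi>1 @ (l @ um) @ wtop @ wb @ \<pi>2"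
      let ?u = "drop j l @ um @ wtop @ wb @ \<pi>2"
      have \<kappa>: "arr x ?J ?\<kappa> ?J"
        by (rule arr_append[OF E arr_append[OF C arr_append[OF B A']]])
      have \<kappa>u: "?\<kappa> = (\<pi>1 @ take j l) @ ?u" by simp
      \<comment> \<open>Uniform in the tail y: \<open>?u\<close> begins with the long initial word
        of x, and whatever follows stays within 2 of zm.\<close>
      have low: "val ?u y < x'" if y: "0 \<le> y" "y < 1" for y
      proof -
        let ?w = "wtop @ wb @ \<pi>2" and ?d = "drop j l @ um"
        have "a \<in> ?I" using aa1 a1b by simp
        then have adma: "adm t ?w a"
          using arr_append[OF arrW(1)[of wtop] arr_append[OF arrW(1)[of wb] \<pi>(2)]] wb by (auto simp: arr_def)
        have "val ?w a < 1" "a < 1" "0 \<le> a" using adm_bounds[OF adma] adm_end[OF adma] tD(1) by auto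
        then have "val ?w y \<le> val ?w a + (y - a) / \<beta> ^ length ?w" using val_shift[of ?w y a] by simp
        moreover have "(y - a) / \<beta> ^ length ?w \<le> 1"
          using y \<open>0 \<le> a\<close> beta_power_ge_1[of "length ?w"] by (simp add: divide_le_eq)
        moreover have "0 \<le> zm" using zmV v(2) tD(1) by (auto simp: inside_def)
        ultimately have "val ?w y - zm \<le> 2" using \<open>val ?w a < 1\<close> by linarith
        then have "(val ?w y - zm) / \<beta> ^ length ?d \<le> 2 / \<beta> ^ length ?d" by (intro divide_right_mono) auto
        also have "\<dots> \<le> 2 / \<beta> ^ m"
        proof -
          have "m * 1 \<le> m * n" using schemeD(1)[OF sch] by (intro mult_le_mono2)
          then have "m \<le> length um" unfolding um(1) by linarith
          then have "m \<le> length ?d" by simp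
          then show ?thesis using beta_gt_1 by (intro divide_left_mono power_increasing) auto
        qed
        also have "2 / \<beta> ^ m < x' - x" using m by (simp add: power_one_over)
        finally have "val ?d zm + (val ?w y - zm) / \<beta> ^ length ?d < val ?d zm + (x' - x)"
          by (rule add_strict_left_mono)
        moreover have "val ?d zm = x" using um(4) by (simp add: x_def)
        ultimately have "val ?d (val ?w y) < x'" unfolding val_shift[of ?d "val ?w y" zm] by linarith
        moreover have "val ?u y = val ?d (val ?w y)" by simp
        ultimately show ?thesis by (simp only:)
      qed
      have "\<exists>s2>s1. \<not> summable_weight (\<beta> powr - s2) {w. arr x ?J w ?J}"
        using loopsJ by (intro loops_strict_increase[OF x0 x'(1) a1b _ v1(4) \<kappa> \<kappa>u low]) auto
      then obtain s2 where s2: "s2 > s1" "\<not> summable_weight (\<beta> powr - s2) {w. arr x ?J w ?J}" by blast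
      \<comment> \<open>An exponent above s1 that K(x) still attains, although dim K(x) equals
        s1.\<close>
      define s3 where "s3 = (s1 + s2) / 2"
      have s3: "s1 < s3" "s3 < s2" "0 \<le> s3" using s2(1) s1(2) by (auto simp: s3_def)
      obtain n3 W3 wtop3 Z3 where Z3: "scheme x a1 b n3 W3 wtop3 Z3" "ennreal s3 \<le> hausdorff_dim Z3"
        using rich_scheme[OF x0 a1b _ s2(2) s3(3,2)] by blast
      have "Z3 \<subseteq> survivor_set \<beta> (x + (b - a1) / \<beta> ^ n3 / \<beta> ^ n3)" by (rule scheme_survivor[OF Z3(1) a1b x0])
      also have "\<dots> \<subseteq> survivor_set \<beta> x" using a1b by (intro survivor_antimono) simp
      finally have "ennreal s3 \<le> ennreal s1"
        using Z3(2) hausdorff_dim_mono s1(1) deq by (metis order_trans)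
      then show False using s3 s1(2) by (simp add: ennreal_le_iff)
    qed
    moreover have "x \<in> {t..<t'}" using x t2(3) by simp
    ultimately show ?thesis using j(1) by (auto simp: x_def)
  qed
  then have "hausdorff_dim Z \<le> hausdorff_dim (dim_bifurcation \<beta> \<inter> {t..<t'})"
    by (intro hausdorff_dim_val_preimages[of "(\<lambda>j. drop j l) ` {..length l}"]) auto
  then have "ennreal c \<le> hausdorff_dim (dim_bifurcation \<beta> \<inter> {t..<t'})" using dimZ by (rule order_trans[rotated])
  moreover have "ennreal c0 \<le> ennreal c" using c(3) by (intro ennreal_leI) simp
  ultimately show ?thesis by (rule order_trans[rotated])
qed

section \<open>Avoiding the countable exceptional set\<close>

lemma countable_preperiodic:
  "countable {t. 0 \<le> t \<and> t < 1 \<and> (\<exists>i j. i \<noteq> j \<and> (beta_map \<beta> ^^ i) t = (beta_map \<beta> ^^ j) t)}"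
proof (rule countable_subset)
  \<comment> \<open>The quotient is the fixed point of \<open>val w'\<close>; a preperiodic t is a
    word w in front of such a point.\<close>
  let ?f = "\<lambda>(w, w'). val w (val w' 0 / (1 - 1 / \<beta> ^ length w'))"
  show "countable (range ?f)" by (intro countable_image) simp
  show "{t. 0 \<le> t \<and> t < 1 \<and> (\<exists>i j. i \<noteq> j \<and> (beta_map \<beta> ^^ i) t = (beta_map \<beta> ^^ j) t)} \<subseteq> range ?f"
  proof
    fix t assume "t \<in> {t. 0 \<le> t \<and> t < 1 \<and> (\<exists>i j. i \<noteq> j \<and> (beta_map \<beta> ^^ i) t = (beta_map \<beta> ^^ j) t)}"
    then have t: "0 \<le> t" "t < 1" "\<exists>i j. i \<noteq> j \<and> (beta_map \<beta> ^^ i) t = (beta_map \<beta> ^^ j) t" by auto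
    then obtain i j where ij: "i < j" "(beta_map \<beta> ^^ i) t = (beta_map \<beta> ^^ j) t"
      by (metis linorder_neqE_nat)
    have "(beta_map \<beta> ^^ n) t \<ge> 0" for n using t(1) by (cases n) (auto simp: beta_map_def)
    then have tK: "t \<in> survivor_set \<beta> 0" using t(2) by (intro in_survivorI) auto
    define y where "y = (beta_map \<beta> ^^ i) t"
    obtain w where w: "val w y = t" using survivor_expansion[OF tK, of i] by (auto simp: y_def)
    obtain w' where w': "length w' = j - i" "val w' ((beta_map \<beta> ^^ (j - i)) y) = y"
      using survivor_expansion[OF survivor_funpow[OF tK, of i], of "j - i"] by (auto simp: y_def)
    have "(beta_map \<beta> ^^ (j - i)) y = y"
      using ij funpow_add[of "j - i" i "beta_map \<beta>"] by (simp add: y_def)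
    then have "val w' y = y" using w'(2) by simp
    then have y: "y = val w' 0 + y / \<beta> ^ length w'" using val_shift[of w' y 0] by simp
    have "1 < \<beta> ^ length w'" using w'(1) ij(1) beta_gt_1 by (intro one_less_power) auto
    then have "1 - 1 / \<beta> ^ length w' \<noteq> 0" by auto
    moreover have "y * (1 - 1 / \<beta> ^ length w') = val w' 0" using y by (simp add: right_diff_distrib)
    ultimately have "y = val w' 0 / (1 - 1 / \<beta> ^ length w')" by (simp add: nonzero_eq_divide_eq)
    then show "t \<in> range ?f" using w by (intro range_eqI[of _ _ "(w, w')"]) simp
  qed
qed

text \<open>By continuity of the dimension, \<open>t\<close> is a right limit of points of \<open>dim_bifurcation\<close>, one for
  each value of the dimension just below \<open>dim K(t)\<close>. So countably many exceptions do not matter.\<close>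

lemma dim_bifurcation_right_limit:
  fixes c s :: real
  assumes tB: "t \<in> dim_bifurcation \<beta>" and s: "hausdorff_dim (survivor_set \<beta> t) = ennreal s"
    and c: "0 \<le> c" "c < s" and t': "t < t'" and N: "countable N"
  obtains t1 where "t1 \<in> dim_bifurcation \<beta> - N" "t \<le> t1" "t1 < t'"
    "ennreal c < hausdorff_dim (survivor_set \<beta> t1)"
proof -
  note tD = dim_bifurcationD[OF tB]
  let ?d = "\<lambda>r. hausdorff_dim (survivor_set \<beta> r)"
  define t2 where "t2 = (t + min t' 1) / 2"
  have t2: "t < t2" "t2 < t'" "t2 < 1" using tD(2) t' by (auto simp: t2_def min_def)
  obtain f2 where f2: "?d t2 = ennreal f2" "0 \<le> f2" using dim_survivor_finite[of t2] t2(1) tD(1) by auto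
  have "f2 < s" using tD(5)[OF t2(1)] f2 s by (simp add: ennreal_less_iff)
  \<comment> \<open>Dimensions above y0 are not attained to the right of t2, which keeps the new
    points below t'.\<close>
  define y0 where "y0 = max c f2"
  have y0: "y0 < s" "c \<le> y0" "f2 \<le> y0" "0 \<le> y0" using c f2(2) \<open>f2 < s\<close> by (auto simp: y0_def)
  define S where "S y = {r. t \<le> r \<and> ennreal y \<le> ?d r}" for y
  \<comment> \<open>The last threshold at which the dimension is at least y; left continuity shows
    that this value is still reached there.\<close>
  define \<tau> where "\<tau> y = Sup (S y)" for y
  have S_le: "r \<le> t2" if "y0 < y" "r \<in> S y" for r y
  proof (rule ccontr)
    assume "\<not> r \<le> t2"
    then have "?d r \<le> ennreal f2" using dim_survivor_antimono[of t2 r] f2 by simp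
    then have "ennreal y \<le> ennreal f2" using that(2) by (auto simp: S_def intro: order_trans)
    then show False using that(1) y0(3,4) f2(2) by (simp add: ennreal_le_iff)
  qed
  have bdd: "bdd_above (S y)" if "y0 < y" for y using S_le[OF that] by (rule bdd_aboveI)
  have tS: "t \<in> S y" if "y < s" for y using that s by (auto simp: S_def intro: ennreal_leI)
  have \<tau>_up: "?d r < ennreal y" if "y0 < y" "y < s" "\<tau> y < r" for r y
  proof (rule ccontr)
    assume "\<not> ?thesis"
    moreover have "t \<le> \<tau> y" unfolding \<tau>_def using tS bdd that by (intro cSup_upper) auto
    ultimately have "r \<in> S y" using that(3) by (auto simp: S_def not_less)
    then have "r \<le> \<tau> y" unfolding \<tau>_def using bdd that by (intro cSup_upper) auto
    with that(3) show False by simp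
  qed
  have \<tau>_bounds: "t < \<tau> y" "\<tau> y \<le> t2" if y: "y0 < y" "y < s" for y
  proof -
    have "0 \<le> y" using y y0(4) by simp
    then obtain r where r: "r > t" "ennreal y \<le> ?d r" using set_bifurcation_dim_ge(2)[OF tB s _ y(2) t'] by blast
    then have "r \<in> S y" by (simp add: S_def)
    then have "r \<le> \<tau> y" unfolding \<tau>_def using bdd y by (intro cSup_upper) auto
    with r show "t < \<tau> y" by simp
    show "\<tau> y \<le> t2" unfolding \<tau>_def using tS[OF y(2)] S_le[OF y(1)] by (intro cSup_least) auto
  qed
  have \<tau>_dim: "ennreal y \<le> ?d (\<tau> y)" if y: "y0 < y" "y < s" for y
  proof (rule ccontr)
    assume "\<not> ?thesis"
    then have "?d (\<tau> y) < ennreal y" by simp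
    then obtain e where e: "?d (\<tau> y) < e" "e < ennreal y" using dense by blast
    then obtain c' where c': "e = ennreal c'" "0 \<le> c'" by (cases e) auto
    have "0 < \<tau> y" "\<tau> y < 1" using \<tau>_bounds[OF y] tD(1) t2(3) by auto
    then obtain t0 where t0: "t0 < \<tau> y" "?d t0 \<le> ennreal c'"
      using dim_survivor_left[of "\<tau> y" c'] e(1) c' by blast
    have "r \<le> t0" if r: "r \<in> S y" for r
    proof (rule ccontr)
      assume "\<not> r \<le> t0"
      then have "?d r \<le> ennreal c'" using dim_survivor_antimono[of t0 r] t0(2) by simp
      moreover have "ennreal y \<le> ?d r" using r by (simp add: S_def)
      ultimately show False using e(2) c'(1) by (metis leD order_trans)
    qed
    then have "\<tau> y \<le> t0" unfolding \<tau>_def using tS[OF y(2)] by (intro cSup_least) auto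
    with t0(1) show False by simp
  qed
  have \<tau>_B: "\<tau> y \<in> dim_bifurcation \<beta>" if y: "y0 < y" "y < s" for y
    unfolding dim_bifurcation_def
  proof (intro CollectI conjI allI impI)
    show "0 \<le> \<tau> y" using \<tau>_bounds(1)[OF y] tD(1) by simp
    fix r assume "\<tau> y < r"
    then show "?d r < ?d (\<tau> y)" using \<tau>_up[OF y] \<tau>_dim[OF y] order_less_le_trans by blast
  qed
  \<comment> \<open>The dimension cannot jump down from y' to below y at a bifurcation point, by
    right continuity there.\<close>
  have "y = y'" if y: "y0 < y" "y < s" "y0 < y'" "y' < s" "\<tau> y = \<tau> y'" for y y'
  proof -
    have "False" if y: "y0 < y" "y < y'" "y' < s" "\<tau> y = \<tau> y'" for y y'
    proof -
      have y': "y0 < y'" "y < s" using y by auto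
      have "0 \<le> \<tau> y'" using \<tau>_bounds(1)[OF y'(1) y(3)] tD(1) by simp
      then obtain s' where s': "?d (\<tau> y') = ennreal s'" "0 \<le> s'" using dim_survivor_finite by blast
      have "y' \<le> s'" using \<tau>_dim[OF y'(1) y(3)] s' by simp
      then have "y < s'" "0 \<le> y" using y y0(4) by auto
      then obtain r where "r > \<tau> y'" "ennreal y \<le> ?d r"
        using set_bifurcation_dim_ge(2)[OF \<tau>_B[OF y'(1) y(3)] s'(1), of y "\<tau> y' + 1"] by auto
      then show False using \<tau>_up[OF y(1) y'(2), of r] y(4) by simp
    qed
    from this[of y y'] this[of y' y] y show ?thesis by (cases y y' rule: linorder_cases) auto
  qed
  then have "inj_on \<tau> {y0<..<s}" by (auto intro: inj_onI)
  moreover have "uncountable {y0<..<s}" using y0(1) by (simp add: uncountable_open_interval)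
  ultimately have "uncountable (\<tau> ` {y0<..<s})" using countable_image_inj_eq by blast
  then have "\<not> \<tau> ` {y0<..<s} \<subseteq> N" using N countable_subset by blast
  then obtain x where "x \<in> \<tau> ` {y0<..<s}" "x \<notin> N" by blast
  then obtain y where y: "y0 < y" "y < s" "\<tau> y \<notin> N" by auto
  have "ennreal c < ennreal y" using y(1) y0(2) c(1) by (simp add: ennreal_less_iff)
  then have "ennreal c < ?d (\<tau> y)" using \<tau>_dim[OF y(1,2)] by (rule order_less_le_trans)
  then show thesis using that[of "\<tau> y"] \<tau>_B[OF y(1,2)] \<tau>_bounds[OF y(1,2)] y(3) t2(2) by auto
qed

lemma dim_bifurcation_dim_ge:
  fixes c :: real
  assumes fin: "finite right_ends" and tB: "t \<in> dim_bifurcation \<beta>"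
    and c: "0 \<le> c" "ennreal c < hausdorff_dim (survivor_set \<beta> t)" and t': "t < t'"
  shows "ennreal c \<le> hausdorff_dim (dim_bifurcation \<beta> \<inter> {t..<t'})"
proof -
  obtain s where s: "hausdorff_dim (survivor_set \<beta> t) = ennreal s"
    using dim_bifurcationD(4)[OF tB] by blast
  have "c < s" using c s by (simp add: ennreal_less_iff)
  let ?N = "right_ends \<union> {t. 0 \<le> t \<and> t < 1 \<and> (\<exists>i j. i \<noteq> j \<and> (beta_map \<beta> ^^ i) t = (beta_map \<beta> ^^ j) t)}"
  have "countable ?N" using countable_preperiodic countable_finite[OF fin] by blast
  from dim_bifurcation_right_limit[OF tB s c(1) \<open>c < s\<close> t' this] obtain t1 where
    t1: "t1 \<in> dim_bifurcation \<beta> - ?N" "t \<le> t1" "t1 < t'" "ennreal c < hausdorff_dim (survivor_set \<beta> t1)" .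
  then have t1B: "t1 \<in> dim_bifurcation \<beta>" "t1 \<notin> right_ends" by auto
  have aper: "i = j" if "(beta_map \<beta> ^^ i) t1 = (beta_map \<beta> ^^ j) t1" for i j
    using t1(1) dim_bifurcationD(1,2)[OF t1B(1)] that by blast
  obtain s1 where s1: "hausdorff_dim (survivor_set \<beta> t1) = ennreal s1"
    using dim_bifurcationD(4)[OF t1B(1)] by blast
  have "c < s1" using c(1) t1(4) s1 by (simp add: ennreal_less_iff)
  have "ennreal c \<le> hausdorff_dim (dim_bifurcation \<beta> \<inter> {t1..<t'})"
    by (rule dim_bifurcation_dim_ge_aux[OF fin t1B(2) aper t1B(1) s1 c(1) \<open>c < s1\<close> t1(3)])
  also have "\<dots> \<le> hausdorff_dim (dim_bifurcation \<beta> \<inter> {t..<t'})"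
    using t1(2) by (intro hausdorff_dim_mono) auto
  finally show ?thesis .
qed

end

theorem theorem1p3:
  fixes \<beta> :: real
  assumes "\<beta> > 1"
  shows "(\<forall>t \<in> dim_bifurcation \<beta>.
            ((\<lambda>\<epsilon>. hausdorff_dim (set_bifurcation \<beta> \<inter> {t - \<epsilon><..<t + \<epsilon>}))
               \<longlongrightarrow> hausdorff_dim (survivor_set \<beta> t)) (at_right 0) \<and>
            ((\<lambda>\<epsilon>. hausdorff_dim (set_bifurcation \<beta> \<inter> {t..<t + \<epsilon>}))
               \<longlongrightarrow> hausdorff_dim (survivor_set \<beta> t)) (at_right 0))
       \<and> (eventually_periodic (quasi_greedy \<beta>) \<longrightarrow>
          (\<forall>t \<in> dim_bifurcation \<beta>.
            ((\<lambda>\<epsilon>. hausdorff_dim (dim_bifurcation \<beta> \<inter> {t - \<epsilon><..<t + \<epsilon>}))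
               \<longlongrightarrow> hausdorff_dim (survivor_set \<beta> t)) (at_right 0) \<and>
            ((\<lambda>\<epsilon>. hausdorff_dim (dim_bifurcation \<beta> \<inter> {t..<t + \<epsilon>}))
               \<longlongrightarrow> hausdorff_dim (survivor_set \<beta> t)) (at_right 0)))"
proof (intro conjI impI ballI)
  interpret beta_base \<beta> by unfold_locales (fact assms)
  fix t assume t: "t \<in> dim_bifurcation \<beta>"
  have ge: "ennreal c \<le> hausdorff_dim (set_bifurcation \<beta> \<inter> {t..<t'})"
    if c: "0 \<le> c" "ennreal c < hausdorff_dim (survivor_set \<beta> t)" "t < t'" for c t'
  proof -
    obtain s where s: "hausdorff_dim (survivor_set \<beta> t) = ennreal s"
      using dim_bifurcationD(4)[OF t] by blast
    then have "c < s" using c by (simp add: ennreal_less_iff)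
    then show ?thesis using set_bifurcation_dim_ge(1)[OF t s c(1) _ c(3)] by blast
  qed
  show "((\<lambda>\<epsilon>. hausdorff_dim (set_bifurcation \<beta> \<inter> {t - \<epsilon><..<t + \<epsilon>}))
      \<longlongrightarrow> hausdorff_dim (survivor_set \<beta> t)) (at_right 0)"
    "((\<lambda>\<epsilon>. hausdorff_dim (set_bifurcation \<beta> \<inter> {t..<t + \<epsilon>}))
      \<longlongrightarrow> hausdorff_dim (survivor_set \<beta> t)) (at_right 0)"
    using local_dimension[OF t order_refl ge] by blast+
  assume "eventually_periodic (quasi_greedy \<beta>)"
  then have fin: "finite right_ends" by (rule finite_right_ends)
  have "dim_bifurcation \<beta> \<subseteq> set_bifurcation \<beta>" using dim_bifurcationD(3) by blast
  from local_dimension[OF t this dim_bifurcation_dim_ge[OF fin t]]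
  show "((\<lambda>\<epsilon>. hausdorff_dim (dim_bifurcation \<beta> \<inter> {t - \<epsilon><..<t + \<epsilon>}))
      \<longlongrightarrow> hausdorff_dim (survivor_set \<beta> t)) (at_right 0)"
    "((\<lambda>\<epsilon>. hausdorff_dim (dim_bifurcation \<beta> \<inter> {t..<t + \<epsilon>}))
      \<longlongrightarrow> hausdorff_dim (survivor_set \<beta> t)) (at_right 0)"
    by blast+
qed

end
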